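(* Let $N\ge 1$, let $\Omega\subset\mathbb{R}^N$ be a bounded domain with smooth boundary containing the origin as an interior point. Suppose that for $x=(x_1,\dots,x_N)\in\bar\Omega$, $m(x)=a_0+\sum_{i=1}^N a_i x_i^2$ with $a_0\in\mathbb{R}$, $a_i\in\mathbb{R}\setminus\{0\}$ for $i=1,\dots,N$ and $\sum_{i=1}^N a_i=0$, and assume $0\le V\in C^\gamma(\bar\Omega)$ for some $0<\gamma<1$. Fix $\varepsilon>0$, and for $\alpha>0$ let $(\lambda_\alpha,u_\alpha)$ be the unique principal eigenpair (see context) of $-\varepsilon\Delta\phi-2\alpha\nabla m\cdot\nabla\phi+V\phi=\lambda_\alpha\phi$ in $\Omega$, $\phi=0$ on $\partial\Omega$. Then $$\lim_{\alpha\to+\infty}\alpha^{-1}\lambda_\alpha=2\sum_{j=1}^N|a_j|>0.$$ Moreover, extending $u_\alpha$ by $u_\alpha\equiv 0$ in $\mathbb{R}^N\setminus\Omega$ and letting $d_\alpha\in\Omega$ be a global maximum point of $u_\alpha$, one has $$\hat w_\alpha(x):=\alpha^{-\frac N4}u_\alpha\big(\alpha^{-\frac12}x+d_\alpha\big)\to Q(x):=\Big(\prod_{i=1}^N\frac{2|a_i|}{\varepsilon\pi}\Big)^{\frac14}e^{-\frac1\varepsilon\sum_{j=1}^N|a_j|x_j^2}$$ strongly in $H^1(\mathbb{R}^N)\cap L^\infty(\mathbb{R}^N)$ as $\alpha\to+\infty$, and $$\lim_{\alpha\to+\infty}\alpha^{\frac12}|d_\alpha|=0.$$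
   Context: Principal eigenpair: for each $\alpha>0$ the problem $-\varepsilon\Delta\phi-2\alpha\nabla m\cdot\nabla\phi+V\phi=\lambda\phi$ in $\Omega$, $\phi=0$ on $\partial\Omega$, has a unique principal (first) eigenvalue $\lambda_\alpha$, with a positive eigenfunction $\phi_\alpha>0$ unique up to multiplication by constants. The function $u_\alpha$ is the positive multiple of $e^{\frac{\alpha}{\varepsilon}m}\phi_\alpha$ normalized by $\|u_\alpha\|_{L^2(\Omega)}=1$. Equivalently, $u_\alpha>0$ is the positive minimizer in $$\lambda_\alpha=\inf_{\{u\in H_0^1(\Omega),\ \int_\Omega u^2dx=1\}}\Big\{\int_\Omega\varepsilon|\nabla u|^2dx+\int_\Omega\Big[\frac{\alpha^2}{\varepsilon}|\nabla m|^2+\alpha\Delta m+V(x)\Big]u^2dx\Big\},$$ and satisfies $-\varepsilon\Delta u_\alpha+\big[\frac{\alpha^2}{\varepsilon}|\nabla m|^2+\alpha\Delta m+V\big]u_\alpha=\lambda_\alpha u_\alpha$, $u_\alpha\in H_0^1(\Omega)$. The pair $(\lambda_\alpha,u_\alpha)$ is called the unique principal eigenpair. *)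

theory Defs
  imports "HOL-Analysis.Analysis" "HOL-Probability.Essential_Supremum"
begin

section \<open>Classical derivatives and smoothness\<close>

definition partial :: "'n::finite \<Rightarrow> (real^'n \<Rightarrow> real) \<Rightarrow> real^'n \<Rightarrow> real" where
  "partial i f x = frechet_derivative f (at x) (axis i 1)"

definition grad :: "(real^'n::finite \<Rightarrow> real) \<Rightarrow> real^'n \<Rightarrow> real^'n" where
  "grad f x = (\<chi> i. partial i f x)"

definition laplacian :: "(real^'n::finite \<Rightarrow> real) \<Rightarrow> real^'n \<Rightarrow> real" where
  "laplacian f x = (\<Sum>i\<in>UNIV. partial i (partial i f) x)"

text \<open>Intended for open \<open>S\<close>: the derivatives are taken at interior points.\<close>

primrec Ck_on :: "nat \<Rightarrow> (real^'n::finite) set \<Rightarrow> (real^'n \<Rightarrow> real) \<Rightarrow> bool" where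
  "Ck_on 0 S f \<longleftrightarrow> continuous_on S f"
| "Ck_on (Suc k) S f \<longleftrightarrow> (\<forall>x\<in>S. f differentiable (at x)) \<and> (\<forall>i. Ck_on k S (partial i f))"

definition Cinf_on :: "(real^'n::finite) set \<Rightarrow> (real^'n \<Rightarrow> real) \<Rightarrow> bool" where
  "Cinf_on S f \<longleftrightarrow> (\<forall>k. Ck_on k S f)"

definition holder_on :: "real \<Rightarrow> (real^'n::finite) set \<Rightarrow> (real^'n \<Rightarrow> real) \<Rightarrow> bool" where
  "holder_on \<gamma> S f \<longleftrightarrow> (\<exists>C. \<forall>x\<in>S. \<forall>y\<in>S. \<bar>f x - f y\<bar> \<le> C * dist x y powr \<gamma>)"

text \<open>
  Near every boundary point the set is the region on one side of the graph of a smooth function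
  of the other \<open>N - 1\<close> coordinates. A function of those coordinates is encoded as a function
  on the whole space that does not depend on coordinate \<open>i\<close>; the sign \<open>s\<close> gives
  the orientation of the axis.
\<close>

definition smooth_boundary :: "(real^'n::finite) set \<Rightarrow> bool" where
  "smooth_boundary \<Omega> \<longleftrightarrow>
     (\<forall>p\<in>frontier \<Omega>. \<exists>r>0. \<exists>i. \<exists>s\<in>{-1, 1}. \<exists>g.
        Cinf_on UNIV g \<and> (\<forall>x t. g (x + t *\<^sub>R axis i 1) = g x) \<and>
        \<Omega> \<inter> ball p r = {x \<in> ball p r. s * x $ i > g x})"

definition smooth_bounded_domain :: "(real^'n::finite) set \<Rightarrow> bool" where
  "smooth_bounded_domain \<Omega> \<longleftrightarrow>
     open \<Omega> \<and> connected \<Omega> \<and> \<Omega> \<noteq> {} \<and> bounded \<Omega> \<and> smooth_boundary \<Omega>"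


section \<open>Function spaces\<close>

definition L2 :: "'a measure \<Rightarrow> ('a \<Rightarrow> real) set" where
  "L2 M = {f \<in> borel_measurable M. integrable M (\<lambda>x. (f x)\<^sup>2)}"

definition L2_norm :: "'a measure \<Rightarrow> ('a \<Rightarrow> real) \<Rightarrow> real" where
  "L2_norm M f = sqrt (LINT x|M. (f x)\<^sup>2)"

definition Linf :: "(real^'n::finite \<Rightarrow> real) set" where
  "Linf = {f \<in> borel_measurable lebesgue. esssup lebesgue (\<lambda>x. ereal \<bar>f x\<bar>) < \<infinity>}"

definition Linf_norm :: "(real^'n::finite \<Rightarrow> real) \<Rightarrow> real" where
  "Linf_norm f = real_of_ereal (esssup lebesgue (\<lambda>x. ereal \<bar>f x\<bar>))"

definition test_function :: "(real^'n::finite \<Rightarrow> real) \<Rightarrow> bool" where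
  "test_function \<psi> \<longleftrightarrow> Cinf_on UNIV \<psi> \<and> compact (closure {x. \<psi> x \<noteq> 0})"

definition has_L2_weak_gradient ::
    "(real^'n::finite \<Rightarrow> real) \<Rightarrow> (real^'n \<Rightarrow> real^'n) \<Rightarrow> bool" where
  "has_L2_weak_gradient f G \<longleftrightarrow>
     (\<forall>i. (\<lambda>x. G x $ i) \<in> L2 lebesgue) \<and>
     (\<forall>\<psi> i. test_function \<psi> \<longrightarrow>
        (LINT x|lebesgue. f x * partial i \<psi> x) = - (LINT x|lebesgue. G x $ i * \<psi> x))"

definition H1 :: "(real^'n::finite \<Rightarrow> real) set" where
  "H1 = {f \<in> L2 lebesgue. \<exists>G. has_L2_weak_gradient f G}"

text \<open>
  The weak gradient of \<open>f\<close> is unique up to null sets, so for \<open>f \<in> H1\<close> the infimum is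
  taken over a single value; it only serves to avoid choosing a representative.
\<close>

definition H1_norm :: "(real^'n::finite \<Rightarrow> real) \<Rightarrow> real" where
  "H1_norm f = (INF G\<in>{G. has_L2_weak_gradient f G}.
      sqrt ((L2_norm lebesgue f)\<^sup>2 + (\<Sum>i\<in>UNIV. (L2_norm lebesgue (\<lambda>x. G x $ i))\<^sup>2)))"


section \<open>The principal eigenpair\<close>

text \<open>A positive classical solution of the Dirichlet eigenvalue problem.\<close>

definition principal_eigenfunction ::
    "real \<Rightarrow> real \<Rightarrow> (real^'n::finite \<Rightarrow> real) \<Rightarrow> (real^'n \<Rightarrow> real) \<Rightarrow> (real^'n) set \<Rightarrow>
     real \<Rightarrow> (real^'n \<Rightarrow> real) \<Rightarrow> bool" where
  "principal_eigenfunction \<epsilon> \<alpha> m V \<Omega> lam \<phi> \<longleftrightarrow>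
     Ck_on 2 \<Omega> \<phi> \<and> continuous_on (closure \<Omega>) \<phi> \<and>
     (\<forall>x\<in>\<Omega>. - \<epsilon> * laplacian \<phi> x - 2 * \<alpha> * (grad m x \<bullet> grad \<phi> x) + V x * \<phi> x = lam * \<phi> x) \<and>
     (\<forall>x\<in>frontier \<Omega>. \<phi> x = 0) \<and>
     (\<forall>x\<in>\<Omega>. \<phi> x > 0)"

definition principal_eigenpair ::
    "real \<Rightarrow> real \<Rightarrow> (real^'n::finite \<Rightarrow> real) \<Rightarrow> (real^'n \<Rightarrow> real) \<Rightarrow> (real^'n) set \<Rightarrow>
     real \<Rightarrow> (real^'n \<Rightarrow> real) \<Rightarrow> bool" where
  "principal_eigenpair \<epsilon> \<alpha> m V \<Omega> lam u \<longleftrightarrow>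
     (\<exists>\<phi> c. principal_eigenfunction \<epsilon> \<alpha> m V \<Omega> lam \<phi> \<and> c > 0 \<and>
        (\<forall>x\<in>closure \<Omega>. u x = c * (exp (\<alpha> / \<epsilon> * m x) * \<phi> x))) \<and>
     u \<in> L2 (lebesgue_on \<Omega>) \<and> L2_norm (lebesgue_on \<Omega>) u = 1"

definition zero_extension :: "(real^'n::finite) set \<Rightarrow> (real^'n \<Rightarrow> real) \<Rightarrow> real^'n \<Rightarrow> real" where
  "zero_extension \<Omega> u x = (if x \<in> \<Omega> then u x else 0)"

definition rescaled :: "real \<Rightarrow> (real^'n::finite \<Rightarrow> real) \<Rightarrow> real^'n \<Rightarrow> real^'n \<Rightarrow> real" where
  "rescaled \<alpha> u d x = \<alpha> powr (- real CARD('n) / 4) * u (\<alpha> powr (- 1/2) *\<^sub>R x + d)"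

definition gaussian_profile :: "real \<Rightarrow> ('n::finite \<Rightarrow> real) \<Rightarrow> real^'n \<Rightarrow> real" where
  "gaussian_profile \<epsilon> a x =
     (\<Prod>i\<in>UNIV. 2 * \<bar>a i\<bar> / (\<epsilon> * pi)) powr (1/4) *
     exp (- (1 / \<epsilon>) * (\<Sum>j\<in>UNIV. \<bar>a j\<bar> * (x $ j)\<^sup>2))"

end

theory Submission
  imports Defs "HOL-Probability.Distributions" "HOL-Real_Asymp.Real_Asymp"
begin

text \<open>
  In the variable \<open>y = \<alpha>\<^bsup>1/2\<^esup> x\<close> the rescaled eigenfunction \<open>v\<close> solves
  \<open>\<Delta>v = (|By|\<^sup>2 + q - \<nu>) v\<close> with \<open>B = diag (2|a\<^sub>i|/\<epsilon>)\<close>, \<open>q = V/(\<alpha>\<epsilon>) \<rightarrow> 0\<close> and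
  \<open>\<nu> = \<lambda>/(\<alpha>\<epsilon>)\<close>: a perturbed harmonic oscillator, whose ground state is the Gaussian
  \<open>G = exp (- y \<bullet> By / 2)\<close> with eigenvalue \<open>\<beta> = tr B\<close>.
  The maximum principle applied to \<open>v/G\<close> gives \<open>\<nu> \<ge> \<beta>\<close>, and applied to \<open>(G - c)/v\<close> on
  \<open>{G \<ge> c}\<close> it gives \<open>limsup \<nu> \<le> \<beta>\<close>. Integrating by parts,
  \<open>\<integral>|\<nabla>v + v By|\<^sup>2 \<le> \<nu> - \<beta> \<rightarrow> 0\<close>; as \<open>\<nabla>(v/G) = (\<nabla>v + v By)/G\<close>, averages of \<open>v/G\<close> over balls of a
  fixed small radius become constant. Since \<open>\<Delta>v\<close> is locally bounded, \<open>v\<close> is close to its own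
  averages, so \<open>v - v(0) G \<rightarrow> 0\<close> locally uniformly. A Gaussian barrier for the tail of \<open>v\<close> makes
  dominated convergence available, which identifies \<open>v(0)\<close> by the normalization and yields
  all the limits; no elliptic regularity theory is needed.
\<close>

section \<open>Integration by parts\<close>

text \<open>The eigenfunction is C^2 inside the domain and only continuous up to the boundary. Hence
  every global integration by parts is done for a truncation of v, supported in a compact set {v >=
  e} inside the domain, and then e tends to 0. The two comparisons differ because v vanishes outside
  the domain and G does not: v/G has an interior maximum by itself, whereas G must first be lowered
  by a constant c so that (G - c)/v is 0 on the boundary of {G >= c}. The field \<nabla>v + v By is
  the annihilation operator of the oscillator applied to v; it vanishes on the multiples of G, and
  its L2 norm measures the deviation of v from them. The same field gives the H^1 convergence,
  because \<nabla>v is recovered from it and from v By, which has no derivatives. Comparing averages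
  over balls of radius r costs a factor r^-N, so r is fixed before \<alpha> tends to infinity. All
  estimates are centred at the origin. The shift to the maximum point comes last, when uniform
  convergence and the strict peak of G at 0 already force that point, in the variable y, to tend to
  0.\<close>

lemma lborel_affine_integrable_iff:
  fixes f :: "'a::euclidean_space \<Rightarrow> real"
  assumes [measurable]: "f \<in> borel_measurable borel" and "c \<noteq> 0"
  shows "integrable lborel (\<lambda>x. f (t + c *\<^sub>R x)) \<longleftrightarrow> integrable lborel f"
  by (subst (2) lborel_affine[OF \<open>c \<noteq> 0\<close>, of t])
     (use \<open>c \<noteq> 0\<close> in \<open>simp add: integrable_density integrable_distr_eq\<close>)

lemma lborel_affine_integral:
  fixes f :: "'a::euclidean_space \<Rightarrow> real"
  assumes [measurable]: "f \<in> borel_measurable borel" and "c \<noteq> 0"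
  shows "(LINT x|lborel. f x) = \<bar>c\<bar> ^ DIM('a) * (LINT x|lborel. f (t + c *\<^sub>R x))"
  by (subst lborel_affine[OF \<open>c \<noteq> 0\<close>, of t])
     (use \<open>c \<noteq> 0\<close> in \<open>simp add: integral_density integral_distr\<close>)

lemma lborel_translate_integral:
  fixes f :: "'a::euclidean_space \<Rightarrow> real"
  assumes "f \<in> borel_measurable borel"
  shows "(LINT x|lborel. f (x + t)) = (LINT x|lborel. f x)"
  using lborel_affine_integral[OF assms, of 1 t] by (simp add: add.commute)

lemma lborel_translate_integrable_iff:
  fixes f :: "'a::euclidean_space \<Rightarrow> real"
  assumes "f \<in> borel_measurable borel"
  shows "integrable lborel (\<lambda>x. f (x + t)) \<longleftrightarrow> integrable lborel f"
  using lborel_affine_integrable_iff[OF assms, of 1 t] by (simp add: add.commute)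

lemma continuous_on_extend_zero:
  fixes f :: "'a::euclidean_space \<Rightarrow> 'b::real_normed_vector"
  assumes "compact K" "open U" "K \<subseteq> U" "continuous_on U f" "\<And>x. x \<notin> K \<Longrightarrow> f x = 0"
  shows "continuous_on UNIV f"
proof -
  have "continuous_on (U \<union> - K) f"
  proof (rule continuous_on_open_Un)
    show "open (- K)" using assms(1) by (simp add: compact_imp_closed open_Compl)
    show "continuous_on (- K) f"
      by (rule continuous_on_cong[THEN iffD2, OF refl _ continuous_on_const[of _ 0]]) (use assms in auto)
  qed (use assms in auto)
  moreover have "U \<union> - K = UNIV" using assms by auto
  ultimately show ?thesis by simp
qed

lemma integrable_compact_support:
  fixes f :: "'a::euclidean_space \<Rightarrow> real"
  assumes "compact K" "continuous_on K f" "\<And>x. x \<notin> K \<Longrightarrow> f x = 0"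
  shows "integrable lborel f"
proof -
  have "integrable lborel (\<lambda>x. indicator K x *\<^sub>R f x)"
    using borel_integrable_compact[OF assms(1,2)] .
  moreover have "(\<lambda>x. indicator K x *\<^sub>R f x) = f"
    by (rule ext) (use assms(3) in \<open>auto simp: indicator_def\<close>)
  ultimately show ?thesis by simp
qed

lemma integrable_dominated:
  fixes f :: "'a::euclidean_space \<Rightarrow> real"
  assumes "integrable lborel w" "f \<in> borel_measurable borel" "\<And>x. \<bar>f x\<bar> \<le> w x"
  shows "integrable lborel f"
  by (rule Bochner_Integration.integrable_bound[OF assms(1)])
     (use assms in \<open>auto intro: order_trans[OF _ abs_ge_self]\<close>)

lemma integral_tendsto_dominated:
  fixes f :: "'a::euclidean_space \<Rightarrow> real"
  assumes "integrable lborel w" "f \<in> borel_measurable borel" "\<And>n. s n \<in> borel_measurable borel"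
    and "\<And>n x. \<bar>s n x\<bar> \<le> w x" "\<And>x. (\<lambda>n. s n x) \<longlonglongrightarrow> f x"
  shows "(\<lambda>n. LINT x|lborel. s n x) \<longlonglongrightarrow> (LINT x|lborel. f x)"
  by (rule integral_dominated_convergence[OF _ _ assms(1)]) (use assms in auto)

lemma integral_tendsto_0_dominated:
  fixes s :: "real \<Rightarrow> 'a::euclidean_space \<Rightarrow> real"
  assumes "integrable lborel w" "\<And>t. s t \<in> borel_measurable borel"
    and "eventually (\<lambda>t. \<forall>x. \<bar>s t x\<bar> \<le> w x) at_top" "\<And>x. ((\<lambda>t. s t x) \<longlongrightarrow> 0) at_top"
  shows "((\<lambda>t. LINT x|lborel. s t x) \<longlongrightarrow> 0) at_top"
proof -
  have "((\<lambda>t. LINT x|lborel. s t x) \<longlongrightarrow> (LINT x|(lborel::'a measure). 0)) at_top"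
    by (rule integral_dominated_convergence_at_top[where w=w])
       (use assms in \<open>auto elim: eventually_mono\<close>)
  then show ?thesis by simp
qed

text \<open>The integral of \<open>f (x + t e)\<close> does not depend on \<open>t\<close>; differentiate at \<open>t = 0\<close>.\<close>

lemma integral_directional_derivative_eq_0:
  fixes f f' :: "'a::euclidean_space \<Rightarrow> real" and e :: 'a
  assumes K: "compact K" and U: "open U" "K \<subseteq> U"
    and f: "continuous_on U f" "\<And>x. x \<notin> K \<Longrightarrow> f x = 0"
    and f': "continuous_on U f'" "\<And>x. x \<notin> K \<Longrightarrow> f' x = 0"
    and deriv: "\<And>x. x \<in> U \<Longrightarrow> ((\<lambda>t. f (x + t *\<^sub>R e)) has_real_derivative f' x) (at 0)"
  shows "(LINT x|lborel. f' x) = 0"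
proof -
  have cf: "continuous_on UNIV f" and cf': "continuous_on UNIV f'"
    using continuous_on_extend_zero[OF K U] f f' by auto
  have [measurable]: "f \<in> borel_measurable borel" "f' \<in> borel_measurable borel"
    using cf cf' by (auto intro: borel_measurable_continuous_onI)
  have intf: "integrable lborel f"
    by (rule integrable_compact_support[OF K _ f(2)]) (use cf continuous_on_subset in auto)
  \<comment> \<open>Off \<open>U\<close> the function vanishes near \<open>x\<close>, the complement
    of \<open>K\<close> being open; so the derivative exists at every point of the space.\<close>
  have d0: "((\<lambda>t. f (x + t *\<^sub>R e)) has_real_derivative f' x) (at 0)" for x
  proof (cases "x \<in> U")
    case False
    then have xK: "x \<in> - K" using U by auto
    have "open ((\<lambda>t. x + t *\<^sub>R e) -` (- K))"
      by (intro open_vimage open_Compl compact_imp_closed K continuous_intros)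
    then have "eventually (\<lambda>t. t \<in> (\<lambda>t. x + t *\<^sub>R e) -` (- K)) (nhds 0)"
      using xK by (intro eventually_nhds_in_open) auto
    then have "eventually (\<lambda>t. f (x + t *\<^sub>R e) = 0) (nhds (0::real))"
      by eventually_elim (use f in auto)
    then have "((\<lambda>t. f (x + t *\<^sub>R e)) has_real_derivative 0) (at 0)"
      by (subst DERIV_cong_ev[OF refl _ refl]) auto
    then show ?thesis using f'(2) xK by auto
  qed (use deriv in auto)
  have d: "((\<lambda>t. f (x + t *\<^sub>R e)) has_real_derivative f' (x + s *\<^sub>R e)) (at s)" for x s
  proof -
    have "((\<lambda>t. f ((x + s *\<^sub>R e) + t *\<^sub>R e)) has_real_derivative f' (x + s *\<^sub>R e)) (at 0)"
      by (rule d0)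
    then have "((\<lambda>t. f (x + (s + t) *\<^sub>R e)) has_real_derivative f' (x + s *\<^sub>R e)) (at 0)"
      by (simp add: algebra_simps)
    then show ?thesis
      using DERIV_at_within_shift[where f="\<lambda>t. f (x + t *\<^sub>R e)" and z=s and x=0 and S=UNIV] by simp
  qed
  obtain C where C: "\<And>x. x \<in> K \<Longrightarrow> norm (f' x) \<le> C" "C > 0"
    using compact_imp_bounded[OF compact_continuous_image[OF continuous_on_subset[OF cf'] K]]
    by (auto simp: bounded_pos)
  have C: "\<bar>f' x\<bar> \<le> C" for x
    using C f'(2)[of x] by (cases "x \<in> K") auto
  define h where "h n = 1 / real (Suc n)" for n
  have h: "0 < h n" "h n \<le> 1" for n by (auto simp: h_def)
  have h0: "h \<longlonglongrightarrow> 0" unfolding h_def by real_asymp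
  \<comment> \<open>All points that a shift by \<open>t *\<^sub>R e\<close> with 0 <= t <= 1 can
    carry into \<open>K\<close>. Outside this compact set the difference quotients vanish, so
    \<open>C\<close> times its indicator dominates them.\<close>
  define K' where "K' = (\<lambda>(x, t). x - t *\<^sub>R e) ` (K \<times> {0..1::real})"
  have K': "compact K'" unfolding K'_def
    by (intro compact_continuous_image compact_Times K compact_Icc) (auto intro!: continuous_intros simp: case_prod_unfold)
  define q where "q n x = (f (x + h n *\<^sub>R e) - f x) / h n" for n x
  have qmeas [measurable]: "q n \<in> borel_measurable borel" for n
    unfolding q_def by measurable
  have "(\<lambda>n. LINT x|lborel. q n x) \<longlonglongrightarrow> (LINT x|lborel. f' x)"
  proof (rule integral_tendsto_dominated[where w="\<lambda>x. C * indicator K' x"])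
    show "(\<lambda>n. q n x) \<longlonglongrightarrow> f' x" for x
    proof -
      have "((\<lambda>t. (f (x + t *\<^sub>R e) - f x) / t) \<longlongrightarrow> f' x) (at 0)"
        using d0[of x] by (simp add: DERIV_def)
      then show "(\<lambda>n. q n x) \<longlonglongrightarrow> f' x"
        unfolding q_def by (rule filterlim_compose) (use h h0 in \<open>auto simp: filterlim_at less_imp_neq[THEN not_sym]\<close>)
    qed
    show "integrable lborel (\<lambda>x. C * indicator K' x)"
      by (rule integrable_mult_right, rule integrable_real_indicator)
        (use emeasure_compact_finite[OF K'] borel_compact[OF K'] in simp_all)
    show "\<bar>q n x\<bar> \<le> C * indicator K' x" for n x
    proof -
      obtain s where s: "s > 0" "s < h n" "f (x + h n *\<^sub>R e) - f (x + 0 *\<^sub>R e) = (h n - 0) * f' (x + s *\<^sub>R e)"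
        using MVT2[of 0 "h n" "\<lambda>t. f (x + t *\<^sub>R e)" "\<lambda>t. f' (x + t *\<^sub>R e)"] d h by auto
      then have q: "q n x = f' (x + s *\<^sub>R e)" using h[of n] by (simp add: q_def)
      show "\<bar>q n x\<bar> \<le> C * indicator K' x"
      proof (cases "x + s *\<^sub>R e \<in> K")
        case True
        then have "x \<in> K'" unfolding K'_def
          using s h[of n] by (intro image_eqI[of _ _ "(x + s *\<^sub>R e, s)"]) auto
        then show ?thesis using C q by simp
      next
        case False
        then show ?thesis using q f'(2) C[of x] by (auto simp: indicator_def)
      qed
    qed
  qed auto
  moreover have "(LINT x|lborel. q n x) = 0" for n
  proof -
    have "(LINT x|lborel. q n x) = ((LINT x|lborel. f (x + h n *\<^sub>R e)) - (LINT x|lborel. f x)) / h n"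
      unfolding q_def using intf by (simp add: lborel_translate_integrable_iff)
    then show ?thesis by (simp add: lborel_translate_integral)
  qed
  ultimately show ?thesis by (simp add: LIMSEQ_const_iff)
qed

section \<open>Derivatives, the maximum principle and local averages\<close>

lemma gderiv_line:
  fixes f :: "'a::real_inner \<Rightarrow> real"
  assumes "GDERIV f (p + s *\<^sub>R q) :> D"
  shows "((\<lambda>t. f (p + t *\<^sub>R q)) has_real_derivative (D \<bullet> q)) (at s within S)"
proof -
  have "((\<lambda>t. p + t *\<^sub>R q) has_derivative (\<lambda>t. t *\<^sub>R q)) (at s within S)"
    by (auto intro!: derivative_eq_intros)
  moreover have "(f has_derivative (\<lambda>h. h \<bullet> D)) (at (p + s *\<^sub>R q))"
    using assms by (simp add: gderiv_def)
  ultimately have "((\<lambda>t. f (p + t *\<^sub>R q)) has_derivative (\<lambda>t. (t *\<^sub>R q) \<bullet> D)) (at s within S)"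
    by (rule has_derivative_compose)
  then show ?thesis
    by (simp add: has_field_derivative_def inner_commute mult.commute[of _ "D \<bullet> q"])
qed

abbreviation has_partial :: "(real^'n::finite \<Rightarrow> real) \<Rightarrow> 'n \<Rightarrow> real \<Rightarrow> real^'n \<Rightarrow> bool" where
  "has_partial f i c x \<equiv> ((\<lambda>t. f (x + t *\<^sub>R axis i 1)) has_real_derivative c) (at 0)"

lemma has_partial_mult:
  "has_partial f i c x \<Longrightarrow> has_partial g i d x \<Longrightarrow> has_partial (\<lambda>x. f x * g x) i (c * g x + d * f x) x"
  by (drule (1) DERIV_mult) simp

lemma has_partial_coordinate: "has_partial (\<lambda>x. b i * x $ i) i (b i) x"
  by (auto intro!: derivative_eq_intros simp: axis_def)

lemma gderiv_partial:
  fixes f :: "real^'n::finite \<Rightarrow> real"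
  assumes "GDERIV f x :> D"
  shows "has_partial f i (D $ i) x"
  using gderiv_line[of f x 0 "axis i 1" D UNIV] assms by (simp add: inner_axis)

lemma gderiv_imp_continuous_on:
  assumes "\<And>x. x \<in> S \<Longrightarrow> GDERIV f x :> g x"
  shows "continuous_on S f"
  using assms by (intro continuous_at_imp_continuous_on) (auto simp: gderiv_def dest: has_derivative_continuous)

text \<open>Since F'(0) = 0, a positive \<open>c\<close> would make F' positive just to the right of
  0, and F would increase there.\<close>

lemma second_derivative_le_0_at_max:
  fixes F :: "real \<Rightarrow> real"
  assumes r: "r > 0" and F: "\<And>t. \<bar>t\<bar> < r \<Longrightarrow> (F has_real_derivative F' t) (at t)"
    and c: "(F' has_real_derivative c) (at 0)"
    and max: "\<And>t. \<bar>t\<bar> < r \<Longrightarrow> F t \<le> F 0"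
  shows "c \<le> 0"
proof (rule ccontr)
  assume "\<not> c \<le> 0"
  then have "c > 0" by simp
  have F'0: "F' 0 = 0"
    by (rule DERIV_local_max[OF F[of 0] r]) (use r max in auto)
  obtain s where s: "s > 0" "\<And>h. h > 0 \<Longrightarrow> h < s \<Longrightarrow> F' 0 < F' (0 + h)"
    using DERIV_pos_inc_right[OF c \<open>c > 0\<close>] by auto
  define h where "h = min r s / 2"
  have h: "h > 0" "h < r" "h < s" using r s by (auto simp: h_def)
  obtain z where z: "z > 0" "z < h" "F h - F 0 = (h - 0) * F' z"
    using MVT2[of 0 h F F'] F h by auto
  then have "F' z > 0" using s(2)[of z] h F'0 by auto
  then have "h * F' z > 0" using h by simp
  then show False using max[of h] h z by auto
qed

lemma laplacian_le_0_at_max: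
  fixes f :: "real^'n::finite \<Rightarrow> real"
  assumes "open U" "x \<in> U" and f: "\<And>y. y \<in> U \<Longrightarrow> GDERIV f y :> g y"
    and l: "\<And>i. has_partial (\<lambda>x. g x $ i) i (l i) x"
    and max: "\<And>y. y \<in> U \<Longrightarrow> f y \<le> f x"
  shows "(\<Sum>i\<in>UNIV. l i) \<le> 0"
proof (rule sum_nonpos)
  fix i :: 'n
  obtain r where r: "r > 0" "ball x r \<subseteq> U"
    using assms(1,2) by (auto simp: open_contains_ball)
  have U: "x + t *\<^sub>R axis i 1 \<in> U" if "\<bar>t\<bar> < r" for t
    using r that by (auto simp: dist_norm norm_axis_1 subset_eq)
  show "l i \<le> 0"
  proof (rule second_derivative_le_0_at_max[OF r(1) _ l[of i]])
    show "((\<lambda>t. f (x + t *\<^sub>R axis i 1)) has_real_derivative g (x + t *\<^sub>R axis i 1) $ i) (at t)"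
      if "\<bar>t\<bar> < r" for t
      using gderiv_line[of f x t "axis i 1", OF f[OF U[OF that]]] by (simp add: inner_axis)
  qed (use U max in auto)
qed

text \<open>From the second power on, the positive part is C^1: at 0 the difference quotient is one
  power lower and tends to 0. Both the bump weights and the truncations of \<open>v\<close> rest on
  this.\<close>

lemma DERIV_max_0_power:
  "((\<lambda>t::real. max 0 t ^ Suc (Suc n)) has_real_derivative real (n + 2) * max 0 t ^ Suc n) (at t)"
proof -
  consider "t < 0" | "t > 0" | "t = 0" by linarith
  then show ?thesis
  proof cases
    case 1
    have "((\<lambda>s. max 0 s ^ Suc (Suc n)) has_real_derivative 0) (at t)"
      by (rule has_field_derivative_transform_within_open[OF DERIV_const[of 0] open_lessThan[of 0]])
         (use 1 in auto)
    then show ?thesis using 1 by simp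
  next
    case 2
    have "((\<lambda>s. s ^ Suc (Suc n)) has_real_derivative real (n + 2) * t ^ Suc n) (at t)"
      using DERIV_pow[of "Suc (Suc n)" t] by (simp add: algebra_simps)
    then have "((\<lambda>s. max 0 s ^ Suc (Suc n)) has_real_derivative real (n + 2) * t ^ Suc n) (at t)"
      by (rule has_field_derivative_transform_within_open[OF _ open_greaterThan[of 0]])
         (use 2 in auto)
    then show ?thesis using 2 by simp
  next
    case 3
    have "((\<lambda>h::real. max 0 h ^ Suc n) \<longlongrightarrow> max 0 0 ^ Suc n) (at 0)"
      by (intro tendsto_intros)
    then have lim: "((\<lambda>h::real. max 0 h ^ Suc n) \<longlongrightarrow> 0) (at 0)"
      by simp
    have eq: "max 0 h ^ Suc (Suc n) / h = max 0 h ^ Suc n" if "h \<noteq> 0" for h :: real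
      using that by (auto simp: max_def)
    have "((\<lambda>h::real. max 0 h ^ Suc (Suc n) / h) \<longlongrightarrow> 0) (at 0)"
      by (rule Lim_transform_eventually[OF lim]) (simp add: eventually_at_filter eq del: power_Suc)
    then show ?thesis using 3 by (simp add: DERIV_def)
  qed
qed

lemma gderiv_compose:
  assumes "GDERIV f x :> D" "(h has_real_derivative c) (at (f x))"
  shows "GDERIV (\<lambda>y. h (f y)) x :> c *\<^sub>R D"
  using GDERIV_DERIV_compose[OF assms] by simp

text \<open>The gradient of such a power is a multiple of \<open>y\<close> times the preceding
  power, so the vector weight \<open>bump 2\<close> times \<open>y\<close> is itself a
  gradient.\<close>

definition bump :: "nat \<Rightarrow> 'a::euclidean_space \<Rightarrow> real" where
  "bump k y = max 0 (1 - y \<bullet> y) ^ k"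

lemma bump_nonneg: "0 \<le> bump k y" by (simp add: bump_def)

lemma bump_le_1: "bump k y \<le> 1"
  by (auto simp: bump_def max_def intro!: power_le_one)

lemma bump_pos: "norm y < 1 \<Longrightarrow> 0 < bump k y"
  by (simp add: bump_def dot_square_norm abs_square_less_1 less_max_iff_disj)

lemma bump_eq_0: "k > 0 \<Longrightarrow> norm y \<ge> 1 \<Longrightarrow> bump k y = 0"
  by (simp add: bump_def dot_square_norm)

lemma bump_Suc_le: "bump (Suc k) y \<le> bump k y"
  by (auto simp: bump_def max_def mult_left_le_one_le)

lemma continuous_on_bump: "continuous_on S (bump k)"
  unfolding bump_def by (intro continuous_intros)

lemma gderiv_bump:
  "GDERIV (bump (Suc (Suc k))) y :> (- 2 * real (k + 2) * bump (Suc k) y) *\<^sub>R (y::'a::euclidean_space)"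
proof -
  have "GDERIV (\<lambda>y::'a. 1 - y \<bullet> y) y :> - (2 *\<^sub>R y)"
    unfolding gderiv_def by (auto intro!: derivative_eq_intros simp: inner_commute inner_add_left)
  from gderiv_compose[OF this DERIV_max_0_power[of k]] show ?thesis
    unfolding bump_def by (simp add: algebra_simps)
qed

lemma integrable_bump: "k > 0 \<Longrightarrow> integrable lborel (bump k :: 'a::euclidean_space \<Rightarrow> real)"
  by (rule integrable_compact_support[OF compact_cball[of 0 1]])
     (auto intro: continuous_on_bump simp: bump_eq_0)

lemma integral_bump_pos: "k > 0 \<Longrightarrow> 0 < (LINT y|lborel. bump k (y::'a::euclidean_space))"
proof (rule ccontr)
  assume k: "k > 0" and "\<not> 0 < (LINT y|lborel. bump k (y::'a))"
  then have "(LINT y|lborel. bump k (y::'a)) = 0"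
    using Bochner_Integration.integral_nonneg[of "lborel :: 'a measure" "bump k"] bump_nonneg
    by (metis antisym not_less)
  then have "AE y in lborel. bump k (y::'a) = 0"
    using integral_nonneg_eq_0_iff_AE[OF integrable_bump[OF k]] bump_nonneg[of k] by auto
  then have "AE y in lborel. y \<notin> ball (0::'a) 1"
    by eventually_elim (metis bump_pos less_irrefl mem_ball_0)
  then have "ball (0::'a) 1 \<in> null_sets lborel"
    by (subst AE_iff_null_sets) auto
  then have "negligible (ball (0::'a) 1)"
    by (simp add: negligible_iff_null_sets null_sets_completionI)
  then show False
    using open_not_negligible[OF open_ball, of "0::'a" 1] by simp
qed

text \<open>The Leibniz rule used below integrates over boxes, so the unit ball is enlarged to the
  cube of half-side 1. Its points have norm at most the dimension N, which is why balls of radius N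
  inside \<open>D\<close> appear in later hypotheses.\<close>

lemma cbox_One_norm_le:
  fixes y :: "'a::euclidean_space"
  assumes "y \<in> cbox (- One) One"
  shows "norm y \<le> real DIM('a)"
proof -
  have "norm y \<le> (\<Sum>i\<in>Basis. \<bar>y \<bullet> i\<bar>)" by (rule norm_le_l1)
  also have "\<dots> \<le> (\<Sum>i\<in>(Basis::'a set). 1)"
  proof (rule sum_mono)
    fix i :: 'a assume "i \<in> Basis"
    then have "- 1 \<le> y \<bullet> i \<and> y \<bullet> i \<le> 1" using assms by (simp add: mem_box)
    then show "\<bar>y \<bullet> i\<bar> \<le> 1" by linarith
  qed
  finally show ?thesis by simp
qed

lemma norm_le_1_cbox_One:
  fixes y :: "'a::euclidean_space"
  assumes "norm y \<le> 1" shows "y \<in> cbox (- One) One"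
proof -
  have "- 1 \<le> y \<bullet> i \<and> y \<bullet> i \<le> 1" if "i \<in> Basis" for i
    using Basis_le_norm[OF that, of y] assms by linarith
  then show ?thesis by (simp add: mem_box)
qed

lemma lborel_integral_eq_integral_cbox:
  fixes f :: "'a::euclidean_space \<Rightarrow> real"
  assumes "continuous_on (cbox a b) f" "\<And>x. x \<notin> cbox a b \<Longrightarrow> f x = 0"
  shows "(LINT x|lborel. f x) = integral (cbox a b) f"
proof -
  have "(LINT x|lborel. f x) = integral UNIV f"
    using integral_lborel[OF integrable_compact_support[OF compact_cbox assms]] by simp
  also have "\<dots> = integral UNIV (\<lambda>x. if x \<in> cbox a b then f x else 0)"
    using assms(2) by (intro arg_cong[of _ _ "integral UNIV"]) auto
  finally show ?thesis by (simp add: integral_restrict_UNIV)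
qed

text \<open>Translations and dilations of the ball are treated at once: \<open>z\<close> moves the
  centre, \<open>s\<close> changes the radius. Averages of v are dilated (\<open>z\<close> = 0,
  \<open>r\<close> = 0, \<open>s\<close> = 1), those of v/G are translated (\<open>s\<close> =
  0).\<close>

lemma DERIV_local_average:
  fixes f :: "'a::euclidean_space \<Rightarrow> real"
  assumes gd: "\<And>x. x \<in> D \<Longrightarrow> GDERIV f x :> g x" and g: "continuous_on D g"
    and D: "\<And>t y. 0 \<le> t \<Longrightarrow> t \<le> 1 \<Longrightarrow> norm y \<le> real DIM('a) \<Longrightarrow> p + t *\<^sub>R z + (r + t * s) *\<^sub>R y \<in> D"
    and \<phi>: "continuous_on UNIV \<phi>" "\<And>y. norm y > 1 \<Longrightarrow> \<phi> y = 0"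
    and t: "0 \<le> t" "t \<le> 1"
  shows "((\<lambda>t. LINT y|lborel. f (p + t *\<^sub>R z + (r + t * s) *\<^sub>R y) * \<phi> y) has_real_derivative
           (LINT y|lborel. (g (p + t *\<^sub>R z + (r + t * s) *\<^sub>R y) \<bullet> (z + s *\<^sub>R y)) * \<phi> y)) (at t within {0..1})"
proof -
  let ?C = "cbox (- One) One :: 'a set"
  have D': "p + t *\<^sub>R z + (r + t * s) *\<^sub>R y \<in> D" if "t \<in> {0..1}" "y \<in> ?C" for t y
    using that D cbox_One_norm_le by auto
  have \<phi>0: "\<phi> y = 0" if "y \<notin> ?C" for y
    using that \<phi>(2) norm_le_1_cbox_One by force
  have cf: "continuous_on D f"
    using gd by (rule gderiv_imp_continuous_on)
  have c1: "continuous_on ?C (\<lambda>y. f (p + t *\<^sub>R z + (r + t * s) *\<^sub>R y) * \<phi> y)" if "t \<in> {0..1}" for t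
    by (intro continuous_intros continuous_on_compose2[OF cf] continuous_on_subset[OF \<phi>(1)]) (use D' that in auto)
  have c2: "continuous_on ({0..1} \<times> ?C) (\<lambda>(t, y). (g (p + t *\<^sub>R z + (r + t * s) *\<^sub>R y) \<bullet> (z + s *\<^sub>R y)) * \<phi> y)"
    unfolding case_prod_unfold
    by (intro continuous_intros continuous_on_compose2[OF g] continuous_on_compose2[OF \<phi>(1)]) (use D' in auto)
  have c3: "continuous_on ?C (\<lambda>y. (g (p + t *\<^sub>R z + (r + t * s) *\<^sub>R y) \<bullet> (z + s *\<^sub>R y)) * \<phi> y)" if "t \<in> {0..1}" for t
    by (intro continuous_intros continuous_on_compose2[OF g] continuous_on_subset[OF \<phi>(1)]) (use D' that in auto)
  have d: "((\<lambda>t. integral ?C (\<lambda>y. f (p + t *\<^sub>R z + (r + t * s) *\<^sub>R y) * \<phi> y)) has_real_derivative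
      integral ?C (\<lambda>y. (g (p + t *\<^sub>R z + (r + t * s) *\<^sub>R y) \<bullet> (z + s *\<^sub>R y)) * \<phi> y)) (at t within {0..1})"
  proof (rule leibniz_rule_field_derivative[OF _ _ c2])
    fix t y assume ty: "t \<in> {0..1::real}" "y \<in> ?C"
    have "((\<lambda>t. f ((p + r *\<^sub>R y) + t *\<^sub>R (z + s *\<^sub>R y))) has_real_derivative
        g (p + t *\<^sub>R z + (r + t * s) *\<^sub>R y) \<bullet> (z + s *\<^sub>R y)) (at t within {0..1})"
      by (rule gderiv_line) (use gd[OF D'[OF ty]] in \<open>simp add: algebra_simps\<close>)
    then show "((\<lambda>t. f (p + t *\<^sub>R z + (r + t * s) *\<^sub>R y) * \<phi> y) has_real_derivative
        (g (p + t *\<^sub>R z + (r + t * s) *\<^sub>R y) \<bullet> (z + s *\<^sub>R y)) * \<phi> y) (at t within {0..1})"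
      by (intro DERIV_cmult_right) (simp add: algebra_simps)
  qed (use c1 t in \<open>auto intro: integrable_continuous\<close>)
  have eq: "(LINT y|lborel. f (p + t *\<^sub>R z + (r + t * s) *\<^sub>R y) * \<phi> y)
      = integral ?C (\<lambda>y. f (p + t *\<^sub>R z + (r + t * s) *\<^sub>R y) * \<phi> y)" if "t \<in> {0..1}" for t
    using c1[OF that] by (rule lborel_integral_eq_integral_cbox) (use \<phi>0 in auto)
  have eq': "(LINT y|lborel. (g (p + t *\<^sub>R z + (r + t * s) *\<^sub>R y) \<bullet> (z + s *\<^sub>R y)) * \<phi> y)
      = integral ?C (\<lambda>y. (g (p + t *\<^sub>R z + (r + t * s) *\<^sub>R y) \<bullet> (z + s *\<^sub>R y)) * \<phi> y)"
    using c3[of t] by (rule lborel_integral_eq_integral_cbox) (use t \<phi>0 in auto)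
  show ?thesis
    unfolding eq' has_field_derivative_def
    by (rule has_derivative_transform[OF _ eq d[unfolded has_field_derivative_def]]) (use t in auto)
qed

section \<open>Gaussians\<close>

text \<open>Here \<theta> = 1 is the ground state, -1 its reciprocal, 2 its square and 1/2 the
  barrier for the tail. Quadratic factors and bounded shifts are paid for by halving \<theta>, so
  all dominating functions stay in this family.\<close>

definition egauss :: "('n::finite \<Rightarrow> real) \<Rightarrow> real \<Rightarrow> real^'n \<Rightarrow> real" where
  "egauss b \<theta> x = exp (- (\<theta> / 2) * (\<Sum>i\<in>UNIV. b i * (x $ i)^2))"

definition diag_mult :: "('n::finite \<Rightarrow> real) \<Rightarrow> real^'n \<Rightarrow> real^'n" where
  "diag_mult b x = (\<chi> i. b i * x $ i)"

lemma diag_mult_nth [simp]: "diag_mult b x $ i = b i * x $ i"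
  by (simp add: diag_mult_def)

lemma continuous_on_diag_mult: "continuous_on S (diag_mult b)"
  unfolding diag_mult_def by (intro continuous_intros)

lemma egauss_pos: "0 < egauss b \<theta> x"
  by (simp add: egauss_def)

lemma egauss_0 [simp]: "egauss b \<theta> 0 = 1"
  by (simp add: egauss_def)

lemma continuous_on_egauss: "continuous_on S (egauss b \<theta>)"
  unfolding egauss_def by (intro continuous_intros)

lemma egauss_measurable [measurable]: "egauss b \<theta> \<in> borel_measurable borel"
  by (rule borel_measurable_continuous_onI) (rule continuous_on_egauss)

lemma egauss_mult: "egauss b \<theta> x * egauss b \<theta>' x = egauss b (\<theta> + \<theta>') x"
  by (simp add: egauss_def exp_add[symmetric] algebra_simps add_divide_distrib)

lemma egauss_power2: "(egauss b \<theta> x)^2 = egauss b (2 * \<theta>) x"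
  by (simp add: power2_eq_square egauss_mult)

lemma egauss_inverse: "egauss b \<theta> x * egauss b (- \<theta>) x = 1"
  by (simp add: egauss_mult) (simp add: egauss_def)

lemma gderiv_egauss:
  "GDERIV (egauss b \<theta>) x :> (- \<theta> * egauss b \<theta> x) *\<^sub>R diag_mult b x"
proof -
  have nth: "((\<lambda>x::real^'a. x $ i) has_derivative (\<lambda>h. h $ i)) (at x)" for i
    by (rule bounded_linear_imp_has_derivative[OF bounded_linear_vec_nth])
  have "GDERIV (\<lambda>x. - (\<theta> / 2) * (\<Sum>i\<in>UNIV. b i * (x $ i)^2)) x :> (- \<theta>) *\<^sub>R diag_mult b x"
    unfolding gderiv_def
    by (auto intro!: derivative_eq_intros nth ext
      simp: inner_vec_def sum_distrib_left power2_eq_square algebra_simps sum_negf)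
  from gderiv_compose[OF this DERIV_exp] show ?thesis
    by (simp add: egauss_def[abs_def] mult.commute)
qed

text \<open>Summed over \<open>i\<close>, the factor becomes \<theta>^2 |Bx|^2 - \<theta> tr B; at
  \<theta> = 1 this is the oscillator equation with eigenvalue tr B.\<close>

lemma egauss_second_derivative:
  "has_partial (\<lambda>x. ((- \<theta> * egauss b \<theta> x) *\<^sub>R diag_mult b x) $ i) i
     (((\<theta> * (b i * x $ i))^2 - \<theta> * b i) * egauss b \<theta> x) x"
  using DERIV_cmult[OF has_partial_mult[OF gderiv_partial[OF gderiv_egauss[of b \<theta> x], of i]
    has_partial_coordinate[of b]], of "- \<theta>"]
  by (simp add: power2_eq_square algebra_simps)

lemma Basis_vec_eq: "(Basis :: (real^'n::finite) set) = range (\<lambda>i. axis i 1)"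
  by (auto simp: Basis_vec_def)

lemma nn_integral_gauss_real:
  assumes "c > 0"
  shows "(\<integral>\<^sup>+t. ennreal (exp (- (c / 2) * t^2)) \<partial>lborel) = ennreal (sqrt (2 * pi / c))"
proof -
  define \<sigma> where "\<sigma> = 1 / sqrt c"
  have \<sigma>: "\<sigma> > 0" "\<sigma>^2 = 1 / c" using assms by (auto simp: \<sigma>_def power_divide)
  have eq: "exp (- (c / 2) * t^2) = sqrt (2 * pi / c) * normal_density 0 \<sigma> t" for t
    using assms by (simp add: normal_density_def \<sigma>)
  have "(\<integral>\<^sup>+t. ennreal (exp (- (c / 2) * t^2)) \<partial>lborel) = ennreal (LINT t|lborel. sqrt (2 * pi / c) * normal_density 0 \<sigma> t)"
    unfolding eq using assms \<sigma>
    by (intro nn_integral_eq_integral integrable_mult_right AE_I2) auto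
  then show ?thesis using \<sigma> by simp
qed

lemma nn_integral_egauss:
  fixes b :: "'n::finite \<Rightarrow> real"
  assumes "\<theta> > 0" "\<And>i. b i > 0"
  shows "(\<integral>\<^sup>+x. ennreal (egauss b \<theta> x) \<partial>lborel) = ennreal (\<Prod>i\<in>UNIV. sqrt (2 * pi / (\<theta> * b i)))"
proof -
  \<comment> \<open>The product formula is indexed by basis vectors; this linear form reads the
    coefficient \<open>b i\<close> off the vector \<open>axis i 1\<close>.\<close>
  define B where "B u = (\<Sum>i\<in>UNIV. b i * u $ i)" for u :: "real^'n"
  have B [simp]: "B (axis i 1) = b i" for i
    by (simp add: B_def axis_def if_distrib cong: if_cong)
  have inj: "inj (\<lambda>i::'n. axis i (1::real))" by (auto simp: inj_on_def axis_eq_axis)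
  define f where "f u t = ennreal (exp (- ((\<theta> * B u) / 2) * t^2))" for u t
  have eq: "ennreal (egauss b \<theta> x) = (\<Prod>u\<in>Basis. f u (x \<bullet> u))" for x
    unfolding Basis_vec_eq f_def
    by (subst prod.reindex[OF inj])
       (simp add: inner_axis prod_ennreal exp_sum[symmetric] egauss_def sum_distrib_left algebra_simps)
  have "(\<integral>\<^sup>+x. ennreal (egauss b \<theta> x) \<partial>lborel) = (\<Prod>u\<in>Basis. (\<integral>\<^sup>+t. f u t \<partial>lborel))"
    unfolding eq
    by (rule nn_integral_lborel_prod) (auto simp: f_def)
  also have "\<dots> = (\<Prod>i\<in>UNIV. ennreal (sqrt (2 * pi / (\<theta> * b i))))"
  proof -
    have "(\<integral>\<^sup>+t. f (axis i 1) t \<partial>lborel) = ennreal (sqrt (2 * pi / (\<theta> * b i)))" for i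
      using nn_integral_gauss_real[of "\<theta> * b i"] assms by (simp add: f_def)
    then show ?thesis unfolding Basis_vec_eq by (subst prod.reindex[OF inj]) simp
  qed
  also have "\<dots> = ennreal (\<Prod>i\<in>UNIV. sqrt (2 * pi / (\<theta> * b i)))"
    by (rule prod_ennreal) (use assms in \<open>simp add: less_imp_le\<close>)
  finally show ?thesis .
qed

lemma
  fixes b :: "'n::finite \<Rightarrow> real"
  assumes "\<theta> > 0" "\<And>i. b i > 0"
  shows integrable_egauss: "integrable lborel (egauss b \<theta>)"
    and integral_egauss: "(LINT x|lborel. egauss b \<theta> x) = (\<Prod>i\<in>UNIV. sqrt (2 * pi / (\<theta> * b i)))"
proof -
  have "0 \<le> (\<Prod>i\<in>UNIV. sqrt (2 * pi / (\<theta> * b i)))"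
    using assms by (intro prod_nonneg) (simp add: less_imp_le)
  then have "has_bochner_integral lborel (egauss b \<theta>) (\<Prod>i\<in>UNIV. sqrt (2 * pi / (\<theta> * b i)))"
    using nn_integral_egauss[OF assms] by (intro has_bochner_integral_nn_integral) (auto simp: less_imp_le[OF egauss_pos])
  then show "integrable lborel (egauss b \<theta>)"
    "(LINT x|lborel. egauss b \<theta> x) = (\<Prod>i\<in>UNIV. sqrt (2 * pi / (\<theta> * b i)))"
    by (auto simp: has_bochner_integral_iff)
qed

lemma component_power2_le: "(x $ i)^2 \<le> (norm (x::real^'n::finite))^2"
  using component_le_norm_cart[of x i] by (metis abs_ge_zero power2_abs power_mono)

lemma norm_power2_eq_sum: "(norm (x::real^'n::finite))^2 = (\<Sum>i\<in>UNIV. (x $ i)^2)"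
  by (simp add: norm_vec_def L2_set_def sum_nonneg)

lemma egauss_ge:
  assumes "\<theta> \<ge> 0" "\<And>i. b i > 0" "norm x \<le> R"
  shows "exp (- (\<theta> / 2) * ((\<Sum>i\<in>UNIV. b i) * R^2)) \<le> egauss b \<theta> x"
proof -
  have "(\<Sum>i\<in>UNIV. b i * (x $ i)^2) \<le> (\<Sum>i\<in>UNIV. b i * R^2)"
    by (intro sum_mono mult_left_mono)
       (use assms(2) order_trans[OF component_power2_le power_mono[OF assms(3)]] in \<open>auto simp: less_imp_le\<close>)
  then show ?thesis
    using assms(1) by (simp add: egauss_def sum_distrib_right mult_left_mono)
qed

lemma egauss_le:
  assumes "\<theta> \<ge> 0" "\<And>i. b i \<ge> c" "c \<ge> 0" "norm x \<ge> R" "R \<ge> 0"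
  shows "egauss b \<theta> x \<le> exp (- (\<theta> / 2) * (c * R^2))"
proof -
  have "c * R^2 \<le> c * (norm x)^2"
    using assms by (intro mult_left_mono power_mono) auto
  also have "\<dots> = (\<Sum>i\<in>UNIV. c * (x $ i)^2)"
    by (simp add: norm_power2_eq_sum sum_distrib_left)
  also have "\<dots> \<le> (\<Sum>i\<in>UNIV. b i * (x $ i)^2)"
    by (intro sum_mono mult_right_mono) (use assms in auto)
  finally show ?thesis
    using assms(1) by (simp add: egauss_def mult_left_mono)
qed

lemma egauss_le_1:
  assumes "\<theta> \<ge> 0" "\<And>i. b i > 0"
  shows "egauss b \<theta> x \<le> 1"
  using egauss_le[of \<theta> 0 b 0 x] assms by (simp add: less_imp_le)

text \<open>In each coordinate (x + y)^2 >= x^2/2 - y^2, so half of the quadratic form survives a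
  shift of length at most 1.\<close>

lemma egauss_translate_le:
  assumes "\<theta> \<ge> 0" "\<And>i. b i > 0" "norm y \<le> 1"
  shows "egauss b \<theta> (x + y) \<le> exp (\<theta> / 2 * (\<Sum>i\<in>UNIV. b i)) * egauss b (\<theta> / 2) x"
proof -
  have "b i * (x $ i)^2 / 2 - b i \<le> b i * ((x + y) $ i)^2" for i
  proof -
    have "(y $ i)^2 \<le> 1"
      using component_power2_le[of y i] assms(3) by (smt (verit) norm_ge_zero power_le_one)
    moreover have "0 \<le> (x $ i + 2 * y $ i)^2" by simp
    ultimately have "(x $ i)^2 / 2 - 1 \<le> ((x + y) $ i)^2"
      by (simp add: power2_eq_square algebra_simps)
    then have "b i * ((x $ i)^2 / 2 - 1) \<le> b i * ((x + y) $ i)^2"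
      using assms(2)[of i] by (intro mult_left_mono) auto
    then show ?thesis by (simp add: algebra_simps)
  qed
  then have "(\<Sum>i\<in>UNIV. b i * (x $ i)^2 / 2 - b i) \<le> (\<Sum>i\<in>UNIV. b i * ((x + y) $ i)^2)"
    by (rule sum_mono)
  then have "(\<Sum>i\<in>UNIV. b i * (x $ i)^2) / 2 - (\<Sum>i\<in>UNIV. b i) \<le> (\<Sum>i\<in>UNIV. b i * ((x + y) $ i)^2)"
    by (simp add: sum_subtractf sum_divide_distrib)
  from mult_left_mono[OF this, of "\<theta> / 2"] assms(1) show ?thesis
    by (simp add: egauss_def exp_add[symmetric] algebra_simps)
qed

text \<open>The inequality s <= exp s, taken at \<theta>/4 times the quadratic form, trades the
  factor for half of the decay rate.\<close>

lemma quadratic_mult_egauss_le: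
  assumes "\<theta> > 0"
  shows "(\<Sum>i\<in>UNIV. b i * (x $ i)^2) * egauss b \<theta> x \<le> 4 / \<theta> * egauss b (\<theta> / 2) x"
proof -
  let ?s = "\<Sum>i\<in>UNIV. b i * (x $ i)^2"
  have "\<theta> / 4 * ?s \<le> exp (\<theta> / 4 * ?s)"
    using exp_ge_add_one_self[of "\<theta> / 4 * ?s"] by linarith
  then have "\<theta> / 4 * ?s * egauss b \<theta> x \<le> exp (\<theta> / 4 * ?s) * egauss b \<theta> x"
    by (rule mult_right_mono) (simp add: egauss_pos less_imp_le)
  also have "\<dots> = egauss b (\<theta> / 2) x"
    by (simp add: egauss_def exp_add[symmetric] algebra_simps)
  finally show ?thesis using assms by (simp add: field_simps)
qed

section \<open>Weak gradients and norms\<close>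

lemma gderiv_grad:
  fixes f :: "real^'n::finite \<Rightarrow> real"
  assumes "f differentiable (at x)"
  shows "GDERIV f x :> grad f x"
proof -
  let ?F = "frechet_derivative f (at x)"
  have F: "(f has_derivative ?F) (at x)" using assms frechet_derivative_works by blast
  then have lin: "linear ?F" by (simp add: has_derivative_linear)
  have "?F h = h \<bullet> grad f x" for h
  proof -
    have "?F h = ?F (\<Sum>i\<in>UNIV. h $ i *\<^sub>R axis i 1)"
      using basis_expansion[of h] by (simp add: scalar_mult_eq_scaleR)
    also have "\<dots> = (\<Sum>i\<in>UNIV. h $ i * partial i f x)"
      by (simp add: linear_sum[OF lin] linear_scale[OF lin] partial_def)
    finally show ?thesis by (simp add: inner_vec_def grad_def)
  qed
  then have "?F = (\<lambda>h. h \<bullet> grad f x)" by auto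
  then show ?thesis using F by (simp add: gderiv_def)
qed

lemma DERIV_partial:
  assumes "f differentiable (at x)"
  shows "has_partial f i (partial i f x) x"
  using gderiv_partial[OF gderiv_grad[OF assms], of i] by (simp add: grad_def)

text \<open>A wider class than the smooth test functions: one continuous partial derivative and a
  compact set off which both functions vanish. This is what integration by parts uses, and it is
  directly stable under translation.\<close>

definition test_pair ::
    "(real^'n::finite) set \<Rightarrow> 'n \<Rightarrow> (real^'n \<Rightarrow> real) \<Rightarrow> (real^'n \<Rightarrow> real) \<Rightarrow> bool" where
  "test_pair K i \<psi> \<psi>' \<longleftrightarrow> compact K \<and> continuous_on UNIV \<psi> \<and> continuous_on UNIV \<psi>' \<and>
     (\<forall>x. x \<notin> K \<longrightarrow> \<psi> x = 0) \<and> (\<forall>x. x \<notin> K \<longrightarrow> \<psi>' x = 0) \<and> (\<forall>x. has_partial \<psi> i (\<psi>' x) x)"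

lemma test_pairD:
  assumes "test_pair K i \<psi> \<psi>'"
  shows "compact K" "continuous_on S \<psi>" "continuous_on S \<psi>'"
    "\<And>x. x \<notin> K \<Longrightarrow> \<psi> x = 0" "\<And>x. x \<notin> K \<Longrightarrow> \<psi>' x = 0" "\<And>x. has_partial \<psi> i (\<psi>' x) x"
    "\<psi> \<in> borel_measurable borel" "\<psi>' \<in> borel_measurable borel"
    "integrable lborel (\<lambda>x. (\<psi> x)^2)" "integrable lborel (\<lambda>x. (\<psi>' x)^2)"
proof -
  have *: "compact K" "continuous_on UNIV \<psi>" "continuous_on UNIV \<psi>'"
    "\<And>x. x \<notin> K \<Longrightarrow> \<psi> x = 0" "\<And>x. x \<notin> K \<Longrightarrow> \<psi>' x = 0" "\<And>x. has_partial \<psi> i (\<psi>' x) x"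
    using assms by (simp_all add: test_pair_def)
  show c: "continuous_on S \<psi>" "continuous_on S \<psi>'" for S
    using *(2,3) continuous_on_subset by blast+
  show "\<psi> \<in> borel_measurable borel" "\<psi>' \<in> borel_measurable borel"
    using *(2,3) by (auto intro: borel_measurable_continuous_onI)
  show "integrable lborel (\<lambda>x. (\<psi> x)^2)" "integrable lborel (\<lambda>x. (\<psi>' x)^2)"
    by (rule integrable_compact_support[OF *(1)]; use *(4,5) c in \<open>auto intro!: continuous_intros\<close>)+
qed (use assms in \<open>simp_all add: test_pair_def\<close>)

text \<open>A stronger form of \<open>has_L2_weak_gradient\<close>, with Borel functions, the
  measure \<open>lborel\<close> and the wider test class; differences and translates are then easy.
  \<open>is_weak_grad_imp\<close> converts back.\<close>

definition is_weak_grad :: "(real^'n::finite \<Rightarrow> real) \<Rightarrow> (real^'n \<Rightarrow> real^'n) \<Rightarrow> bool" where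
  "is_weak_grad f G \<longleftrightarrow>
     f \<in> borel_measurable borel \<and> integrable lborel (\<lambda>x. (f x)^2) \<and>
     (\<forall>i. (\<lambda>x. G x $ i) \<in> borel_measurable borel \<and> integrable lborel (\<lambda>x. (G x $ i)^2)) \<and>
     (\<forall>\<psi> \<psi>' i K. test_pair K i \<psi> \<psi>' \<longrightarrow> (LINT x|lborel. f x * \<psi>' x) = - (LINT x|lborel. G x $ i * \<psi> x))"

lemma is_weak_gradD:
  assumes "is_weak_grad f G"
  shows "f \<in> borel_measurable borel" "integrable lborel (\<lambda>x. (f x)^2)"
    "(\<lambda>x. G x $ i) \<in> borel_measurable borel" "integrable lborel (\<lambda>x. (G x $ i)^2)"
  using assms unfolding is_weak_grad_def by (elim conjE; simp)+

lemma is_weak_grad_parts: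
  assumes "is_weak_grad f G" and "test_pair K i \<psi> \<psi>'"
  shows "(LINT x|lborel. f x * \<psi>' x) = - (LINT x|lborel. G x $ i * \<psi> x)"
  using assms(1)[unfolded is_weak_grad_def, THEN conjunct2, THEN conjunct2, THEN conjunct2, rule_format, OF assms(2)] .

lemma integrable_mult_of_squares:
  fixes f g :: "'a \<Rightarrow> real"
  assumes [measurable]: "f \<in> borel_measurable M" "g \<in> borel_measurable M"
    and "integrable M (\<lambda>x. (f x)^2)" "integrable M (\<lambda>x. (g x)^2)"
  shows "integrable M (\<lambda>x. f x * g x)"
proof (rule Bochner_Integration.integrable_bound)
  show "integrable M (\<lambda>x. (f x)^2 + (g x)^2)" using assms by simp
  have "\<bar>a * c\<bar> \<le> a^2 + c^2" for a c :: real
  proof -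
    have "2 * (\<bar>a\<bar> * \<bar>c\<bar>) \<le> a^2 + c^2" "0 \<le> \<bar>a\<bar> * \<bar>c\<bar>"
      using sum_squares_bound[of "\<bar>a\<bar>" "\<bar>c\<bar>"] by simp_all
    then show ?thesis unfolding abs_mult by linarith
  qed
  then show "AE x in M. norm (f x * g x) \<le> norm ((f x)^2 + (g x)^2)"
    by (auto simp: abs_le_iff)
qed measurable

lemma integrable_power2_diff:
  fixes f g :: "'a \<Rightarrow> real"
  assumes "f \<in> borel_measurable M" "g \<in> borel_measurable M"
    and "integrable M (\<lambda>x. (f x)^2)" "integrable M (\<lambda>x. (g x)^2)"
  shows "integrable M (\<lambda>x. (f x - g x)^2)"
  unfolding power2_diff using assms integrable_mult_of_squares[OF assms]
  by (auto simp: mult.assoc)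

lemma is_weak_grad_diff:
  assumes f: "is_weak_grad f F" and h: "is_weak_grad h H"
  shows "is_weak_grad (\<lambda>x. f x - h x) (\<lambda>x. F x - H x)"
  unfolding is_weak_grad_def
proof (intro conjI allI impI)
  note [measurable] = is_weak_gradD(1,3)[OF f] is_weak_gradD(1,3)[OF h]
  note int = is_weak_gradD(2,4)[OF f] is_weak_gradD(2,4)[OF h]
  show "(\<lambda>x. f x - h x) \<in> borel_measurable borel" by measurable
  show "integrable lborel (\<lambda>x. (f x - h x)^2)" using int by (intro integrable_power2_diff) auto
  show "(\<lambda>x. (F x - H x) $ i) \<in> borel_measurable borel" for i by simp
  show "integrable lborel (\<lambda>x. ((F x - H x) $ i)^2)" for i
    using int by simp (intro integrable_power2_diff, auto)
  fix \<psi> \<psi>' i K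
  assume t: "test_pair (K :: (real^'a) set) i \<psi> \<psi>'"
  note [measurable] = test_pairD(7,8)[OF t]
  have i1: "integrable lborel (\<lambda>x. f x * \<psi>' x)" "integrable lborel (\<lambda>x. h x * \<psi>' x)"
    "integrable lborel (\<lambda>x. F x $ i * \<psi> x)" "integrable lborel (\<lambda>x. H x $ i * \<psi> x)"
    using int test_pairD(9,10)[OF t] by (auto intro!: integrable_mult_of_squares)
  show "(LINT x|lborel. (f x - h x) * \<psi>' x) = - (LINT x|lborel. (F x - H x) $ i * \<psi> x)"
    using i1 is_weak_grad_parts[OF f t] is_weak_grad_parts[OF h t] by (simp add: left_diff_distrib)
qed

lemma test_pair_translate:
  assumes t: "test_pair K i \<psi> \<psi>'"
  shows "test_pair ((\<lambda>x. x + y) ` K) i (\<lambda>x. \<psi> (x - y)) (\<lambda>x. \<psi>' (x - y))"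
  unfolding test_pair_def
proof (intro conjI allI impI)
  show "compact ((\<lambda>x. x + y) ` K)"
    using test_pairD(1)[OF t] by (intro compact_continuous_image continuous_intros)
  show "continuous_on UNIV (\<lambda>x. \<psi> (x - y))" "continuous_on UNIV (\<lambda>x. \<psi>' (x - y))"
    by (rule continuous_on_compose2[OF test_pairD(2)[OF t]] continuous_on_compose2[OF test_pairD(3)[OF t]];
        auto intro!: continuous_intros)+
  fix x
  show "\<psi> (x - y) = 0" "\<psi>' (x - y) = 0" if "x \<notin> (\<lambda>x. x + y) ` K"
    by (rule test_pairD(4)[OF t] test_pairD(5)[OF t]; use that in \<open>force simp: image_iff\<close>)+
  show "has_partial (\<lambda>x. \<psi> (x - y)) i (\<psi>' (x - y)) x"
    using test_pairD(6)[OF t, of "x - y"] by (simp add: algebra_simps)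
qed

lemma is_weak_grad_translate:
  assumes f: "is_weak_grad f F"
  shows "is_weak_grad (\<lambda>x. f (x + y)) (\<lambda>x. F (x + y))"
  unfolding is_weak_grad_def
proof (intro conjI allI impI)
  note [measurable] = is_weak_gradD(1,3)[OF f]
  note int = is_weak_gradD(2,4)[OF f]
  show "(\<lambda>x. f (x + y)) \<in> borel_measurable borel" by measurable
  show "integrable lborel (\<lambda>x. (f (x + y))^2)"
    using int lborel_translate_integrable_iff[of "\<lambda>x. (f x)^2" y] by simp
  show "(\<lambda>x. F (x + y) $ i) \<in> borel_measurable borel" for i by measurable
  show "integrable lborel (\<lambda>x. (F (x + y) $ i)^2)" for i
    using int lborel_translate_integrable_iff[of "\<lambda>x. (F x $ i)^2" y] by simp
  fix \<psi> \<psi>' i K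
  assume t: "test_pair (K :: (real^'a) set) i \<psi> \<psi>'"
  note [measurable] = test_pairD(7,8)[OF t]
  have "(LINT x|lborel. f (x + y) * \<psi>' x) = (LINT x|lborel. f x * \<psi>' (x - y))"
    using lborel_translate_integral[of "\<lambda>x. f x * \<psi>' (x - y)" y] by simp
  also have "\<dots> = - (LINT x|lborel. F x $ i * \<psi> (x - y))"
    by (rule is_weak_grad_parts[OF f test_pair_translate[OF t]])
  also have "(LINT x|lborel. F x $ i * \<psi> (x - y)) = (LINT x|lborel. F (x + y) $ i * \<psi> x)"
    using lborel_translate_integral[of "\<lambda>x. F x $ i * \<psi> (x - y)" y] by simp
  finally show "(LINT x|lborel. f (x + y) * \<psi>' x) = - (LINT x|lborel. F (x + y) $ i * \<psi> x)" .
qed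

lemma lebesgue_integral_eq_lborel:
  fixes f :: "'a::euclidean_space \<Rightarrow> real"
  assumes "f \<in> borel_measurable borel"
  shows "(LINT x|lebesgue. f x) = (LINT x|lborel. f x)"
  by (rule integral_completion) (use assms in simp)

lemma L2_lebesgueI:
  fixes f :: "'a::euclidean_space \<Rightarrow> real"
  assumes [measurable]: "f \<in> borel_measurable borel" and "integrable lborel (\<lambda>x. (f x)^2)"
  shows "f \<in> L2 lebesgue"
proof -
  have "f \<in> borel_measurable lborel" by simp
  moreover have "(\<lambda>x. (f x)^2) \<in> borel_measurable lborel" by simp
  ultimately show ?thesis using assms(2)
    by (simp add: L2_def integrable_completion measurable_completion)
qed

lemma test_function_test_pair:
  assumes "test_function \<psi>"
  shows "test_pair (closure {x. \<psi> x \<noteq> 0}) i \<psi> (partial i \<psi>)"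
  unfolding test_pair_def
proof (intro conjI allI impI)
  have C1: "Ck_on (Suc 0) UNIV \<psi>" and C0: "Ck_on 0 UNIV \<psi>"
    using assms unfolding test_function_def Cinf_on_def by blast+
  show "compact (closure {x. \<psi> x \<noteq> 0})" using assms by (simp add: test_function_def)
  show "continuous_on UNIV \<psi>" "continuous_on UNIV (partial i \<psi>)" using C0 C1 by auto
  fix x
  show "has_partial \<psi> i (partial i \<psi> x) x" using C1 by (intro DERIV_partial) simp
  assume x: "x \<notin> closure {x. \<psi> x \<noteq> 0}"
  then show "\<psi> x = 0" using closure_subset[of "{x. \<psi> x \<noteq> 0}"] by blast
  have "(\<psi> has_derivative (\<lambda>_. 0)) (at x)"
  proof (rule has_derivative_transform_within_open[OF has_derivative_const[of 0], of "- closure {x. \<psi> x \<noteq> 0}"])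
    show "0 = \<psi> y" if "y \<in> - closure {x. \<psi> x \<noteq> 0}" for y
      using that closure_subset[of "{x. \<psi> x \<noteq> 0}"] by auto
  qed (use x in auto)
  then have "frechet_derivative \<psi> (at x) = (\<lambda>_. 0)"
    by (rule frechet_derivative_at[symmetric])
  then show "partial i \<psi> x = 0" by (simp add: partial_def)
qed

text \<open>\<open>H1_norm\<close> is an infimum over weak gradients, hence at most the value at
  \<open>F\<close>. Together with non-negativity this upper bound suffices for convergence to
  0.\<close>

lemma is_weak_grad_imp:
  fixes f :: "real^'n::finite \<Rightarrow> real"
  assumes f: "is_weak_grad f F"
  shows "has_L2_weak_gradient f F" and "f \<in> H1"
    and "H1_norm f \<le> sqrt ((LINT x|lborel. (f x)^2) + (\<Sum>i\<in>UNIV. LINT x|lborel. (F x $ i)^2))"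
    and "0 \<le> H1_norm f"
proof -
  note [measurable] = is_weak_gradD(1,3)[OF f]
  note int = is_weak_gradD(2,4)[OF f]
  show 1: "has_L2_weak_gradient f F"
    unfolding has_L2_weak_gradient_def
  proof (intro conjI allI impI)
    show "(\<lambda>x. F x $ i) \<in> L2 lebesgue" for i by (rule L2_lebesgueI) (use int in auto)
    fix \<psi> i assume t: "test_function (\<psi> :: real^'n \<Rightarrow> real)"
    note t = test_function_test_pair[OF t, of i]
    note [measurable] = test_pairD(7,8)[OF t]
    have "(LINT x|lborel. f x * partial i \<psi> x) = - (LINT x|lborel. F x $ i * \<psi> x)"
      by (rule is_weak_grad_parts[OF f t])
    then show "(LINT x|lebesgue. f x * partial i \<psi> x) = - (LINT x|lebesgue. F x $ i * \<psi> x)"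
      by (simp add: lebesgue_integral_eq_lborel)
  qed
  show "f \<in> H1" using 1 int by (auto simp: H1_def intro!: L2_lebesgueI)
  let ?n = "\<lambda>G. sqrt ((L2_norm lebesgue f)^2 + (\<Sum>i\<in>UNIV. (L2_norm lebesgue (\<lambda>x. G x $ i))^2))"
  have bdd: "bdd_below (?n ` {G. has_L2_weak_gradient f G})"
    by (rule bdd_belowI[of _ 0]) (auto intro!: add_nonneg_nonneg sum_nonneg)
  have "H1_norm f \<le> ?n F"
    unfolding H1_norm_def by (rule cINF_lower[OF bdd]) (use 1 in simp)
  also have "?n F = sqrt ((LINT x|lborel. (f x)^2) + (\<Sum>i\<in>UNIV. LINT x|lborel. (F x $ i)^2))"
    by (simp add: L2_norm_def lebesgue_integral_eq_lborel)
  finally show "H1_norm f \<le> \<dots>" .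
  show "0 \<le> H1_norm f"
    unfolding H1_norm_def by (rule cINF_greatest) (use 1 in \<open>auto intro!: add_nonneg_nonneg sum_nonneg\<close>)
qed

lemma Linf_bound:
  fixes f :: "real^'n::finite \<Rightarrow> real"
  assumes [measurable]: "f \<in> borel_measurable borel" and c: "\<And>x. \<bar>f x\<bar> \<le> c"
  shows "f \<in> Linf" "0 \<le> Linf_norm f" "Linf_norm f \<le> c"
proof -
  have [measurable]: "f \<in> borel_measurable lebesgue"
    by (rule measurable_completion) simp
  have m: "(\<lambda>x. ereal \<bar>f x\<bar>) \<in> borel_measurable lebesgue" by measurable
  have le: "esssup lebesgue (\<lambda>x. ereal \<bar>f x\<bar>) \<le> ereal c"
    by (rule esssup_I[OF m]) (use c in auto)
  \<comment> \<open>Lebesgue measure is not the zero measure, so the zero function has essential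
    supremum 0 and not minus infinity.\<close>
  have "(0::ereal) = esssup (lebesgue :: (real^'n) measure) (\<lambda>x. 0)"
    by (rule esssup_const[symmetric]) simp
  also have "\<dots> \<le> esssup lebesgue (\<lambda>x. ereal \<bar>f x\<bar>)"
    by (rule esssup_mono) auto
  finally have ge: "0 \<le> esssup lebesgue (\<lambda>x. ereal \<bar>f x\<bar>)" .
  show "f \<in> Linf" using le by (auto simp: Linf_def) 
  show "0 \<le> Linf_norm f" using ge by (simp add: Linf_norm_def real_of_ereal_pos)
  show "Linf_norm f \<le> c" using ge le unfolding Linf_norm_def
    by (cases "esssup lebesgue (\<lambda>x. ereal \<bar>f x\<bar>)") auto
qed

section \<open>Eigenfunctions of a perturbed harmonic oscillator\<close>

text \<open>A \<open>C\<^sup>1\<close> substitute for the identity vanishing below \<open>e\<close>: \<open>trunc e (v x)\<close> has compact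
  support in \<open>D\<close> without any regularity at the boundary, and it tends to \<open>v x\<close> as \<open>e \<rightarrow> 0\<close>.\<close>

definition trunc :: "real \<Rightarrow> real \<Rightarrow> real" where
  "trunc e t = (max 0 (t - e))^2 / t"

definition trunc' :: "real \<Rightarrow> real \<Rightarrow> real" where
  "trunc' e t = max 0 (t - e) * (2 * t - max 0 (t - e)) / t^2"

lemma DERIV_pos_part_square:
  "((\<lambda>t. (max 0 (t - e))^2) has_real_derivative 2 * max 0 (t - e)) (at t)"
proof -
  have "((\<lambda>t. t - e) has_real_derivative 1) (at t)"
    by (auto intro!: derivative_eq_intros)
  from DERIV_chain2[OF DERIV_max_0_power[of 0] this] show ?thesis
    by (simp add: power2_eq_square)
qed

lemma DERIV_trunc:
  assumes "t > 0"
  shows "(trunc e has_real_derivative trunc' e t) (at t)"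
proof -
  have "((\<lambda>t. (max 0 (t - e))^2 / t) has_real_derivative
      (2 * max 0 (t - e) * t - (max 0 (t - e))^2 * 1) / (t * t)) (at t)"
    by (rule DERIV_divide[OF DERIV_pos_part_square DERIV_ident]) (use assms in simp)
  then show ?thesis
    by (simp add: trunc_def[abs_def] trunc'_def power2_eq_square algebra_simps)
qed

lemma trunc_eq_0: "e \<ge> 0 \<Longrightarrow> t \<le> e \<Longrightarrow> trunc e t = 0" "t \<le> e \<Longrightarrow> trunc' e t = 0"
  by (simp_all add: trunc_def trunc'_def)

text \<open>These bounds do not depend on \<open>e\<close> and provide the dominating functions for
  \<open>e\<close> tending to 0. With s the positive part of t - e, the last one is (t - s)^2 >=
  0.\<close>

lemma trunc_bounds:
  assumes "e \<ge> 0" "t \<ge> 0"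
  shows "0 \<le> trunc e t" "trunc e t \<le> t" "0 \<le> trunc' e t" "trunc' e t \<le> 1"
proof -
  define s where "s = max 0 (t - e)"
  have s: "0 \<le> s" "s \<le> t" using assms by (auto simp: s_def)
  show "0 \<le> trunc e t" "0 \<le> trunc' e t"
    using assms s unfolding trunc_def trunc'_def s_def[symmetric] by simp_all
  have "s^2 \<le> t * t" using s by (simp add: power2_eq_square mult_mono)
  then show "trunc e t \<le> t"
    using assms s unfolding trunc_def s_def[symmetric] by (cases "t = 0") (auto simp: divide_le_eq)
  have "s * (2 * t - s) \<le> t^2" using zero_le_power2[of "t - s"]
    by (simp add: power2_eq_square algebra_simps)
  then show "trunc' e t \<le> 1"
    using assms unfolding trunc'_def s_def[symmetric] by (cases "t = 0") (auto simp: divide_le_eq)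
qed

lemma trunc_tendsto:
  assumes e: "e \<longlonglongrightarrow> 0" and t: "t > 0"
  shows "(\<lambda>n. trunc (e n) t) \<longlonglongrightarrow> t" "(\<lambda>n. trunc' (e n) t) \<longlonglongrightarrow> 1"
proof -
  have "(\<lambda>n. max 0 (t - e n)) \<longlonglongrightarrow> max 0 (t - 0)" by (intro tendsto_intros e)
  then have s: "(\<lambda>n. max 0 (t - e n)) \<longlonglongrightarrow> t" using t by simp
  have "(\<lambda>n. trunc (e n) t) \<longlonglongrightarrow> t^2 / t"
    unfolding trunc_def by (intro tendsto_intros s) (use t in simp)
  then show "(\<lambda>n. trunc (e n) t) \<longlonglongrightarrow> t" using t by (simp add: power2_eq_square)
  have "(\<lambda>n. trunc' (e n) t) \<longlonglongrightarrow> t * (2 * t - t) / t^2"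
    unfolding trunc'_def by (intro tendsto_intros s) (use t in simp)
  then show "(\<lambda>n. trunc' (e n) t) \<longlonglongrightarrow> 1" using t by (simp add: power2_eq_square)
qed

lemma continuous_on_trunc:
  assumes "continuous_on S f" "\<And>x. x \<in> S \<Longrightarrow> f x > 0"
  shows "continuous_on S (\<lambda>x. trunc e (f x))" "continuous_on S (\<lambda>x. trunc' e (f x))"
  unfolding trunc_def trunc'_def
  by (intro continuous_intros assms; use assms in force)+

text \<open>\<open>g\<close> is the gradient of \<open>v\<close> and \<open>l i\<close> its pure
  second partials. They are set to 0 off \<open>D\<close> to be total and Borel, with no control
  near the boundary; only \<open>v\<close> is continuous on the whole space. \<open>\<delta>\<close>
  bounds the perturbation \<open>q\<close> of the quadratic potential.\<close>

locale well_eigenfunction =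
  fixes D :: "(real^'n::finite) set" and v :: "real^'n \<Rightarrow> real" and g :: "real^'n \<Rightarrow> real^'n"
    and l :: "'n \<Rightarrow> real^'n \<Rightarrow> real" and b :: "'n \<Rightarrow> real" and q :: "real^'n \<Rightarrow> real"
    and \<nu> \<delta> :: real
  assumes open_D: "open D" and bounded_D: "bounded D"
    and cont_v: "continuous_on UNIV v" and v_outside: "\<And>x. x \<notin> D \<Longrightarrow> v x = 0"
    and v_pos: "\<And>x. x \<in> D \<Longrightarrow> v x > 0"
    and gderiv_v: "\<And>x. x \<in> D \<Longrightarrow> GDERIV v x :> g x" and cont_g: "continuous_on D g"
    and g_outside: "\<And>x. x \<notin> D \<Longrightarrow> g x = 0"
    and deriv_g: "\<And>x i. x \<in> D \<Longrightarrow> has_partial (\<lambda>x. g x $ i) i (l i x) x"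
    and cont_l: "\<And>i. continuous_on D (l i)" and l_outside: "\<And>x i. x \<notin> D \<Longrightarrow> l i x = 0"
    and laplacian_eq: "\<And>x. x \<in> D \<Longrightarrow>
          (\<Sum>i\<in>UNIV. l i x) = ((norm (diag_mult b x))^2 + q x - \<nu>) * v x"
    and q_nonneg: "\<And>x. x \<in> D \<Longrightarrow> 0 \<le> q x" and q_le: "\<And>x. x \<in> D \<Longrightarrow> q x \<le> \<delta>"
    and b_pos: "\<And>i. b i > 0"
    and normalized: "(LINT x|lborel. (v x)^2) = 1"
begin

abbreviation \<beta> :: real where "\<beta> \<equiv> \<Sum>i\<in>UNIV. b i"

definition lap :: "real^'n \<Rightarrow> real" where "lap x = (\<Sum>i\<in>UNIV. l i x)"

lemma beta_pos: "\<beta> > 0"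
  by (rule sum_pos) (auto simp: b_pos)

lemma v_nonneg: "v x \<ge> 0"
  using v_pos v_outside by (cases "x \<in> D") (auto simp: less_imp_le)

lemma D_if_pos: "v x > 0 \<Longrightarrow> x \<in> D"
  using v_outside by fastforce

lemma v_measurable [measurable]: "v \<in> borel_measurable borel"
  by (rule borel_measurable_continuous_onI[OF cont_v])

lemma v_cont: "continuous_on S v"
  using cont_v continuous_on_subset by blast

lemma compact_closure_D: "compact (closure D)"
  using bounded_D by simp

lemma integrable_v2: "integrable lborel (\<lambda>x. (v x)^2)"
  by (rule integrable_compact_support[OF compact_closure_D])
     (use v_outside closure_subset[of D] in \<open>auto intro!: continuous_intros v_cont\<close>)

lemma D_nonempty: "D \<noteq> {}"
  using normalized v_outside by force

lemma measurable_zero_outside: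
  fixes f :: "real^'n \<Rightarrow> 'b::real_normed_vector"
  assumes "continuous_on D f" "\<And>x. x \<notin> D \<Longrightarrow> f x = 0"
  shows "f \<in> borel_measurable borel"
proof -
  have "(\<lambda>x. if x \<in> D then f x else 0) \<in> borel_measurable borel"
    by (rule borel_measurable_continuous_on_if) (use open_D assms in auto)
  moreover have "(\<lambda>x. if x \<in> D then f x else 0) = f" using assms by auto
  ultimately show ?thesis by simp
qed

lemma g_measurable [measurable]: "(\<lambda>x. g x $ i) \<in> borel_measurable borel"
  by (rule measurable_zero_outside) (auto intro!: continuous_intros cont_g simp: g_outside)

lemma lap_measurable [measurable]: "lap \<in> borel_measurable borel"
  unfolding lap_def[abs_def]
  by (rule measurable_zero_outside) (auto intro!: continuous_intros cont_l simp: l_outside)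

lemma lap_eq: "x \<in> D \<Longrightarrow> lap x = ((norm (diag_mult b x))^2 + q x - \<nu>) * v x"
  by (simp add: lap_def laplacian_eq)

lemma norm_diag_mult_eq: "(norm (diag_mult b x))^2 = (\<Sum>i\<in>UNIV. (b i * x $ i)^2)"
  by (simp add: norm_power2_eq_sum)

text \<open>Where a quotient v/G attains its maximum \<kappa>, the combination v - \<kappa> G is
  maximal too, so only linear combinations are differentiated. The coefficients used later are (1,
  -\<kappa>) and (-\<kappa>, 1).\<close>

lemma comparison_at_max:
  assumes U: "open U" "x \<in> U" "U \<subseteq> D"
    and max: "\<And>y. y \<in> U \<Longrightarrow> A * v y + B * egauss b \<theta> y \<le> A * v x + B * egauss b \<theta> x"
  shows "A * (((norm (diag_mult b x))^2 + q x - \<nu>) * v x)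
    + B * ((\<theta>^2 * (norm (diag_mult b x))^2 - \<theta> * \<beta>) * egauss b \<theta> x) \<le> 0"
proof -
  let ?e = "\<lambda>y. (- \<theta> * egauss b \<theta> y) *\<^sub>R diag_mult b y"
  have "(\<Sum>i\<in>UNIV. A * l i x + B * (((\<theta> * (b i * x $ i))^2 - \<theta> * b i) * egauss b \<theta> x)) \<le> 0"
  proof (rule laplacian_le_0_at_max[OF U(1,2)])
    show "GDERIV (\<lambda>y. A * v y + B * egauss b \<theta> y) y :> A *\<^sub>R g y + B *\<^sub>R ?e y" if "y \<in> U" for y
      using GDERIV_add[OF GDERIV_mult[OF GDERIV_const[of A] gderiv_v[of y]]
          GDERIV_mult[OF GDERIV_const[of B] gderiv_egauss[of b \<theta> y]]] that U by auto
    show "has_partial (\<lambda>x. (A *\<^sub>R g x + B *\<^sub>R ?e x) $ i) i (A * l i x + B * (((\<theta> * (b i * x $ i))^2 - \<theta> * b i) * egauss b \<theta> x)) x" for i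
    proof -
      have eq: "(A *\<^sub>R p + B *\<^sub>R r) $ i = A * p $ i + B * r $ i" for p r :: "real^'n"
        by simp
      show ?thesis
        unfolding eq by (intro DERIV_add DERIV_cmult deriv_g egauss_second_derivative) (use U in auto)
    qed
  qed (use max in auto)
  also have "(\<Sum>i\<in>UNIV. A * l i x + B * (((\<theta> * (b i * x $ i))^2 - \<theta> * b i) * egauss b \<theta> x))
    = A * (\<Sum>i\<in>UNIV. l i x) + B * ((\<theta>^2 * (\<Sum>i\<in>UNIV. (b i * x $ i)^2) - \<theta> * \<beta>) * egauss b \<theta> x)"
    by (simp add: sum.distrib sum_distrib_left sum_distrib_right sum_subtractf power_mult_distrib algebra_simps)
  finally show ?thesis
    using laplacian_eq[of x] U by (auto simp: norm_diag_mult_eq)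
qed

text \<open>At a maximum of v/G the |Bx|^2 terms of the two Laplacians cancel, leaving (q - \<nu> +
  \<beta>) v <= 0 with v > 0 and q >= 0. The maximum over the closure lies in \<open>D\<close>
  because v vanishes elsewhere.\<close>

lemma nu_ge: "\<beta> \<le> \<nu>"
proof -
  let ?f = "\<lambda>x. v x * egauss b (- 1) x"
  obtain x where x: "x \<in> closure D" "\<And>y. y \<in> closure D \<Longrightarrow> ?f y \<le> ?f x"
    using continuous_attains_sup[OF compact_closure_D, of ?f] D_nonempty
    by (auto intro!: continuous_intros v_cont continuous_on_egauss)
  obtain z where z: "z \<in> D" using D_nonempty by auto
  have "0 < ?f z" using v_pos[OF z] egauss_pos by (rule mult_pos_pos)
  also have "\<dots> \<le> ?f x" using x z closure_subset by blast
  finally have "v x > 0" by (rule zero_less_mult_pos2) (rule egauss_pos)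
  then have xD: "x \<in> D" by (rule D_if_pos)
  have cancel: "?f y * egauss b 1 y = v y" for y
    using egauss_inverse[of b 1 y] by (simp add: mult.assoc mult.commute[of "egauss b (- 1) y"])
  define \<kappa> where "\<kappa> = ?f x"
  have \<kappa>x: "\<kappa> * egauss b 1 x = v x" unfolding \<kappa>_def by (rule cancel)
  have "1 * (((norm (diag_mult b x))^2 + q x - \<nu>) * v x)
    + - \<kappa> * ((1^2 * (norm (diag_mult b x))^2 - 1 * \<beta>) * egauss b 1 x) \<le> 0"
  proof (rule comparison_at_max[OF open_D xD])
    fix y assume "y \<in> D"
    then have "?f y \<le> \<kappa>" unfolding \<kappa>_def using x closure_subset by blast
    then have "?f y * egauss b 1 y \<le> \<kappa> * egauss b 1 y"
      by (rule mult_right_mono) (simp add: egauss_pos less_imp_le)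
    then have "v y \<le> \<kappa> * egauss b 1 y" unfolding cancel .
    then show "1 * v y + - \<kappa> * egauss b 1 y \<le> 1 * v x + - \<kappa> * egauss b 1 x"
      using \<kappa>x by simp
  qed simp
  moreover have "\<kappa> * ((1^2 * (norm (diag_mult b x))^2 - 1 * \<beta>) * egauss b 1 x)
      = ((norm (diag_mult b x))^2 - \<beta>) * v x"
    unfolding \<kappa>x[symmetric] by (simp add: algebra_simps)
  ultimately have "(q x - \<nu> + \<beta>) * v x \<le> 0"
    by (simp add: algebra_simps)
  then show ?thesis
    using \<open>v x > 0\<close> q_nonneg[OF xD] by (simp add: mult_le_0_iff)
qed

text \<open>The bound on \<open>c\<close> ensures that \<open>(\<beta> + \<tau>) c \<le> \<tau> G\<close> where \<open>|Bx|^2 \<le> \<beta> + \<tau>\<close>, so that \<open>G - c\<close> is a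
  subsolution on \<open>{G \<ge> c}\<close> for the spectral parameter \<open>\<beta> + \<tau>\<close>.\<close>

lemma nu_le:
  assumes \<tau>: "\<tau> > 0" and c0: "c0 > 0" "\<And>i. c0 \<le> b i"
    and c: "0 < c" "c \<le> \<tau> / (\<beta> + \<tau>) * exp (- (\<beta> + \<tau>) / (2 * c0))"
    and sub: "{x. c \<le> egauss b 1 x} \<subseteq> D"
  shows "\<nu> \<le> \<beta> + \<tau> + \<delta>"
proof (rule ccontr)
  assume "\<not> \<nu> \<le> \<beta> + \<tau> + \<delta>"
  then have nu: "\<nu> > \<beta> + \<tau> + \<delta>" by simp
  let ?A = "{x. c \<le> egauss b 1 x}"
  have "closed ?A"
    by (rule closed_Collect_le) (auto intro: continuous_on_egauss)
  then have A: "compact ?A"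
    using bounded_subset[OF bounded_D sub] by (simp add: compact_eq_bounded_closed)
  have "- (\<beta> + \<tau>) / (2 * c0) < 0"
    using \<tau> c0(1) beta_pos by (intro divide_neg_pos) auto
  then have "exp (- (\<beta> + \<tau>) / (2 * c0)) < 1" by simp
  moreover have t: "0 < \<tau> / (\<beta> + \<tau>)" "\<tau> / (\<beta> + \<tau>) < 1" using \<tau> beta_pos by simp_all
  ultimately have "\<tau> / (\<beta> + \<tau>) * exp (- (\<beta> + \<tau>) / (2 * c0)) < \<tau> / (\<beta> + \<tau>) * 1"
    by (intro mult_strict_left_mono)
  \<comment> \<open>Strictness matters at the very end, where it excludes a maximum at the
    origin.\<close>
  then have c_lt: "c < \<tau> / (\<beta> + \<tau>)" using c(2) by simp
  then have "c < 1" using t by simp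
  then have zA: "0 \<in> ?A" by simp
  let ?f = "\<lambda>x. (egauss b 1 x - c) / v x"
  have ne: "?A \<noteq> {}" using zA by blast
  have cont: "continuous_on ?A ?f"
    by (intro continuous_intros v_cont continuous_on_egauss) (use sub v_pos in force)
  then obtain x where x: "x \<in> ?A" "\<And>y. y \<in> ?A \<Longrightarrow> ?f y \<le> ?f x"
    using continuous_attains_sup[OF A ne cont] by blast
  define \<kappa> where "\<kappa> = ?f x"
  have "v 0 > 0" using zA sub v_pos by blast
  then have "0 < ?f 0" using \<open>c < 1\<close> by simp
  also have "\<dots> \<le> \<kappa>" unfolding \<kappa>_def using x(2)[OF zA] .
  finally have "\<kappa> > 0" .
  have xD: "x \<in> D" and vx: "v x > 0" using x sub v_pos by auto
  have \<kappa>x: "\<kappa> * v x = egauss b 1 x - c" using vx by (simp add: \<kappa>_def)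
  \<comment> \<open>The quotient is positive at its maximum, so the point lies in the open set {G >
    c}, where the local comparison applies.\<close>
  have Gc: "egauss b 1 x > c" using \<kappa>x \<open>\<kappa> > 0\<close> vx by (smt (verit) mult_pos_pos)
  let ?W = "(norm (diag_mult b x))^2"
  have "- \<kappa> * ((?W + q x - \<nu>) * v x) + 1 * ((1^2 * ?W - 1 * \<beta>) * egauss b 1 x) \<le> 0"
  proof (rule comparison_at_max)
    show "open {x. c < egauss b 1 x}"
      by (rule open_Collect_less) (auto intro: continuous_on_egauss)
    fix y assume y: "y \<in> {x. c < egauss b 1 x}"
    then have "y \<in> ?A" by simp
    then have "v y > 0" "?f y \<le> \<kappa>" unfolding \<kappa>_def using x(2) sub v_pos by blast+
    then have "egauss b 1 y - c \<le> \<kappa> * v y" by (simp add: divide_le_eq)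
    then show "- \<kappa> * v y + 1 * egauss b 1 y \<le> - \<kappa> * v x + 1 * egauss b 1 x"
      using \<kappa>x by simp
  qed (use Gc sub in auto)
  moreover have "- \<kappa> * ((?W + q x - \<nu>) * v x) = - ((?W + q x - \<nu>) * (egauss b 1 x - c))"
    unfolding \<kappa>x[symmetric] by (simp add: algebra_simps)
  ultimately have "(\<nu> - q x) * (egauss b 1 x - c) \<le> \<beta> * egauss b 1 x - ?W * c"
    by (simp add: algebra_simps)
  moreover have "(\<beta> + \<tau>) * (egauss b 1 x - c) \<le> (\<nu> - q x) * (egauss b 1 x - c)"
    using nu q_le[OF xD] Gc by (intro mult_right_mono) auto
  ultimately have *: "\<tau> * egauss b 1 x \<le> (\<beta> + \<tau> - ?W) * c"
    by (simp add: algebra_simps)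
  then have W: "?W < \<beta> + \<tau>"
    using \<tau> egauss_pos[of b 1 x] c(1) by (smt (verit) mult_nonpos_nonneg mult_pos_pos)
  have "c0 * (\<Sum>i\<in>UNIV. b i * (x $ i)^2) \<le> ?W"
    unfolding norm_diag_mult_eq sum_distrib_left
  proof (rule sum_mono)
    fix i
    have "c0 * (b i * (x $ i)^2) \<le> b i * (b i * (x $ i)^2)"
      using c0(2)[of i] b_pos[of i] by (intro mult_right_mono) auto
    then show "c0 * (b i * (x $ i)^2) \<le> (b i * x $ i)^2"
      by (simp add: power2_eq_square mult_ac)
  qed
  then have "(\<Sum>i\<in>UNIV. b i * (x $ i)^2) \<le> (\<beta> + \<tau>) / c0"
    using W c0 by (simp add: le_divide_eq mult.commute)
  then have "exp (- (\<beta> + \<tau>) / (2 * c0)) \<le> egauss b 1 x"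
    using c0 by (simp add: egauss_def field_simps)
  then have "\<tau> / (\<beta> + \<tau>) * exp (- (\<beta> + \<tau>) / (2 * c0)) \<le> \<tau> / (\<beta> + \<tau>) * egauss b 1 x"
    using t by (intro mult_left_mono) auto
  then have "c \<le> \<tau> / (\<beta> + \<tau>) * egauss b 1 x" using c by linarith
  then have "(\<beta> + \<tau>) * c \<le> \<tau> * egauss b 1 x"
    using \<tau> beta_pos by (simp add: field_simps)
  \<comment> \<open>This leaves only \<open>?W\<close> = 0, that is x = 0 and G = 1; there
    \<open>*\<close> reads \<tau> <= (\<beta> + \<tau>) c and contradicts
    \<open>c_lt\<close>.\<close>
  with * have "?W * c \<le> 0" by (simp add: algebra_simps)
  then have W0: "?W \<le> 0" using c(1) by (simp add: mult_le_0_iff)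
  then have "diag_mult b x = 0" by simp
  then have "x = 0" using b_pos by (auto simp: vec_eq_iff) (metis less_irrefl)
  then have "\<tau> \<le> (\<beta> + \<tau>) * c" using * W0 by simp
  then show False using c_lt \<tau> beta_pos by (simp add: field_simps)
qed

end

section \<open>Energy identities\<close>

context well_eigenfunction begin

lemma compact_superlevel: "e > 0 \<Longrightarrow> compact {x. e \<le> v x}"
proof -
  assume "e > 0"
  have "closed {x. e \<le> v x}"
    by (rule closed_Collect_le) (auto intro: cont_v)
  moreover have "{x. e \<le> v x} \<subseteq> D" using \<open>e > 0\<close> by (auto intro: D_if_pos)
  ultimately show ?thesis
    using bounded_subset[OF bounded_D] by (simp add: compact_eq_bounded_closed)
qed

lemma superlevel_subset: "e > 0 \<Longrightarrow> {x. e \<le> v x} \<subseteq> D"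
  by (auto intro: D_if_pos)

lemma deriv_v: "x \<in> D \<Longrightarrow> has_partial v i (g x $ i) x"
  by (rule gderiv_partial[OF gderiv_v])

lemma deriv_trunc_v:
  assumes "x \<in> D"
  shows "has_partial (\<lambda>x. trunc e (v x)) i (trunc' e (v x) * g x $ i) x"
  by (rule DERIV_chain2[OF _ deriv_v[OF assms]]) (use DERIV_trunc v_pos assms in simp)

lemma deriv_pos_part_square_v:
  assumes "x \<in> D"
  shows "has_partial (\<lambda>x. (max 0 (v x - e))^2) i ((2 * max 0 (v x - e)) * g x $ i) x"
  by (rule DERIV_chain2[OF _ deriv_v[OF assms]]) (use DERIV_pos_part_square[of e "v x"] in simp)

lemma cont_trunc_v: "continuous_on D (\<lambda>x. trunc e (v x))" "continuous_on D (\<lambda>x. trunc' e (v x))"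
  using v_pos by (auto intro!: continuous_on_trunc v_cont)

lemma cont_g_nth: "continuous_on D (\<lambda>x. g x $ i)"
  by (intro continuous_intros cont_g)

text \<open>The divergence of trunc(v) \<nabla>v is trunc'(v) |\<nabla>v|^2 + trunc(v) \<Delta>v,
  and this field is supported in the compact set {v >= e} inside \<open>D\<close>.\<close>

lemma trunc_energy:
  assumes e: "e > 0"
  shows "integrable lborel (\<lambda>x. trunc' e (v x) * (norm (g x))^2)"
    and "(LINT x|lborel. trunc' e (v x) * (norm (g x))^2) = - (LINT x|lborel. trunc e (v x) * lap x)"
proof -
  note K = compact_superlevel[OF e]
  note KD = superlevel_subset[OF e]
  have out: "trunc e (v x) = 0" "trunc' e (v x) = 0" if "x \<notin> {x. e \<le> v x}" for x
    using that e by (auto intro: trunc_eq_0)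
  have i1: "integrable lborel (\<lambda>x. trunc' e (v x) * (g x $ i)^2)" for i
    by (rule integrable_compact_support[OF K])
       (use out in \<open>auto intro!: continuous_intros continuous_on_subset[OF _ KD] cont_trunc_v cont_g_nth\<close>)
  have i2: "integrable lborel (\<lambda>x. trunc e (v x) * l i x)" for i
    by (rule integrable_compact_support[OF K])
       (use out in \<open>auto intro!: continuous_intros continuous_on_subset[OF _ KD] cont_trunc_v cont_l\<close>)
  have "(LINT x|lborel. trunc' e (v x) * (g x $ i)^2 + trunc e (v x) * l i x) = 0" for i
  proof (rule integral_directional_derivative_eq_0[OF K open_D KD, where f="\<lambda>x. trunc e (v x) * g x $ i"])
    fix x assume x: "x \<in> D"
    show "has_partial (\<lambda>x. trunc e (v x) * g x $ i) i (trunc' e (v x) * (g x $ i)^2 + trunc e (v x) * l i x) x"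
      using has_partial_mult[OF deriv_trunc_v[OF x] deriv_g[OF x]]
      by (simp add: power2_eq_square algebra_simps)
  qed (use out in \<open>auto intro!: continuous_intros cont_trunc_v cont_g_nth cont_l\<close>)
  then have "(LINT x|lborel. trunc' e (v x) * (g x $ i)^2) = - (LINT x|lborel. trunc e (v x) * l i x)" for i
    using i1 i2 by (simp add: eq_neg_iff_add_eq_0)
  then have "(\<Sum>i\<in>UNIV. LINT x|lborel. trunc' e (v x) * (g x $ i)^2) = - (\<Sum>i\<in>UNIV. LINT x|lborel. trunc e (v x) * l i x)"
    by (simp add: sum_negf)
  moreover have eq: "(\<lambda>x. trunc' e (v x) * (norm (g x))^2) = (\<lambda>x. \<Sum>i\<in>UNIV. trunc' e (v x) * (g x $ i)^2)"
    by (simp add: norm_power2_eq_sum sum_distrib_left)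
  ultimately show "(LINT x|lborel. trunc' e (v x) * (norm (g x))^2) = - (LINT x|lborel. trunc e (v x) * lap x)"
    unfolding lap_def sum_distrib_left using i1 i2 by simp
  show "integrable lborel (\<lambda>x. trunc' e (v x) * (norm (g x))^2)"
    unfolding eq using i1 by simp
qed

lemma diag_mult_bounded: obtains B where "B > 0" "\<And>x. x \<in> D \<Longrightarrow> norm (diag_mult b x) \<le> B"
proof -
  have "bounded (diag_mult b ` closure D)"
    by (intro compact_imp_bounded compact_continuous_image continuous_on_diag_mult compact_closure_D)
  then obtain B where "B > 0" "\<forall>x\<in>diag_mult b ` closure D. norm x \<le> B"
    by (auto simp: bounded_pos)
  then show ?thesis using that closure_subset[of D] by blast
qed

text \<open>On the bounded set \<open>D\<close> the potential is bounded. The constant depends on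
  \<open>D\<close> and serves integrability only; bounds uniform over a family come from
  \<open>neg_lap_le\<close> and \<open>lap_bound_eventually\<close>.\<close>

lemma lap_bound: obtains C where "\<And>x. \<bar>lap x\<bar> \<le> C * v x" "C > 0"
proof -
  obtain B where B: "B > 0" "\<And>x. x \<in> D \<Longrightarrow> norm (diag_mult b x) \<le> B"
    using diag_mult_bounded by blast
  have "\<bar>lap x\<bar> \<le> (B^2 + \<bar>\<delta>\<bar> + \<bar>\<nu>\<bar> + 1) * v x" for x
  proof (cases "x \<in> D")
    case True
    have "(norm (diag_mult b x))^2 \<le> B^2" using B(2)[OF True] by (intro power_mono) auto
    then have "\<bar>(norm (diag_mult b x))^2 + q x - \<nu>\<bar> \<le> B^2 + \<bar>\<delta>\<bar> + \<bar>\<nu>\<bar> + 1"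
      using q_nonneg[OF True] q_le[OF True] zero_le_power2[of "norm (diag_mult b x)"] by linarith
    then show ?thesis
      using True v_nonneg[of x] by (simp add: lap_eq abs_mult mult_right_mono)
  qed (simp add: lap_def l_outside v_outside)
  moreover have "B^2 + \<bar>\<delta>\<bar> + \<bar>\<nu>\<bar> + 1 > 0" by (simp add: add_nonneg_pos)
  ultimately show ?thesis using that by blast
qed

text \<open>The potential is non-negative. The bound is one-sided, but its constant does not involve
  the size of \<open>D\<close>.\<close>

lemma neg_lap_le: "- lap x \<le> \<nu> * v x"
proof (cases "x \<in> D")
  case True
  then have "0 \<le> ((norm (diag_mult b x))^2 + q x) * v x"
    using q_nonneg v_nonneg by simp
  then show ?thesis using True by (simp add: lap_eq algebra_simps)
qed (simp add: lap_def l_outside v_outside)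

lemma integrable_lap_v: "integrable lborel (\<lambda>x. v x * lap x)"
proof -
  obtain C where C: "\<And>x. \<bar>lap x\<bar> \<le> C * v x" "C > 0" using lap_bound by blast
  show ?thesis
  proof (rule integrable_dominated)
    show "integrable lborel (\<lambda>x. C * (v x)^2)" using integrable_v2 by simp
    show "\<bar>v x * lap x\<bar> \<le> C * (v x)^2" for x
      using mult_left_mono[OF C(1) v_nonneg[of x]] v_nonneg[of x]
      by (simp add: abs_mult power2_eq_square mult_ac)
  qed measurable
qed

definition eps :: "nat \<Rightarrow> real" where "eps n = 1 / real (Suc n)"

lemma e_n: "eps n > 0" "eps \<longlonglongrightarrow> 0"
  by (simp_all add: eps_def[abs_def]) real_asymp

lemma e_n_nonneg [simp]: "0 \<le> eps n"
  using e_n(1)[of n] by simp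

lemma trunc_v_bounds:
  assumes "e \<ge> 0"
  shows "0 \<le> trunc e (v x)" "trunc e (v x) \<le> v x" "0 \<le> trunc' e (v x)" "trunc' e (v x) \<le> 1"
  using trunc_bounds[OF assms v_nonneg] by auto

lemma norm_g_measurable [measurable]: "(\<lambda>x. norm (g x)) \<in> borel_measurable borel"
  by (rule measurable_zero_outside) (auto intro!: continuous_intros cont_g simp: g_outside)

lemma trunc_measurable [measurable]:
  "(\<lambda>x. trunc e (v x)) \<in> borel_measurable borel" "(\<lambda>x. trunc' e (v x)) \<in> borel_measurable borel"
  unfolding trunc_def trunc'_def by measurable

lemma trunc_lap_le: "e > 0 \<Longrightarrow> - (trunc e (v x) * lap x) \<le> \<nu> * (v x)^2"
proof -
  assume e: "e > 0"
  have nu: "\<nu> \<ge> 0" using nu_ge beta_pos by linarith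
  have "trunc e (v x) * - lap x \<le> trunc e (v x) * (\<nu> * v x)"
    using neg_lap_le[of x] trunc_bounds[of e "v x"] e v_nonneg[of x] by (intro mult_left_mono) auto
  also have "\<dots> \<le> v x * (\<nu> * v x)"
    using trunc_bounds[of e "v x"] e v_nonneg[of x] nu by (intro mult_right_mono) auto
  finally show ?thesis by (simp add: power2_eq_square mult_ac)
qed

lemma integrable_trunc_lap:
  assumes e: "e > 0"
  shows "integrable lborel (\<lambda>x. trunc e (v x) * lap x)"
proof (rule integrable_dominated[OF integrable_abs[OF integrable_lap_v]])
  show "\<bar>trunc e (v x) * lap x\<bar> \<le> \<bar>v x * lap x\<bar>" for x
    using trunc_v_bounds[of e x] e v_nonneg[of x] by (auto simp: abs_mult intro!: mult_right_mono)
qed measurable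

lemma trunc'_g_tendsto: "(\<lambda>n. trunc' (eps n) (v x) * c) \<longlonglongrightarrow> c" if "x \<notin> D \<Longrightarrow> c = 0" for c :: real
proof (cases "x \<in> D")
  case True
  have "(\<lambda>n. trunc' (eps n) (v x) * c) \<longlonglongrightarrow> 1 * c"
    by (intro tendsto_intros trunc_tendsto e_n(2) v_pos[OF True])
  then show ?thesis by simp
qed (use that in simp)

lemma trunc_v_tendsto: "(\<lambda>n. trunc (eps n) (v x)) \<longlonglongrightarrow> v x"
proof (cases "x \<in> D")
  case True
  show ?thesis by (intro trunc_tendsto e_n(2) v_pos[OF True])
qed (simp add: v_outside trunc_def)

text \<open>By \<open>trunc_energy\<close> and -\<Delta>v <= \<nu> v, the truncated energies are at
  most \<nu> times the integral of v^2; Fatou's lemma removes the truncation.\<close>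

lemma integrable_norm_g2: "integrable lborel (\<lambda>x. (norm (g x))^2)"
proof (rule integrableI_nonneg)
  have bd: "(\<integral>\<^sup>+x. ennreal (trunc' (eps n) (v x) * (norm (g x))^2) \<partial>lborel) \<le> ennreal \<nu>" for n
  proof -
    have "(\<integral>\<^sup>+x. ennreal (trunc' (eps n) (v x) * (norm (g x))^2) \<partial>lborel)
      = ennreal (LINT x|lborel. trunc' (eps n) (v x) * (norm (g x))^2)"
      by (intro nn_integral_eq_integral trunc_energy e_n AE_I2 mult_nonneg_nonneg)
         (auto intro!: trunc_bounds v_nonneg)
    also have "(LINT x|lborel. trunc' (eps n) (v x) * (norm (g x))^2) = (LINT x|lborel. - (trunc (eps n) (v x) * lap x))"
      by (subst trunc_energy(2)[OF e_n(1)]) simp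
    also have "\<dots> \<le> (LINT x|lborel. \<nu> * (v x)^2)"
      using integrable_trunc_lap[OF e_n(1)] integrable_v2 trunc_lap_le[OF e_n(1)]
      by (intro integral_mono) auto
    also have "\<dots> = \<nu>" using normalized by simp
    finally show ?thesis by (simp add: ennreal_leI)
  qed
  have lim: "liminf (\<lambda>n. ennreal (trunc' (eps n) (v x) * (norm (g x))^2)) = ennreal ((norm (g x))^2)" for x
    by (rule lim_imp_Liminf) (auto intro!: tendsto_ennrealI trunc'_g_tendsto simp: g_outside)
  have "(\<integral>\<^sup>+x. ennreal ((norm (g x))^2) \<partial>lborel) = (\<integral>\<^sup>+x. liminf (\<lambda>n. ennreal (trunc' (eps n) (v x) * (norm (g x))^2)) \<partial>lborel)"
    unfolding lim ..
  also have "\<dots> \<le> liminf (\<lambda>n. \<integral>\<^sup>+x. ennreal (trunc' (eps n) (v x) * (norm (g x))^2) \<partial>lborel)"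
    by (rule nn_integral_liminf) measurable
  also have "\<dots> \<le> limsup (\<lambda>n. \<integral>\<^sup>+x. ennreal (trunc' (eps n) (v x) * (norm (g x))^2) \<partial>lborel)"
    by (rule Liminf_le_Limsup) simp
  also have "\<dots> \<le> ennreal \<nu>"
    by (rule Limsup_bounded) (use bd in simp)
  finally show "(\<integral>\<^sup>+x. ennreal ((norm (g x))^2) \<partial>lborel) < \<infinity>"
    by (simp add: order_le_less_trans)
qed auto

lemma integrable_g2: "integrable lborel (\<lambda>x. (g x $ i)^2)"
  by (rule integrable_dominated[OF integrable_norm_g2]) (simp_all add: component_power2_le)

lemma energy_identity: "(LINT x|lborel. (norm (g x))^2) = - (LINT x|lborel. v x * lap x)"
proof -
  have 1: "(\<lambda>n. LINT x|lborel. trunc' (eps n) (v x) * (norm (g x))^2) \<longlonglongrightarrow> (LINT x|lborel. (norm (g x))^2)"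
  proof (rule integral_tendsto_dominated[OF integrable_norm_g2])
    show "\<bar>trunc' (eps n) (v x) * (norm (g x))^2\<bar> \<le> (norm (g x))^2" for n x
      by (simp add: abs_mult trunc_v_bounds mult_left_le_one_le)
  qed (auto intro!: trunc'_g_tendsto simp: g_outside)
  have 2: "(\<lambda>n. LINT x|lborel. trunc (eps n) (v x) * lap x) \<longlonglongrightarrow> (LINT x|lborel. v x * lap x)"
  proof (rule integral_tendsto_dominated[OF integrable_abs[OF integrable_lap_v]])
    show "\<bar>trunc (eps n) (v x) * lap x\<bar> \<le> \<bar>v x * lap x\<bar>" for n x
      by (simp add: abs_mult trunc_v_bounds v_nonneg mult_right_mono)
  qed (auto intro!: trunc_v_tendsto tendsto_intros)
  show ?thesis
    using LIMSEQ_unique[OF 1[unfolded trunc_energy(2)[OF e_n(1)]] tendsto_minus[OF 2]] .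
qed

lemma diag_nth_le: "norm (diag_mult b x) \<le> B \<Longrightarrow> \<bar>b i * x $ i\<bar> \<le> B"
  using component_le_norm_cart[of "diag_mult b x" i] by simp

lemma integrable_v_g_b: "integrable lborel (\<lambda>x. v x * g x $ i * (b i * x $ i))"
proof -
  obtain B where B: "B > 0" "\<And>x. x \<in> D \<Longrightarrow> norm (diag_mult b x) \<le> B"
    using diag_mult_bounded by blast
  show ?thesis
  proof (rule integrable_dominated)
    show "integrable lborel (\<lambda>x. B * \<bar>v x * g x $ i\<bar>)"
      by (intro integrable_mult_right integrable_abs integrable_mult_of_squares integrable_v2 integrable_g2) auto
    show "\<bar>v x * g x $ i * (b i * x $ i)\<bar> \<le> B * \<bar>v x * g x $ i\<bar>" for x
    proof (cases "x \<in> D")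
      case True
      have "\<bar>v x * g x $ i\<bar> * \<bar>b i * x $ i\<bar> \<le> \<bar>v x * g x $ i\<bar> * B"
        using diag_nth_le[OF B(2)[OF True]] by (intro mult_left_mono) auto
      then show ?thesis by (simp add: abs_mult mult_ac)
    qed (simp add: v_outside)
  qed measurable
qed

text \<open>The virial identity: the i-th derivative of v^2 b_i x_i has integral 0. The squared
  positive part of v - \<open>eps n\<close> replaces v^2 to give compact support, and then n tends
  to infinity.\<close>

lemma cross_term: "(LINT x|lborel. 2 * (v x * g x $ i * (b i * x $ i))) = - b i"
proof -
  define s where "s n x = max 0 (v x - eps n)" for n x
  have s: "0 \<le> s n x" "s n x \<le> v x" for n x
    using v_nonneg[of x] e_n_nonneg[of n] by (auto simp: s_def simp del: e_n_nonneg)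
  have [measurable]: "s n \<in> borel_measurable borel" for n unfolding s_def by measurable
  have lim: "(\<lambda>n. s n x) \<longlonglongrightarrow> v x" for x
  proof -
    have "(\<lambda>n. s n x) \<longlonglongrightarrow> max 0 (v x - 0)" unfolding s_def by (intro tendsto_intros e_n)
    then show ?thesis using v_nonneg[of x] by simp
  qed
  have zero: "(LINT x|lborel. 2 * s n x * g x $ i * (b i * x $ i) + (s n x)^2 * b i) = 0" for n
  proof (rule integral_directional_derivative_eq_0[OF compact_superlevel[OF e_n(1)[of n]] open_D
      superlevel_subset[OF e_n(1)], where f="\<lambda>x. (s n x)^2 * (b i * x $ i)" and e="axis i 1"])
    fix x assume x: "x \<in> D"
    show "has_partial (\<lambda>x. (s n x)^2 * (b i * x $ i)) i (2 * s n x * g x $ i * (b i * x $ i) + (s n x)^2 * b i) x"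
      using has_partial_mult[OF deriv_pos_part_square_v[OF x, of _ "eps n"] has_partial_coordinate]
      by (simp add: s_def algebra_simps)
  qed (auto simp: s_def intro!: continuous_intros v_cont cont_g_nth)
  have "(\<lambda>n. LINT x|lborel. 2 * s n x * g x $ i * (b i * x $ i) + (s n x)^2 * b i) \<longlonglongrightarrow>
      (LINT x|lborel. 2 * v x * g x $ i * (b i * x $ i) + (v x)^2 * b i)"
  proof (rule integral_tendsto_dominated)
    fix n x
    have "\<bar>2 * s n x * g x $ i * (b i * x $ i)\<bar> \<le> 2 * \<bar>v x * g x $ i * (b i * x $ i)\<bar>"
      using s[of n x] by (simp add: abs_mult mult_right_mono)
    moreover have "(s n x)^2 * b i \<le> (v x)^2 * b i" "0 \<le> (s n x)^2 * b i"
      using s[of n x] b_pos[of i] by (auto intro!: mult_right_mono power_mono)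
    ultimately show "\<bar>2 * s n x * g x $ i * (b i * x $ i) + (s n x)^2 * b i\<bar>
      \<le> 2 * \<bar>v x * g x $ i * (b i * x $ i)\<bar> + (v x)^2 * b i"
      by linarith
  next
    show "integrable lborel (\<lambda>x. 2 * \<bar>v x * g x $ i * (b i * x $ i)\<bar> + (v x)^2 * b i)"
      using integrable_v_g_b integrable_v2 by auto
  qed (auto intro!: tendsto_intros lim)
  then have "(LINT x|lborel. 2 * v x * g x $ i * (b i * x $ i) + (v x)^2 * b i) = 0"
    unfolding zero by (simp add: LIMSEQ_const_iff)
  then have "(LINT x|lborel. 2 * (v x * g x $ i * (b i * x $ i))) + (LINT x|lborel. (v x)^2 * b i) = 0"
    using integrable_v_g_b[of i] integrable_v2
    by (subst Bochner_Integration.integral_add[symmetric]) (auto simp: mult.assoc)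
  then show ?thesis using normalized by simp
qed

definition \<rho> :: "real^'n \<Rightarrow> real^'n" where "\<rho> x = g x + v x *\<^sub>R diag_mult b x"

lemma rho_nth: "\<rho> x $ i = g x $ i + v x * (b i * x $ i)"
  by (simp add: \<rho>_def)

lemma rho_measurable [measurable]: "(\<lambda>x. \<rho> x $ i) \<in> borel_measurable borel"
  unfolding rho_nth by measurable

text \<open>The energy and virial identities combine to the ground state representation
  \<open>\<integral>|\<nabla>v + v Bx|^2 = \<nu> - \<beta> - \<integral>q v^2\<close>.\<close>

lemma integrable_rho2: "integrable lborel (\<lambda>x. (norm (\<rho> x))^2)"
  and integral_rho2: "(LINT x|lborel. (norm (\<rho> x))^2) \<le> \<nu> - \<beta>"
proof -
  obtain B where B: "B > 0" "\<And>x. x \<in> D \<Longrightarrow> norm (diag_mult b x) \<le> B"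
    using diag_mult_bounded by blast
  let ?W = "\<lambda>x. (norm (diag_mult b x))^2"
  have [measurable]: "diag_mult b \<in> borel_measurable borel"
    by (rule borel_measurable_continuous_onI) (rule continuous_on_diag_mult)
  have iW: "integrable lborel (\<lambda>x. (v x)^2 * ?W x)"
  proof (rule integrable_dominated)
    show "integrable lborel (\<lambda>x. (v x)^2 * B^2)" using integrable_v2 by simp
    have "(v x)^2 * ?W x \<le> (v x)^2 * B^2" for x
      by (cases "x \<in> D") (auto intro!: mult_left_mono power_mono B simp: v_outside)
    then show "\<bar>(v x)^2 * ?W x\<bar> \<le> (v x)^2 * B^2" for x by simp
  qed measurable
  have eq: "(norm (\<rho> x))^2 = (norm (g x))^2 + (\<Sum>i\<in>UNIV. 2 * (v x * g x $ i * (b i * x $ i))) + (v x)^2 * ?W x" for x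
    by (simp add: norm_power2_eq_sum rho_nth power2_sum sum.distrib sum_distrib_left power_mult_distrib algebra_simps)
  note ints = integrable_norm_g2 integrable_v_g_b iW integrable_lap_v integrable_v2
  show "integrable lborel (\<lambda>x. (norm (\<rho> x))^2)"
    unfolding eq using ints by (intro Bochner_Integration.integrable_add Bochner_Integration.integrable_sum integrable_mult_right) auto
  have "(LINT x|lborel. (norm (\<rho> x))^2) = (LINT x|lborel. (norm (g x))^2)
      + (\<Sum>i\<in>UNIV. LINT x|lborel. 2 * (v x * g x $ i * (b i * x $ i))) + (LINT x|lborel. (v x)^2 * ?W x)"
    unfolding eq using ints
    by (subst Bochner_Integration.integral_add Bochner_Integration.integral_sum | simp)+
  also have "\<dots> = (LINT x|lborel. (v x)^2 * ?W x) - (LINT x|lborel. v x * lap x) - \<beta>"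
    unfolding energy_identity cross_term by (simp add: sum_negf)
  also have "\<dots> = (LINT x|lborel. (v x)^2 * ?W x - v x * lap x) - \<beta>"
    using ints by simp
  \<comment> \<open>By the equation the integrand on the left is (\<nu> - q) v^2 inside
    \<open>D\<close>.\<close>
  also have "(LINT x|lborel. (v x)^2 * ?W x - v x * lap x) \<le> (LINT x|lborel. \<nu> * (v x)^2)"
  proof (rule integral_mono)
    fix x
    show "(v x)^2 * ?W x - v x * lap x \<le> \<nu> * (v x)^2"
    proof (cases "x \<in> D")
      case True
      then have "0 \<le> q x * (v x)^2" using q_nonneg by simp
      then show ?thesis using True by (simp add: lap_eq power2_eq_square algebra_simps)
    qed (simp add: v_outside)
  qed (use ints in auto)
  also have "\<dots> = \<nu>" using normalized by simp
  finally show "(LINT x|lborel. (norm (\<rho> x))^2) \<le> \<nu> - \<beta>" by simp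
qed

text \<open>The product of the truncated v with a test function is supported in a compact subset of
  \<open>D\<close>, so extension by zero creates no boundary term; the bounds on
  \<open>trunc\<close> and \<open>trunc'\<close> then allow the passage to the limit.\<close>

lemma weak_grad: "is_weak_grad v g"
  unfolding is_weak_grad_def
proof (intro conjI allI impI)
  fix \<psi> \<psi>' i K
  assume t: "test_pair (K :: (real^'n) set) i \<psi> \<psi>'"
  note [measurable] = test_pairD(7,8)[OF t]
  have psi: "integrable lborel (\<lambda>x. v x * \<psi>' x)" "integrable lborel (\<lambda>x. g x $ i * \<psi> x)"
    using test_pairD(9,10)[OF t] integrable_v2 integrable_g2 by (auto intro!: integrable_mult_of_squares)
  have zero: "(LINT x|lborel. trunc' (eps n) (v x) * (g x $ i * \<psi> x) + trunc (eps n) (v x) * \<psi>' x) = 0" for n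
  proof (rule integral_directional_derivative_eq_0[OF compact_superlevel[OF e_n(1)[of n]] open_D
      superlevel_subset[OF e_n(1)], where f="\<lambda>x. trunc (eps n) (v x) * \<psi> x" and e="axis i 1"])
    fix x assume x: "x \<in> D"
    show "has_partial (\<lambda>x. trunc (eps n) (v x) * \<psi> x) i (trunc' (eps n) (v x) * (g x $ i * \<psi> x) + trunc (eps n) (v x) * \<psi>' x) x"
      using has_partial_mult[OF deriv_trunc_v[OF x, of "eps n"] test_pairD(6)[OF t]]
      by (simp add: algebra_simps)
  next
    fix x assume "x \<notin> {x. eps n \<le> v x}"
    then show "trunc (eps n) (v x) * \<psi> x = 0" "trunc' (eps n) (v x) * (g x $ i * \<psi> x) + trunc (eps n) (v x) * \<psi>' x = 0"
      by (simp_all add: trunc_eq_0 not_le less_imp_le)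
  qed (auto intro!: continuous_intros cont_trunc_v cont_g_nth test_pairD(2,3)[OF t])
  have "(\<lambda>n. LINT x|lborel. trunc' (eps n) (v x) * (g x $ i * \<psi> x) + trunc (eps n) (v x) * \<psi>' x) \<longlonglongrightarrow>
      (LINT x|lborel. g x $ i * \<psi> x + v x * \<psi>' x)"
  proof (rule integral_tendsto_dominated)
    show "integrable lborel (\<lambda>x. \<bar>g x $ i * \<psi> x\<bar> + \<bar>v x * \<psi>' x\<bar>)" using psi by auto
    fix n x
    have "\<bar>trunc' (eps n) (v x) * (g x $ i * \<psi> x)\<bar> \<le> \<bar>g x $ i * \<psi> x\<bar>"
      by (subst abs_mult) (auto intro!: mult_left_le_one_le trunc_v_bounds simp: trunc_v_bounds)
    moreover have "\<bar>trunc (eps n) (v x) * \<psi>' x\<bar> \<le> \<bar>v x * \<psi>' x\<bar>"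
      by (simp add: abs_mult mult_right_mono trunc_v_bounds v_nonneg)
    ultimately show "\<bar>trunc' (eps n) (v x) * (g x $ i * \<psi> x) + trunc (eps n) (v x) * \<psi>' x\<bar>
        \<le> \<bar>g x $ i * \<psi> x\<bar> + \<bar>v x * \<psi>' x\<bar>"
      by linarith
  next
    show "(\<lambda>n. trunc' (eps n) (v x) * (g x $ i * \<psi> x) + trunc (eps n) (v x) * \<psi>' x)
        \<longlonglongrightarrow> g x $ i * \<psi> x + v x * \<psi>' x" for x
      by (intro tendsto_add trunc'_g_tendsto tendsto_mult_right trunc_v_tendsto) (simp add: g_outside)
  qed measurable
  then have "(LINT x|lborel. g x $ i * \<psi> x + v x * \<psi>' x) = 0"
    unfolding zero by (simp add: LIMSEQ_const_iff)
  then show "(LINT x|lborel. v x * \<psi>' x) = - (LINT x|lborel. g x $ i * \<psi> x)"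
    using psi by simp
qed (auto intro: integrable_v2 integrable_g2)

end

section \<open>Local averages and decay\<close>

lemma gderiv_bump3: "GDERIV (bump 3) y :> (- 6 * bump 2 y) *\<^sub>R (y::'a::euclidean_space)"
  using gderiv_bump[of 1 y] by (simp add: eval_nat_numeral)

lemma cball_subset_cball_0:
  fixes x :: "'a::real_normed_vector"
  assumes "norm x \<le> R"
  shows "cball x r \<subseteq> cball 0 (R + r)"
proof
  fix z assume "z \<in> cball x r"
  then show "z \<in> cball 0 (R + r)"
    using assms norm_triangle_sub[of z x] by (simp add: dist_norm norm_minus_commute)
qed

lemma integrable_mult_bump:
  fixes f :: "'a::euclidean_space \<Rightarrow> real"
  assumes "k > 0" "continuous_on (cball 0 1) f"
  shows "integrable lborel (\<lambda>y. f y * bump k y)"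
  by (rule integrable_compact_support[OF compact_cball[of 0 1]])
     (use assms in \<open>auto intro!: continuous_intros continuous_on_bump simp: bump_eq_0\<close>)

context well_eigenfunction begin

lemma I2_pos: "(LINT y|lborel. bump 2 (y::real^'n)) > 0"
  by (rule integral_bump_pos) simp

text \<open>The weight is not normalized, so averages are compared with \<open>v x\<close> times the
  integral of \<open>bump 2\<close>.\<close>

definition local_avg :: "real^'n \<Rightarrow> real \<Rightarrow> real" where
  "local_avg x r = (LINT y|lborel. v (x + r *\<^sub>R y) * bump 2 y)"

lemma local_avg_0: "local_avg x 0 = v x * (LINT y|lborel. bump 2 (y::real^'n))"
  by (simp add: local_avg_def)

lemma cont_lap: "continuous_on D lap"
  unfolding lap_def[abs_def] by (intro continuous_intros cont_l)

lemma mem_ball_D: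
  assumes "cball x (real CARD('n)) \<subseteq> D" "0 \<le> t" "t \<le> 1" "norm y \<le> real CARD('n)"
  shows "x + t *\<^sub>R y \<in> D"
proof -
  have "norm (t *\<^sub>R y) \<le> 1 * real CARD('n)"
    unfolding norm_scaleR by (intro mult_mono) (use assms in auto)
  then show ?thesis using assms(1) by (auto simp: dist_norm subset_eq)
qed

lemma one_le_CARD: "1 \<le> real CARD('n)"
  using zero_less_card_finite[where 'a='n] by linarith

lemma cont_ball:
  assumes "cball x (real CARD('n)) \<subseteq> D" "0 \<le> t" "t \<le> 1" "continuous_on D f"
  shows "continuous_on (cball 0 1) (\<lambda>y. f (x + t *\<^sub>R y))"
proof (rule continuous_on_compose2[OF assms(4)])
  show "(\<lambda>y. x + t *\<^sub>R y) ` cball 0 1 \<subseteq> D"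
    using mem_ball_D[OF assms(1-3) order_trans[OF _ one_le_CARD]] by auto
qed (intro continuous_intros)

text \<open>As \<open>\<nabla>(bump 3) = - 6 bump 2 y\<close>, integrating by parts turns the radial derivative
  of the average into an average of the Laplacian.\<close>

lemma DERIV_local_avg:
  assumes D: "cball x (real CARD('n)) \<subseteq> D" and t: "0 \<le> t" "t \<le> 1"
  shows "(local_avg x has_real_derivative t / 6 * (LINT y|lborel. lap (x + t *\<^sub>R y) * bump 3 y)) (at t within {0..1})"
proof -
  have "((\<lambda>t. LINT y|lborel. v (x + t *\<^sub>R 0 + (0 + t * 1) *\<^sub>R y) * bump 2 y) has_real_derivative
      (LINT y|lborel. (g (x + t *\<^sub>R 0 + (0 + t * 1) *\<^sub>R y) \<bullet> (0 + 1 *\<^sub>R y)) * bump 2 y)) (at t within {0..1})"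
    by (rule DERIV_local_average[OF gderiv_v cont_g _ continuous_on_bump _ t])
       (use mem_ball_D[OF D] in \<open>auto simp: bump_eq_0\<close>)
  then have d: "(local_avg x has_real_derivative (LINT y|lborel. (g (x + t *\<^sub>R y) \<bullet> y) * bump 2 y)) (at t within {0..1})"
    by (simp add: local_avg_def[abs_def])
  let ?U = "(\<lambda>y. x + t *\<^sub>R y) -` D"
  have U: "open ?U" by (intro open_vimage open_D continuous_intros)
  have KU: "cball 0 1 \<subseteq> ?U"
    using mem_ball_D[OF D t order_trans[OF _ one_le_CARD]] by auto
  have c: "continuous_on ?U (\<lambda>y. f (x + t *\<^sub>R y))" if "continuous_on D f" for f :: "real^'n \<Rightarrow> real"
    by (rule continuous_on_compose2[OF that]) (auto intro!: continuous_intros)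
  have zero: "(LINT y|lborel. t * l i (x + t *\<^sub>R y) * bump 3 y - 6 * (g (x + t *\<^sub>R y) $ i * y $ i * bump 2 y)) = 0" for i
  proof (rule integral_directional_derivative_eq_0[OF compact_cball U KU,
        where f="\<lambda>y. g (x + t *\<^sub>R y) $ i * bump 3 y" and e="axis i 1"])
    fix y assume y: "y \<in> ?U"
    \<comment> \<open>The base point is written \<open>t * 0\<close> to fit the chain rule through s
      -> t s, which also covers t = 0.\<close>
    have "((\<lambda>s. g ((x + t *\<^sub>R y) + s *\<^sub>R axis i 1) $ i) has_real_derivative l i (x + t *\<^sub>R y)) (at (t * 0))"
      using deriv_g[of "x + t *\<^sub>R y" i] y by simp
    then have "((\<lambda>s. g ((x + t *\<^sub>R y) + (t * s) *\<^sub>R axis i 1) $ i) has_real_derivative l i (x + t *\<^sub>R y) * t) (at 0)"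
      by (rule DERIV_chain2) (auto intro!: derivative_eq_intros)
    then have "has_partial (\<lambda>z. g (x + t *\<^sub>R z) $ i) i (l i (x + t *\<^sub>R y) * t) y"
      by (simp add: algebra_simps)
    from DERIV_mult[OF this gderiv_partial[OF gderiv_bump3[of y], of i]]
    show "has_partial (\<lambda>z. g (x + t *\<^sub>R z) $ i * bump 3 z) i (t * l i (x + t *\<^sub>R y) * bump 3 y - 6 * (g (x + t *\<^sub>R y) $ i * y $ i * bump 2 y)) y"
      by (simp add: algebra_simps)
  qed (auto intro!: continuous_intros c cont_l cont_g_nth continuous_on_bump simp: bump_eq_0)
  have i1: "integrable lborel (\<lambda>y. l i (x + t *\<^sub>R y) * bump 3 y)" for i
    by (intro integrable_mult_bump cont_ball[OF D t] cont_l) simp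
  have i2: "integrable lborel (\<lambda>y. g (x + t *\<^sub>R y) $ i * y $ i * bump 2 y)" for i
    by (intro integrable_mult_bump continuous_intros cont_ball[OF D t] cont_g) simp
  have "(LINT y|lborel. g (x + t *\<^sub>R y) $ i * y $ i * bump 2 y) = t / 6 * (LINT y|lborel. l i (x + t *\<^sub>R y) * bump 3 y)" for i
    using zero[of i] i1[of i] i2[of i] by (simp add: mult.assoc)
  then have "(\<Sum>i\<in>UNIV. LINT y|lborel. g (x + t *\<^sub>R y) $ i * y $ i * bump 2 y)
      = t / 6 * (\<Sum>i\<in>UNIV. LINT y|lborel. l i (x + t *\<^sub>R y) * bump 3 y)"
    by (simp only: sum_distrib_left)
  then have "(LINT y|lborel. (g (x + t *\<^sub>R y) \<bullet> y) * bump 2 y) = t / 6 * (LINT y|lborel. lap (x + t *\<^sub>R y) * bump 3 y)"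
    unfolding lap_def inner_vec_def sum_distrib_right inner_real_def
    using i1 i2 by simp
  with d show ?thesis by simp
qed

text \<open>A mean value inequality for -\<Delta>v <= \<nu> v. By \<open>DERIV_local_avg\<close> and
  bump 3 <= bump 2, the average at radius t has derivative at least -\<nu> t/6 times itself, and exp
  (\<nu> t^2/12) is the integrating factor.\<close>

lemma v_le_local_avg:
  assumes D: "cball x (real CARD('n)) \<subseteq> D"
  shows "v x * (LINT y|lborel. bump 2 (y::real^'n)) \<le> exp (\<nu> / 12) * local_avg x 1"
proof -
  have nu: "\<nu> \<ge> 0" using nu_ge beta_pos by linarith
  let ?F = "\<lambda>t. exp (\<nu> * t^2 / 12) * local_avg x t"
  let ?L = "\<lambda>t. LINT y|lborel. lap (x + t *\<^sub>R y) * bump 3 y"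
  have dF: "(?F has_real_derivative exp (\<nu> * t^2 / 12) * (t / 6) * (\<nu> * local_avg x t + ?L t)) (at t within {0..1})"
    if t: "t \<in> {0..1}" for t
  proof -
    have 1: "((\<lambda>t. exp (\<nu> * t^2 / 12)) has_real_derivative exp (\<nu> * t^2 / 12) * (\<nu> * t / 6)) (at t within {0..1})"
      by (auto intro!: derivative_eq_intros)
    show ?thesis
      using DERIV_mult[OF 1 DERIV_local_avg[OF D, of t]] t by (simp add: algebra_simps)
  qed
  have nonneg: "0 \<le> exp (\<nu> * t^2 / 12) * (t / 6) * (\<nu> * local_avg x t + ?L t)" if t: "t \<in> {0..1}" for t
  proof -
    have i1: "integrable lborel (\<lambda>y. lap (x + t *\<^sub>R y) * bump 3 y)"
      by (rule integrable_mult_bump[OF _ cont_ball[OF D _ _ cont_lap]]) (use t in auto)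
    have i2: "integrable lborel (\<lambda>y. v (x + t *\<^sub>R y) * bump 2 y)"
      by (rule integrable_mult_bump[OF _ cont_ball[OF D _ _ v_cont]]) (use t in auto)
    have "- (\<nu> * local_avg x t) = (LINT y|lborel. - (\<nu> * (v (x + t *\<^sub>R y) * bump 2 y)))"
      by (simp add: local_avg_def)
    also have "\<dots> \<le> ?L t"
    proof (rule integral_mono)
      fix y
      have "- lap (x + t *\<^sub>R y) * bump 3 y \<le> \<nu> * v (x + t *\<^sub>R y) * bump 3 y"
        by (rule mult_right_mono[OF neg_lap_le bump_nonneg])
      also have "\<dots> \<le> \<nu> * v (x + t *\<^sub>R y) * bump 2 y"
        using bump_Suc_le[of 2 y] nu v_nonneg[of "x + t *\<^sub>R y"] by (intro mult_left_mono) auto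
      finally show "- (\<nu> * (v (x + t *\<^sub>R y) * bump 2 y)) \<le> lap (x + t *\<^sub>R y) * bump 3 y"
        by (simp add: mult.assoc)
    qed (use i1 i2 in auto)
    finally have "0 \<le> \<nu> * local_avg x t + ?L t" by simp
    then show ?thesis using t by simp
  qed
  have "?F 0 \<le> ?F 1"
  proof (rule DERIV_nonneg_imp_increasing_open[where f="?F" and a=0 and b=1])
    fix t :: real assume t: "0 < t" "t < 1"
    then have "at t within {0..1} = at t" by (rule at_within_Icc_at)
    with dF[of t] nonneg[of t] t show "\<exists>y. (?F has_real_derivative y) (at t) \<and> 0 \<le> y"
      by auto
  qed (use DERIV_continuous_on[OF dF] in auto)
  then show ?thesis by (simp add: local_avg_0)
qed

text \<open>The normalization enters through 2ab <= a^2 + b^2 with b = \<open>bump 2\<close>, whose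
  square is \<open>bump 4\<close>. Apart from the dimension, the bound depends on \<nu>
  alone.\<close>

lemma v_le:
  assumes D: "cball x (real CARD('n)) \<subseteq> D"
  shows "v x \<le> exp (\<nu> / 12) * ((1 + (LINT y|lborel. bump 4 (y::real^'n))) / 2) / (LINT y|lborel. bump 2 (y::real^'n))"
proof -
  have i1: "integrable lborel (\<lambda>y. v (x + 1 *\<^sub>R y) * bump 2 y)"
    by (rule integrable_mult_bump[OF _ cont_ball[OF D _ _ v_cont]]) auto
  have i2: "integrable lborel (\<lambda>y. (v (y + x))^2)"
    using lborel_translate_integrable_iff[of "\<lambda>y. (v y)^2" x] integrable_v2 by simp
  have n: "(LINT y|lborel. (v (y + x))^2) = 1"
    using lborel_translate_integral[of "\<lambda>y. (v y)^2" x] normalized by simp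
  have i4: "integrable lborel (bump 4 :: real^'n \<Rightarrow> real)" by (rule integrable_bump) simp
  have "local_avg x 1 \<le> (LINT y|lborel. ((v (y + x))^2 + bump 4 y) / 2)"
    unfolding local_avg_def
  proof (rule integral_mono[OF i1])
    show "integrable lborel (\<lambda>y. ((v (y + x))^2 + bump 4 y) / 2)" using i2 i4 by auto
    fix y :: "real^'n"
    have "bump 4 y = (bump 2 y)^2" by (simp add: bump_def power_mult[symmetric])
    then show "v (x + 1 *\<^sub>R y) * bump 2 y \<le> ((v (y + x))^2 + bump 4 y) / 2"
      using sum_squares_bound[of "v (x + y)" "bump 2 y"] by (simp add: add.commute)
  qed
  also have "\<dots> = (1 + (LINT y|lborel. bump 4 (y::real^'n))) / 2"
    using i2 i4 n by simp
  finally have "exp (\<nu> / 12) * local_avg x 1 \<le> exp (\<nu> / 12) * ((1 + (LINT y|lborel. bump 4 (y::real^'n))) / 2)"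
    by (rule mult_left_mono) simp
  from order_trans[OF v_le_local_avg[OF D] this] show ?thesis
    by (subst pos_le_divide_eq[OF I2_pos])
qed

text \<open>Integrates \<open>DERIV_local_avg\<close> from radius 0: a local bound on the Laplacian
  controls the distance of v from its averages linearly in the radius.\<close>

lemma local_avg_diff:
  assumes D: "cball x (real CARD('n)) \<subseteq> D" and L: "\<And>y. y \<in> cball x 1 \<Longrightarrow> \<bar>lap y\<bar> \<le> L"
    and t: "0 \<le> t" "t \<le> 1"
  shows "\<bar>local_avg x t - v x * (LINT y|lborel. bump 2 (y::real^'n))\<bar> \<le> L * (LINT y|lborel. bump 2 (y::real^'n)) * t"
proof -
  have L0: "L \<ge> 0" using L[of x] by force
  have "norm (local_avg x t - local_avg x 0) \<le> L * (LINT y|lborel. bump 2 (y::real^'n)) * norm (t - 0)"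
  proof (rule field_differentiable_bound[OF _ DERIV_local_avg[OF D]])
    fix s :: real assume s: "s \<in> {0..1}"
    have i1: "integrable lborel (\<lambda>y. lap (x + s *\<^sub>R y) * bump 3 y)"
      by (rule integrable_mult_bump[OF _ cont_ball[OF D _ _ cont_lap]]) (use s in auto)
    have "\<bar>LINT y|lborel. lap (x + s *\<^sub>R y) * bump 3 y\<bar> \<le> (LINT y|lborel. \<bar>lap (x + s *\<^sub>R y) * bump 3 y\<bar>)"
      by (rule integral_abs_bound)
    also have "\<dots> \<le> (LINT y|lborel. L * bump 2 (y::real^'n))"
    proof (rule integral_mono)
      fix y :: "real^'n"
      show "\<bar>lap (x + s *\<^sub>R y) * bump 3 y\<bar> \<le> L * bump 2 y"
      proof (cases "norm y \<le> 1")
        case True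
        have "s * norm y \<le> 1 * 1" by (intro mult_mono) (use s True in auto)
        then have "\<bar>lap (x + s *\<^sub>R y)\<bar> \<le> L" using s by (intro L) (auto simp: dist_norm)
        then have "\<bar>lap (x + s *\<^sub>R y)\<bar> * bump 3 y \<le> L * bump 2 y"
          using bump_Suc_le[of 2 y] bump_nonneg[of 3 y] L0 by (intro mult_mono) auto
        then show ?thesis by (simp add: abs_mult bump_nonneg)
      qed (simp add: bump_eq_0)
    qed (use i1 integrable_bump[of 2] in auto)
    finally have 2: "\<bar>LINT y|lborel. lap (x + s *\<^sub>R y) * bump 3 y\<bar> \<le> L * (LINT y|lborel. bump 2 (y::real^'n))" by simp
    have "\<bar>s / 6\<bar> * \<bar>LINT y|lborel. lap (x + s *\<^sub>R y) * bump 3 y\<bar> \<le> 1 * (L * (LINT y|lborel. bump 2 (y::real^'n)))"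
      by (rule mult_mono[OF _ 2]) (use s in auto)
    then show "norm (s / 6 * (LINT y|lborel. lap (x + s *\<^sub>R y) * bump 3 y)) \<le> L * (LINT y|lborel. bump 2 (y::real^'n))"
      by (simp add: abs_mult)
  qed (use t in auto)
  then show ?thesis using t by (simp add: local_avg_0)
qed

section \<open>Oscillation of the quotient of v by the ground state\<close>

definition h :: "real^'n \<Rightarrow> real" where "h x = v x * egauss b (- 1) x"

definition h_avg :: "real^'n \<Rightarrow> real \<Rightarrow> real" where
  "h_avg x r = (LINT y|lborel. h (x + r *\<^sub>R y) * bump 2 y)"

lemma gderiv_h: "x \<in> D \<Longrightarrow> GDERIV h x :> egauss b (- 1) x *\<^sub>R \<rho> x"
  using GDERIV_mult[OF gderiv_v gderiv_egauss[of b "- 1"], of x]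
  by (simp add: h_def[abs_def] \<rho>_def scaleR_right_distrib add.commute mult.commute)

lemma cont_h: "continuous_on S h"
  unfolding h_def[abs_def] by (intro continuous_intros v_cont continuous_on_egauss)

lemma cont_rho: "continuous_on D \<rho>"
  unfolding \<rho>_def[abs_def] by (intro continuous_intros v_cont cont_g continuous_on_diag_mult)

text \<open>Freezing the factor 1/G at the centre \<open>x\<close> costs V |K| r by its Lipschitz
  bound; the rest is at most \<open>H\<close> times the error in
  \<open>local_avg_diff\<close>.\<close>

lemma h_avg_approx:
  assumes D: "cball 0 (R + real CARD('n)) \<subseteq> D" and x: "norm x \<le> R"
    and V: "\<And>y. norm y \<le> R + 1 \<Longrightarrow> v y \<le> V" and L: "\<And>y. norm y \<le> R + 1 \<Longrightarrow> \<bar>lap y\<bar> \<le> L"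
    and H: "\<And>y. norm y \<le> R + 1 \<Longrightarrow> egauss b (- 1) y \<le> H"
    and K: "\<And>y z. norm y \<le> R + 1 \<Longrightarrow> norm z \<le> R + 1 \<Longrightarrow>
              \<bar>egauss b (- 1) y - egauss b (- 1) z\<bar> \<le> K * norm (y - z)"
    and r: "0 \<le> r" "r \<le> 1"
  shows "\<bar>h_avg x r - h x * (LINT y|lborel. bump 2 (y::real^'n))\<bar> \<le> (H * L + V * \<bar>K\<bar>) * (LINT y|lborel. bump 2 (y::real^'n)) * r"
proof -
  let ?E = "egauss b (- 1)"
  have Dx: "cball x (real CARD('n)) \<subseteq> D"
    using cball_subset_cball_0[OF x] D by blast
  have V0: "V \<ge> 0" using V[of x] v_nonneg[of x] x by simp
  have 1: "\<bar>local_avg x r - v x * (LINT y|lborel. bump 2 (y::real^'n))\<bar> \<le> L * (LINT y|lborel. bump 2 (y::real^'n)) * r"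
  proof (rule local_avg_diff[OF Dx _ r])
    fix y assume "y \<in> cball x 1"
    then have "norm y \<le> R + 1" using cball_subset_cball_0[OF x] by force
    then show "\<bar>lap y\<bar> \<le> L" by (rule L)
  qed
  have i1: "integrable lborel (\<lambda>y. h (x + r *\<^sub>R y) * bump 2 y)"
    by (rule integrable_mult_bump[OF _ cont_ball[OF Dx r cont_h]]) auto
  have i2: "integrable lborel (\<lambda>y. v (x + r *\<^sub>R y) * bump 2 y)"
    by (rule integrable_mult_bump[OF _ cont_ball[OF Dx r v_cont]]) auto
  have i3: "integrable lborel (bump 2 :: real^'n \<Rightarrow> real)" by (rule integrable_bump) simp
  have "h_avg x r - ?E x * local_avg x r = (LINT y|lborel. h (x + r *\<^sub>R y) * bump 2 y - ?E x * (v (x + r *\<^sub>R y) * bump 2 y))"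
    unfolding h_avg_def local_avg_def using i1 i2 by simp
  also have "\<bar>\<dots>\<bar> \<le> (LINT y|lborel. \<bar>h (x + r *\<^sub>R y) * bump 2 y - ?E x * (v (x + r *\<^sub>R y) * bump 2 y)\<bar>)"
    by (rule integral_abs_bound)
  also have "\<dots> \<le> (LINT y|lborel. V * \<bar>K\<bar> * r * bump 2 (y::real^'n))"
  proof (rule integral_mono)
    fix y :: "real^'n"
    show "\<bar>h (x + r *\<^sub>R y) * bump 2 y - ?E x * (v (x + r *\<^sub>R y) * bump 2 y)\<bar> \<le> V * \<bar>K\<bar> * r * bump 2 y"
    proof (cases "norm y \<le> 1")
      case True
      have ry: "r * norm y \<le> 1 * 1" by (intro mult_mono) (use r True in auto)
      have "norm (x + r *\<^sub>R y) \<le> R + 1"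
        using norm_triangle_ineq[of x "r *\<^sub>R y"] x ry r by simp
      then have v: "v (x + r *\<^sub>R y) \<le> V" and e: "\<bar>?E (x + r *\<^sub>R y) - ?E x\<bar> \<le> K * norm (r *\<^sub>R y)"
        using V K[of "x + r *\<^sub>R y" x] x by auto
      have "K * norm (r *\<^sub>R y) \<le> \<bar>K\<bar> * (r * 1)"
        using True r by (intro mult_mono) (auto simp: mult_left_le)
      with e have "\<bar>?E (x + r *\<^sub>R y) - ?E x\<bar> \<le> \<bar>K\<bar> * r" by simp
      with v have "v (x + r *\<^sub>R y) * \<bar>?E (x + r *\<^sub>R y) - ?E x\<bar> \<le> V * (\<bar>K\<bar> * r)"
        using V0 by (intro mult_mono) auto
      from mult_right_mono[OF this bump_nonneg[of 2 y]]
      have "v (x + r *\<^sub>R y) * \<bar>?E (x + r *\<^sub>R y) - ?E x\<bar> * bump 2 y \<le> V * \<bar>K\<bar> * r * bump 2 y"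
        by (simp add: mult_ac)
      moreover have "h (x + r *\<^sub>R y) * bump 2 y - ?E x * (v (x + r *\<^sub>R y) * bump 2 y)
          = v (x + r *\<^sub>R y) * (?E (x + r *\<^sub>R y) - ?E x) * bump 2 y"
        by (simp add: h_def algebra_simps)
      ultimately show ?thesis by (simp add: abs_mult v_nonneg bump_nonneg)
    qed (simp add: bump_eq_0)
  qed (use i1 i2 i3 in auto)
  finally have 2: "\<bar>h_avg x r - ?E x * local_avg x r\<bar> \<le> V * \<bar>K\<bar> * r * (LINT y|lborel. bump 2 (y::real^'n))" by simp
  have "?E x * local_avg x r - h x * (LINT y|lborel. bump 2 (y::real^'n)) = ?E x * (local_avg x r - v x * (LINT y|lborel. bump 2 (y::real^'n)))"
    by (simp add: h_def algebra_simps)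
  then have "\<bar>?E x * local_avg x r - h x * (LINT y|lborel. bump 2 (y::real^'n))\<bar> \<le> H * (L * (LINT y|lborel. bump 2 (y::real^'n)) * r)"
    using 1 H[of x] x egauss_pos[of b "- 1" x]
    by (simp add: abs_mult) (intro mult_mono, auto intro: order_trans)
  with 2 have "\<bar>h_avg x r - h x * (LINT y|lborel. bump 2 (y::real^'n))\<bar> \<le> V * \<bar>K\<bar> * r * (LINT y|lborel. bump 2 (y::real^'n)) + H * (L * (LINT y|lborel. bump 2 (y::real^'n)) * r)"
    by linarith
  then show ?thesis by (simp add: algebra_simps)
qed

text \<open>Along the segment from 0 to \<open>x\<close> the average changes at the rate of the
  average of (\<rho>/G) \<bullet> x. Young's inequality with parameter \<open>s\<close> produces
  |\<rho>|^2, and rescaling the ball bounds its integral by r^-N (\<nu> - \<beta>).\<close>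

lemma h_avg_diff:
  assumes D: "cball 0 (R + real CARD('n)) \<subseteq> D" and x: "norm x \<le> R"
    and H: "\<And>y. norm y \<le> R + 1 \<Longrightarrow> egauss b (- 1) y \<le> H"
    and r: "0 < r" "r \<le> 1" and s: "s > 0"
  shows "\<bar>h_avg x r - h_avg 0 r\<bar> \<le> R * H * ((\<nu> - \<beta>) / (r ^ CARD('n) * (2 * s)) + s / 2 * (LINT y|lborel. bump 2 (y::real^'n)))"
proof -
  let ?E = "egauss b (- 1)"
  let ?g = "\<lambda>x. ?E x *\<^sub>R \<rho> x"
  let ?B = "R * H * ((\<nu> - \<beta>) / (r ^ CARD('n) * (2 * s)) + s / 2 * (LINT y|lborel. bump 2 (y::real^'n)))"
  have R0: "R \<ge> 0" using x norm_ge_zero[of x] by linarith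
  have H0: "H \<ge> 0" using H[of 0] R0 by simp
  have cg: "continuous_on D ?g" by (intro continuous_intros continuous_on_egauss cont_rho)
  have inD: "t *\<^sub>R x + r *\<^sub>R y \<in> D" if "0 \<le> t" "t \<le> 1" "norm y \<le> real CARD('n)" for t y
  proof -
    have "t * norm x \<le> 1 * R" "r * norm y \<le> 1 * real CARD('n)"
      using that x r by (intro mult_mono; simp)+
    then have "norm (t *\<^sub>R x + r *\<^sub>R y) \<le> R + real CARD('n)"
      using norm_triangle_ineq[of "t *\<^sub>R x" "r *\<^sub>R y"] that r by simp
    then show ?thesis using D by auto
  qed
  define P where "P t = (LINT y|lborel. h (0 + t *\<^sub>R x + (r + t * 0) *\<^sub>R y) * bump 2 y)" for t
  have dP: "(P has_real_derivative (LINT y|lborel. (?g (0 + t *\<^sub>R x + (r + t * 0) *\<^sub>R y) \<bullet> (x + 0 *\<^sub>R y)) * bump 2 y)) (at t within {0..1})"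
    if "t \<in> {0..1}" for t
    unfolding P_def
    by (rule DERIV_local_average[OF gderiv_h cg _ continuous_on_bump]) (use inD that in \<open>auto simp: bump_eq_0\<close>)
  have mr: "(\<lambda>x. (norm (\<rho> x))^2) \<in> borel_measurable borel"
    unfolding norm_power2_eq_sum by measurable
  have "norm (P 1 - P 0) \<le> ?B * norm (1 - 0 :: real)"
  proof (rule field_differentiable_bound[OF _ dP])
    fix t :: real assume t: "t \<in> {0..1}"
    let ?p = "\<lambda>y. t *\<^sub>R x + r *\<^sub>R y"
    have ir: "integrable lborel (\<lambda>y. (norm (\<rho> (?p y)))^2)"
      using lborel_affine_integrable_iff[OF mr, of r "t *\<^sub>R x"] r integrable_rho2 by simp
    have vr: "(LINT y|lborel. (norm (\<rho> (?p y)))^2) \<le> (\<nu> - \<beta>) / r ^ CARD('n)"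
      using lborel_affine_integral[OF mr, of r "t *\<^sub>R x"] r integral_rho2
      by (simp add: le_divide_eq mult.commute)
    have ib: "integrable lborel (bump 2 :: real^'n \<Rightarrow> real)" by (rule integrable_bump) simp
    have c1: "continuous_on (cball 0 1) (\<lambda>y. ?g (?p y) \<bullet> x)"
    proof (rule continuous_on_inner[OF continuous_on_compose2[OF cg] continuous_on_const])
      show "?p ` cball 0 1 \<subseteq> D"
        using inD[OF _ _ order_trans[OF _ one_le_CARD]] t by auto
    qed (intro continuous_intros)
    have i1: "integrable lborel (\<lambda>y. (?g (?p y) \<bullet> x) * bump 2 y)"
      by (rule integrable_mult_bump[OF _ c1]) simp
    have "\<bar>LINT y|lborel. (?g (?p y) \<bullet> x) * bump 2 y\<bar> \<le> (LINT y|lborel. \<bar>(?g (?p y) \<bullet> x) * bump 2 y\<bar>)"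
      by (rule integral_abs_bound)
    also have "\<dots> \<le> (LINT y|lborel. R * H * ((norm (\<rho> (?p y)))^2 / (2 * s) + s / 2 * bump 2 y))"
    proof (rule integral_mono)
      fix y :: "real^'n"
      show "\<bar>(?g (?p y) \<bullet> x) * bump 2 y\<bar> \<le> R * H * ((norm (\<rho> (?p y)))^2 / (2 * s) + s / 2 * bump 2 y)"
      proof (cases "norm y \<le> 1")
        case True
        have "t * norm x \<le> 1 * R" "r * norm y \<le> 1 * 1"
          using True x r t by (intro mult_mono; simp)+
        then have "norm (?p y) \<le> R + 1"
          using norm_triangle_ineq[of "t *\<^sub>R x" "r *\<^sub>R y"] t r by simp
        then have E: "?E (?p y) \<le> H" by (rule H)
        have "\<bar>?g (?p y) \<bullet> x\<bar> \<le> ?E (?p y) * norm (\<rho> (?p y)) * norm x"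
          using Cauchy_Schwarz_ineq2[of "?g (?p y)" x] egauss_pos[of b "- 1" "?p y"] by simp
        also have "\<dots> \<le> H * norm (\<rho> (?p y)) * R"
          using E x H0 by (intro mult_mono) auto
        finally have 1: "\<bar>?g (?p y) \<bullet> x\<bar> * bump 2 y \<le> R * H * (norm (\<rho> (?p y)) * bump 2 y)"
          using mult_right_mono[OF _ bump_nonneg[of 2 y]] by (force simp: mult_ac)
        have "0 \<le> (norm (\<rho> (?p y)) - s)^2 * bump 2 y" by (simp add: bump_nonneg)
        then have "2 * s * (norm (\<rho> (?p y)) * bump 2 y) \<le> (norm (\<rho> (?p y)))^2 * bump 2 y + s^2 * bump 2 y"
          by (simp add: power2_diff algebra_simps)
        also have "(norm (\<rho> (?p y)))^2 * bump 2 y \<le> (norm (\<rho> (?p y)))^2 * 1"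
          by (intro mult_left_mono bump_le_1) simp
        finally have "norm (\<rho> (?p y)) * bump 2 y \<le> (norm (\<rho> (?p y)))^2 / (2 * s) + s / 2 * bump 2 y"
          using s by (simp add: field_simps power2_eq_square)
        from mult_left_mono[OF this, of "R * H"] 1 R0 H0 show ?thesis
          by (simp add: abs_mult bump_nonneg)
      next
        case False
        then show ?thesis using R0 H0 s by (simp add: bump_eq_0)
      qed
    qed (use i1 ir ib in auto)
    also have "\<dots> = R * H * ((LINT y|lborel. (norm (\<rho> (?p y)))^2) / (2 * s) + s / 2 * (LINT y|lborel. bump 2 (y::real^'n)))"
      using ir ib by simp
    also have "\<dots> \<le> R * H * (((\<nu> - \<beta>) / r ^ CARD('n)) / (2 * s) + s / 2 * (LINT y|lborel. bump 2 (y::real^'n)))"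
      using vr R0 H0 s by (intro mult_left_mono add_right_mono divide_right_mono) auto
    finally show "norm (LINT y|lborel. (?g (0 + t *\<^sub>R x + (r + t * 0) *\<^sub>R y) \<bullet> (x + 0 *\<^sub>R y)) * bump 2 y) \<le> ?B"
      by simp
  qed auto
  then show ?thesis by (simp add: P_def h_avg_def)
qed

text \<open>The barrier is \<kappa> G^(1/2), with \<kappa> making it at least \<open>M\<close> on
  the ball of radius \<open>R\<close>. Beyond that ball, a positive maximum of v minus the barrier
  would force |Bx|^2 + q - \<nu> < |Bx|^2/4 - \<beta>/2, the quarter being \<theta>^2 for \<theta> =
  1/2; this contradicts 3/4 |Bx|^2 > \<nu>.\<close>

lemma decay:
  assumes M: "M > 0" "\<And>y. norm y \<le> R \<Longrightarrow> v y \<le> M" and R: "R \<ge> 0"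
    and c0: "c0 \<ge> 0" "\<And>i. c0 \<le> b i" "3 / 4 * (c0^2 * R^2) > \<nu>"
  shows "v y \<le> M * exp (\<beta> * R^2 / 4) * egauss b (1/2) y"
proof (rule ccontr)
  define \<kappa> where "\<kappa> = M * exp (\<beta> * R^2 / 4)"
  have \<kappa>: "\<kappa> > 0" using M by (simp add: \<kappa>_def)
  let ?E = "egauss b (1/2)"
  let ?f = "\<lambda>x. v x - \<kappa> * ?E x"
  assume "\<not> v y \<le> M * exp (\<beta> * R^2 / 4) * ?E y"
  then have fy: "?f y > 0" by (simp add: \<kappa>_def)
  then have "v y > 0" using \<kappa> egauss_pos[of b "1/2" y] by (smt (verit) mult_pos_pos)
  then have yD: "y \<in> D" by (rule D_if_pos)
  obtain x where x: "x \<in> closure D" "\<And>z. z \<in> closure D \<Longrightarrow> ?f z \<le> ?f x"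
  proof -
    have "continuous_on (closure D) ?f"
      by (intro continuous_intros v_cont continuous_on_egauss)
    moreover have "closure D \<noteq> {}" using D_nonempty by simp
    ultimately show ?thesis
      using continuous_attains_sup[OF compact_closure_D] that by blast
  qed
  have "?f y \<le> ?f x" using x(2) yD closure_subset by blast
  with fy have fx: "v x > \<kappa> * ?E x" by linarith
  have E: "?E x > 0" by (rule egauss_pos)
  have "\<kappa> * ?E x > 0" using \<kappa> E by (rule mult_pos_pos)
  then have "v x > 0" using fx by linarith
  then have xD: "x \<in> D" by (rule D_if_pos)
  have nx: "norm x > R"
  proof (rule ccontr)
    assume "\<not> norm x > R"
    then have le: "norm x \<le> R" by simp
    have "exp (- (\<beta> * R^2 / 4)) \<le> ?E x"
      using egauss_ge[of "1/2" b x R] b_pos le by simp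
    then have "\<kappa> * exp (- (\<beta> * R^2 / 4)) \<le> \<kappa> * ?E x"
      using \<kappa> by (intro mult_left_mono) auto
    then have "M \<le> \<kappa> * ?E x" by (simp add: \<kappa>_def mult.assoc exp_minus)
    then show False using fx M(2)[OF le] by linarith
  qed
  let ?W = "(norm (diag_mult b x))^2"
  have W: "3 / 4 * ?W > \<nu>"
  proof -
    have "c0^2 * R^2 \<le> c0^2 * (norm x)^2" using nx R by (intro mult_left_mono power_mono) auto
    also have "\<dots> = (\<Sum>i\<in>UNIV. c0^2 * (x $ i)^2)" by (simp add: norm_power2_eq_sum sum_distrib_left)
    also have "\<dots> \<le> ?W" unfolding norm_diag_mult_eq power_mult_distrib
      by (intro sum_mono mult_right_mono power_mono c0) auto
    finally show ?thesis using c0(3) by linarith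
  qed
  have "1 * ((?W + q x - \<nu>) * v x) + - \<kappa> * (((1/2)^2 * ?W - 1/2 * \<beta>) * ?E x) \<le> 0"
  proof (rule comparison_at_max[OF open_D xD])
    fix z assume "z \<in> D"
    then show "1 * v z + - \<kappa> * ?E z \<le> 1 * v x + - \<kappa> * ?E x"
      using x(2)[of z] closure_subset by auto
  qed simp
  then have 1: "(?W + q x - \<nu>) * v x \<le> (?W / 4 - \<beta> / 2) * (\<kappa> * ?E x)"
    by (simp add: power2_eq_square algebra_simps)
  have pos: "?W + q x - \<nu> > 0" using W q_nonneg[OF xD] zero_le_power2[of "norm (diag_mult b x)"] by linarith
  have "(?W + q x - \<nu>) * (\<kappa> * ?E x) < (?W + q x - \<nu>) * v x"
    using fx pos by (intro mult_strict_left_mono)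
  with 1 have "(?W + q x - \<nu>) * (\<kappa> * ?E x) < (?W / 4 - \<beta> / 2) * (\<kappa> * ?E x)" by linarith
  then have "?W + q x - \<nu> < ?W / 4 - \<beta> / 2"
    using \<open>\<kappa> * ?E x > 0\<close> by (simp add: mult_less_cancel_right)
  then show False using W q_nonneg[OF xD] beta_pos by linarith
qed

end

section \<open>Convergence of a family of eigenfunctions\<close>

lemma gderiv_lipschitz:
  assumes S: "convex S" and gd: "\<And>x. x \<in> S \<Longrightarrow> GDERIV f x :> g x" and B: "\<And>x. x \<in> S \<Longrightarrow> norm (g x) \<le> B"
    and xy: "x \<in> S" "y \<in> S"
  shows "\<bar>f x - f y\<bar> \<le> B * norm (x - y)"
proof -
  have "norm (f x - f y) \<le> B * norm (x - y)"
  proof (rule differentiable_bound[OF S _ _ xy])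
    fix z assume z: "z \<in> S"
    show "(f has_derivative (\<lambda>h. h \<bullet> g z)) (at z within S)"
      using gd[OF z] by (simp add: gderiv_def has_derivative_at_withinI)
    show "onorm (\<lambda>h. h \<bullet> g z) \<le> B"
    proof (rule onorm_bound)
      show "0 \<le> B" using B[OF z] norm_ge_zero[of "g z"] by linarith
      fix h
      have "\<bar>h \<bullet> g z\<bar> \<le> norm h * norm (g z)" by (rule Cauchy_Schwarz_ineq2)
      also have "\<dots> \<le> norm h * B" by (intro mult_left_mono B z) simp
      finally show "norm (h \<bullet> g z) \<le> B * norm h" by (simp add: mult.commute)
    qed
  qed
  then show ?thesis by simp
qed

text \<open>Meant for \<theta> = -1: the gradient of 1/G is unbounded on the whole space but bounded
  on each ball.\<close>

lemma egauss_locally_lipschitz: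
  fixes b :: "'n::finite \<Rightarrow> real"
  obtains K where "\<And>y z. norm y \<le> R \<Longrightarrow> norm z \<le> R \<Longrightarrow> \<bar>egauss b \<theta> y - egauss b \<theta> z\<bar> \<le> K * norm (y - z)"
proof -
  let ?g = "\<lambda>x. (- \<theta> * egauss b \<theta> x) *\<^sub>R diag_mult b x"
  have "compact (?g ` cball 0 R)"
    by (intro compact_continuous_image continuous_intros continuous_on_egauss continuous_on_diag_mult compact_cball)
  then have "bounded (?g ` cball 0 R)" by (rule compact_imp_bounded)
  then obtain B where "\<forall>y\<in>?g ` cball 0 R. norm y \<le> B" unfolding bounded_iff by blast
  then have B: "norm (?g x) \<le> B" if "x \<in> cball 0 R" for x using that by blast
  have "\<bar>egauss b \<theta> y - egauss b \<theta> z\<bar> \<le> B * norm (y - z)" if "norm y \<le> R" "norm z \<le> R" for y z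
    by (rule gderiv_lipschitz[OF convex_cball[of 0 R] gderiv_egauss B]) (use that in simp_all)
  then show ?thesis by (rule that)
qed

lemma norm_diag_mult_le:
  assumes "\<And>i. b i > 0"
  shows "(norm (diag_mult b x))^2 \<le> sum b UNIV * (\<Sum>i\<in>UNIV. b i * (x $ i)^2)"
proof -
  have "(norm (diag_mult b x))^2 = (\<Sum>i\<in>UNIV. b i * (b i * (x $ i)^2))"
    by (simp add: norm_power2_eq_sum power_mult_distrib power2_eq_square[of "b _"] mult.assoc)
  also have "\<dots> \<le> (\<Sum>i\<in>UNIV. (\<Sum>j\<in>UNIV. b j) * (b i * (x $ i)^2))"
    by (intro sum_mono mult_right_mono member_le_sum) (simp_all add: assms less_imp_le)
  finally show ?thesis by (simp add: sum_distrib_left)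
qed

lemma norm_diag_mult_egauss_le:
  assumes "\<theta> > 0" "\<And>i. b i > 0"
  shows "(norm (diag_mult b x))^2 * egauss b \<theta> x \<le> sum b UNIV * (4 / \<theta>) * egauss b (\<theta> / 2) x"
proof -
  have "(norm (diag_mult b x))^2 * egauss b \<theta> x \<le> sum b UNIV * (\<Sum>i\<in>UNIV. b i * (x $ i)^2) * egauss b \<theta> x"
    by (intro mult_right_mono norm_diag_mult_le assms) (simp add: egauss_pos less_imp_le)
  also have "\<dots> \<le> sum b UNIV * (4 / \<theta> * egauss b (\<theta> / 2) x)"
    unfolding mult.assoc by (intro mult_left_mono quadratic_mult_egauss_le assms sum_nonneg) (use assms in \<open>auto intro: less_imp_le\<close>)
  finally show ?thesis by (simp add: mult.assoc)
qed

text \<open>Here |\<nabla>G|^2 = |Bx|^2 G^2, which \<open>norm_diag_mult_egauss_le\<close> at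
  \<theta> = 2 bounds by 2 tr B times G <= 1.\<close>

lemma egauss_lipschitz:
  assumes "\<And>i. b i > 0"
  shows "\<bar>egauss b 1 y - egauss b 1 z\<bar> \<le> sqrt (2 * sum b UNIV) * norm (y - z)"
proof (rule gderiv_lipschitz[OF convex_UNIV gderiv_egauss])
  fix x :: "real^'a"
  have "(egauss b 1 x * norm (diag_mult b x))^2 = (norm (diag_mult b x))^2 * egauss b 2 x"
    by (simp add: power_mult_distrib egauss_power2)
  also have "\<dots> \<le> sum b UNIV * (4 / 2) * egauss b (2 / 2) x"
    by (rule norm_diag_mult_egauss_le) (use assms in auto)
  also have "\<dots> \<le> sum b UNIV * (4 / 2) * 1"
  proof (rule mult_left_mono)
    show "egauss b (2 / 2) x \<le> 1" using egauss_le_1[of 1 b x] assms by simp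
    show "0 \<le> sum b UNIV * (4 / 2)" using assms by (simp add: sum_nonneg less_imp_le)
  qed
  finally have "(egauss b 1 x * norm (diag_mult b x))^2 \<le> 2 * sum b UNIV" by simp
  then have "egauss b 1 x * norm (diag_mult b x) \<le> sqrt (2 * sum b UNIV)"
    by (rule real_le_rsqrt)
  then show "norm ((- 1 * egauss b 1 x) *\<^sub>R diag_mult b x) \<le> sqrt (2 * sum b UNIV)"
    using egauss_pos[of b 1 x] by simp
qed auto

lemma egauss_small_outside:
  fixes b :: "'n::finite \<Rightarrow> real"
  assumes "\<theta> > 0" "c > 0" and c0: "c0 > 0" "\<And>i. c0 \<le> b i"
  obtains R where "R > 0" "\<And>x. norm x \<ge> R \<Longrightarrow> egauss b \<theta> x < c"
proof -
  have "eventually (\<lambda>R. exp (- (\<theta> / 2) * (c0 * R^2)) < c) at_top"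
  proof (rule order_tendstoD(2)[OF _ \<open>c > 0\<close>])
    have eq: "exp (- (\<theta> / 2) * (c0 * R^2)) = exp (- ((\<theta> / 2 * c0) * R^2))" for R by simp
    have lim: "((\<lambda>R. exp (- (k * R^2))) \<longlongrightarrow> 0) at_top" if "k > 0" for k :: real
      using that by real_asymp
    show "((\<lambda>R. exp (- (\<theta> / 2) * (c0 * R^2))) \<longlongrightarrow> 0) at_top"
      unfolding eq by (rule lim) (use assms in simp)
  qed
  then have ev: "eventually (\<lambda>R. exp (- (\<theta> / 2) * (c0 * R^2)) < c \<and> R > 0) at_top"
    using eventually_gt_at_top by (rule eventually_conj)
  obtain R where R: "exp (- (\<theta> / 2) * (c0 * R^2)) < c" "R > 0"
    using eventually_happens[OF ev] by auto
  show ?thesis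
  proof (rule that[OF R(2)])
    fix x :: "real^'n" assume "norm x \<ge> R"
    then have "egauss b \<theta> x \<le> exp (- (\<theta> / 2) * (c0 * R^2))"
      using assms R by (intro egauss_le) auto
    then show "egauss b \<theta> x < c" using R by linarith
  qed
qed

text \<open>All members share the oscillator given by \<open>b\<close>; the domains eventually
  contain every ball and the perturbation of the potential vanishes uniformly in the limit.\<close>

locale well_family =
  fixes D :: "real \<Rightarrow> (real^'n::finite) set" and v :: "real \<Rightarrow> real^'n \<Rightarrow> real"
    and g :: "real \<Rightarrow> real^'n \<Rightarrow> real^'n" and l :: "real \<Rightarrow> 'n \<Rightarrow> real^'n \<Rightarrow> real"
    and b :: "'n \<Rightarrow> real" and q :: "real \<Rightarrow> real^'n \<Rightarrow> real" and \<nu> \<delta> :: "real \<Rightarrow> real"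
  assumes well: "\<And>t. well_eigenfunction (D t) (v t) (g t) (l t) b (q t) (\<nu> t) (\<delta> t)"
    and exhaust: "\<And>R. eventually (\<lambda>t. cball 0 R \<subseteq> D t) at_top"
    and \<delta>_0: "(\<delta> \<longlongrightarrow> 0) at_top"
begin

abbreviation \<beta> :: real where "\<beta> \<equiv> \<Sum>i\<in>UNIV. b i"

definition b\<^sub>0 :: real where "b\<^sub>0 = Min (range b)"

lemmas b_pos = well_eigenfunction.b_pos[OF well]
lemmas beta_pos = well_eigenfunction.beta_pos[OF well]
lemmas v_nonneg = well_eigenfunction.v_nonneg[OF well]
lemmas nu_ge = well_eigenfunction.nu_ge[OF well]
lemmas v_measurable [measurable] = well_eigenfunction.v_measurable[OF well]

lemma b0: "b\<^sub>0 > 0" "b\<^sub>0 \<le> b i"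
  unfolding b\<^sub>0_def using b_pos by (auto simp: Min_gr_iff)

lemma nu_tendsto: "(\<nu> \<longlongrightarrow> \<beta>) at_top"
proof (rule order_tendstoI)
  fix a assume "a < \<beta>"
  then show "eventually (\<lambda>t. a < \<nu> t) at_top" using nu_ge by (intro always_eventually) (meson less_le_trans)
next
  fix a assume a: "\<beta> < a"
  define \<tau> where "\<tau> = (a - \<beta>) / 2"
  have \<tau>: "\<tau> > 0" using a by (simp add: \<tau>_def)
  define c where "c = \<tau> / (\<beta> + \<tau>) * exp (- (\<beta> + \<tau>) / (2 * b\<^sub>0))"
  have c: "c > 0" using \<tau> beta_pos by (simp add: c_def)
  obtain R where R: "R > 0" "\<And>x. norm x \<ge> R \<Longrightarrow> egauss b 1 x < c"
    using egauss_small_outside[of 1 c b\<^sub>0 b, OF zero_less_one c b0] by blast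
  have "eventually (\<lambda>t. \<delta> t < \<tau>) at_top"
    using order_tendstoD(2)[OF \<delta>_0 \<tau>] .
  with exhaust[of R] show "eventually (\<lambda>t. \<nu> t < a) at_top"
  proof eventually_elim
    case (elim t)
    have "{x. c \<le> egauss b 1 x} \<subseteq> D t"
    proof
      fix x assume "x \<in> {x. c \<le> egauss b 1 x}"
      then have "norm x < R" using R(2)[of x] by force
      then show "x \<in> D t" using elim by auto
    qed
    then have "\<nu> t \<le> \<beta> + \<tau> + \<delta> t"
      by (intro well_eigenfunction.nu_le[OF well \<tau> b0 c]) (simp_all add: c_def)
    then show ?case using elim by (simp add: \<tau>_def field_simps)
  qed
qed

lemma nu_le_eventually: "eventually (\<lambda>t. \<nu> t \<le> \<beta> + 1) at_top"
  using order_tendstoD(2)[OF nu_tendsto, of "\<beta> + 1"] by (auto elim: eventually_mono)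

lemma delta_le_eventually: "eventually (\<lambda>t. \<delta> t \<le> 1) at_top"
  using order_tendstoD(2)[OF \<delta>_0, of 1] by (auto elim: eventually_mono)

text \<open>The bound of \<open>v_le\<close> with \<nu> replaced by \<beta> + 1, hence independent
  of \<open>t\<close>. It is a bound for v, not the potential of the theorem.\<close>

definition V :: real where
  "V = exp ((\<beta> + 1) / 12) * ((1 + (LINT y|lborel. bump 4 (y::real^'n))) / 2) / (LINT y|lborel. bump 2 (y::real^'n))"

lemma I2_pos: "0 < (LINT y|lborel. bump 2 (y::real^'n))"
  by (rule integral_bump_pos) simp

lemma V_pos: "V > 0"
proof -
  have "0 < (LINT y|lborel. bump 4 (y::real^'n))" by (rule integral_bump_pos) simp
  then show ?thesis using I2_pos by (simp add: V_def)
qed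

lemma v_le_V: "eventually (\<lambda>t. \<forall>y. norm y \<le> R \<longrightarrow> v t y \<le> V) at_top"
  using exhaust[of "R + real CARD('n)"] nu_le_eventually
proof eventually_elim
  case (elim t)
  show ?case
  proof (intro allI impI)
    fix y :: "real^'n" assume y: "norm y \<le> R"
    have "cball y (real CARD('n)) \<subseteq> D t"
      using cball_subset_cball_0[OF y] elim(1) by blast
    then have "v t y \<le> exp (\<nu> t / 12) * ((1 + (LINT y|lborel. bump 4 (y::real^'n))) / 2) / (LINT y|lborel. bump 2 (y::real^'n))"
      by (rule well_eigenfunction.v_le[OF well])
    also have "\<dots> \<le> V"
    proof -
      have "0 < (LINT y|lborel. bump 4 (y::real^'n))" by (rule integral_bump_pos) simp
      then show ?thesis unfolding V_def using I2_pos elim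
        by (intro divide_right_mono mult_right_mono) auto
    qed
    finally show "v t y \<le> V" .
  qed
qed

lemma decay_eventually:
  obtains K where "K > 0" "eventually (\<lambda>t. \<forall>y. v t y \<le> K * egauss b (1/2) y) at_top"
proof -
  define R where "R = sqrt ((\<beta> + 2) * 4 / 3) / b\<^sub>0"
  have R: "R \<ge> 0" "b\<^sub>0^2 * R^2 = (\<beta> + 2) * 4 / 3"
    using b0(1) beta_pos by (simp_all add: R_def power_divide)
  show ?thesis
  proof (rule that)
    show "V * exp (\<beta> * R^2 / 4) > 0" using V_pos by simp
    show "eventually (\<lambda>t. \<forall>y. v t y \<le> V * exp (\<beta> * R^2 / 4) * egauss b (1/2) y) at_top"
      using v_le_V[of R] nu_le_eventually
    proof eventually_elim
      case (elim t)
      show ?case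
        by (intro allI well_eigenfunction.decay[OF well V_pos _ R(1) _ b0(2)]) (use elim R b0(1) in auto)
    qed
  qed
qed

definition f :: "real \<Rightarrow> real^'n \<Rightarrow> real" where "f t x = v t x * egauss b (- 1) x"

lemma f_eq: "f t = well_eigenfunction.h (v t) b"
  by (rule ext) (simp add: f_def well_eigenfunction.h_def[OF well])

lemma lap_bound_eventually:
  obtains L where "L \<ge> 0" "eventually (\<lambda>t. \<forall>y. norm y \<le> R \<longrightarrow> \<bar>well_eigenfunction.lap (l t) y\<bar> \<le> L) at_top"
proof -
  define L where "L = (\<beta> * (\<beta> * R^2) + 1 + (\<beta> + 1)) * V"
  have W: "(norm (diag_mult b y))^2 \<le> \<beta> * (\<beta> * R^2)" if "norm y \<le> R" for y
  proof -
    have "(\<Sum>i\<in>UNIV. b i * (y $ i)^2) \<le> (\<Sum>i\<in>UNIV. b i * R^2)"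
      using order_trans[OF component_power2_le power_mono[OF that]] b_pos
      by (intro sum_mono mult_left_mono) (auto simp: less_imp_le)
    then have "\<beta> * (\<Sum>i\<in>UNIV. b i * (y $ i)^2) \<le> \<beta> * (\<beta> * R^2)"
      using beta_pos by (intro mult_left_mono) (auto simp: sum_distrib_right)
    then show ?thesis using norm_diag_mult_le[of b y, OF b_pos] by linarith
  qed
  show ?thesis
  proof (rule that)
    show "L \<ge> 0" using beta_pos V_pos by (simp add: L_def)
    show "eventually (\<lambda>t. \<forall>y. norm y \<le> R \<longrightarrow> \<bar>well_eigenfunction.lap (l t) y\<bar> \<le> L) at_top"
      using exhaust[of R] v_le_V[of R] nu_le_eventually delta_le_eventually
    proof eventually_elim
      case (elim t)
      show ?case
      proof (intro allI impI)
        fix y :: "real^'n" assume y: "norm y \<le> R"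
        then have yD: "y \<in> D t" and vy: "v t y \<le> V" using elim by auto
        have "\<bar>(norm (diag_mult b y))^2 + q t y - \<nu> t\<bar> \<le> \<beta> * (\<beta> * R^2) + 1 + (\<beta> + 1)"
          using W[OF y] well_eigenfunction.q_nonneg[OF well yD] well_eigenfunction.q_le[OF well yD]
            elim nu_ge[of t] beta_pos zero_le_power2[of "norm (diag_mult b y)"] by linarith
        then have "\<bar>(norm (diag_mult b y))^2 + q t y - \<nu> t\<bar> * v t y \<le> L"
          unfolding L_def by (intro mult_mono vy v_nonneg) auto
        then show "\<bar>well_eigenfunction.lap (l t) y\<bar> \<le> L"
          by (simp add: well_eigenfunction.lap_eq[OF well yD] abs_mult v_nonneg)
      qed
    qed
  qed
qed

text \<open>On a fixed ball, \<open>f\<close> differs by \<open>O(r)\<close> from its averages over balls of radius \<open>r\<close>,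
  and for fixed \<open>r\<close> those averages become constant because \<open>\<integral>|\<rho>|^2 \<le> \<nu> - \<beta> \<rightarrow> 0\<close>.\<close>

lemma f_locally_constant:
  assumes \<eta>: "\<eta> > 0"
  shows "eventually (\<lambda>t. \<forall>x. norm x \<le> R \<longrightarrow> \<bar>f t x - f t 0\<bar> \<le> \<eta>) at_top"
proof (cases "R \<ge> 0")
  case False
  then show ?thesis by (intro always_eventually) (metis norm_ge_zero order_trans)
next
  case R: True
  let ?I = "LINT y|lborel. bump 2 (y::real^'n)"
  have "compact (egauss b (- 1) ` cball 0 (R + 1))"
    by (intro compact_continuous_image continuous_on_egauss compact_cball)
  then obtain H where H: "\<And>y. norm y \<le> R + 1 \<Longrightarrow> egauss b (- 1) y \<le> H"
    using compact_imp_bounded bounded_iff by (metis abs_le_D1 image_eqI mem_cball_0 real_norm_def)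
  have H0: "H > 0" using H[of 0] R by simp
  obtain K where K: "\<And>y z. norm y \<le> R + 1 \<Longrightarrow> norm z \<le> R + 1 \<Longrightarrow>
      \<bar>egauss b (- 1) y - egauss b (- 1) z\<bar> \<le> K * norm (y - z)"
    using egauss_locally_lipschitz by blast
  obtain L where L0: "L \<ge> 0" and L: "eventually (\<lambda>t. \<forall>y. norm y \<le> R + 1 \<longrightarrow> \<bar>well_eigenfunction.lap (l t) y\<bar> \<le> L) at_top"
    using lap_bound_eventually by blast
  define C where "C = (H * L + V * \<bar>K\<bar>) * ?I"
  have C: "C \<ge> 0" using H0 L0 V_pos I2_pos by (simp add: C_def)
  \<comment> \<open>The budget \<open>\<eta> * ?I\<close> is spent in quarters: two approximation
    errors \<open>C * r\<close>, the Young term fixed by \<open>s\<close>, and the energy term with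
    \<nu> - \<beta>. As \<open>r\<close> and \<open>s\<close> do not depend on \<open>t\<close>, the
    last one tends to 0. The added 1 in each denominator keeps it positive.\<close>
  define r where "r = min 1 (\<eta> * ?I / (4 * (C + 1)))"
  have pos: "\<eta> * ?I / (4 * (C + 1)) > 0" using \<eta> C I2_pos by simp
  then have r: "0 < r" "r \<le> 1" by (auto simp: r_def)
  have "C * r \<le> C * (\<eta> * ?I / (4 * (C + 1)))"
    using C by (intro mult_left_mono) (auto simp: r_def)
  also have "\<dots> = \<eta> * ?I / 4 * (C / (C + 1))" by simp
  also have "\<dots> \<le> \<eta> * ?I / 4 * 1"
    using C \<eta> I2_pos by (intro mult_left_mono) auto
  finally have Cr: "C * r \<le> \<eta> * ?I / 4" by simp
  define s where "s = \<eta> / (2 * (R * H + 1))"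
  have RH: "R * H \<ge> 0" using R H0 by simp
  then have s: "s > 0" using \<eta> by (simp add: s_def)
  have "R * H * (s / 2 * ?I) = \<eta> * ?I / 4 * (R * H / (R * H + 1))"
    using RH by (simp add: s_def field_simps)
  also have "\<dots> \<le> \<eta> * ?I / 4 * 1"
    using RH \<eta> I2_pos by (intro mult_left_mono) auto
  finally have sI: "R * H * (s / 2 * ?I) \<le> \<eta> * ?I / 4" by simp
  have "((\<lambda>t. R * H * ((\<nu> t - \<beta>) / (r ^ CARD('n) * (2 * s)))) \<longlongrightarrow> R * H * ((\<beta> - \<beta>) / (r ^ CARD('n) * (2 * s)))) at_top"
    by (intro tendsto_intros nu_tendsto) (use r s in simp)
  then have "((\<lambda>t. R * H * ((\<nu> t - \<beta>) / (r ^ CARD('n) * (2 * s)))) \<longlongrightarrow> 0) at_top"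
    by simp
  then have nu: "eventually (\<lambda>t. R * H * ((\<nu> t - \<beta>) / (r ^ CARD('n) * (2 * s))) < \<eta> * ?I / 4) at_top"
    by (rule order_tendstoD(2)) (use \<eta> I2_pos in simp)
  show ?thesis
    using exhaust[of "R + real CARD('n)"] v_le_V[of "R + 1"] L nu
  proof eventually_elim
    case (elim t)
    show ?case
    proof (intro allI impI)
      fix x :: "real^'n" assume x: "norm x \<le> R"
      let ?A = "well_eigenfunction.h_avg (v t) b"
      have 1: "\<bar>?A y r - f t y * ?I\<bar> \<le> C * r" if "norm y \<le> R" for y
        unfolding C_def f_eq
        by (rule well_eigenfunction.h_avg_approx[OF well _ that]) (use elim H K r in auto)
      have 2: "\<bar>?A x r - ?A 0 r\<bar> \<le> R * H * ((\<nu> t - \<beta>) / (r ^ CARD('n) * (2 * s)) + s / 2 * ?I)"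
        by (rule well_eigenfunction.h_avg_diff[OF well _ x H r s]) (use elim in auto)
      have "\<bar>?A x r - ?A 0 r\<bar> \<le> \<eta> * ?I / 4 + \<eta> * ?I / 4"
        using 2 elim(4) sI unfolding distrib_left by linarith
      moreover have "\<bar>?A 0 r - f t 0 * ?I\<bar> \<le> C * r" using 1[of 0] R by simp
      ultimately have "\<bar>f t x * ?I - f t 0 * ?I\<bar> \<le> \<eta> * ?I"
        using 1[OF x] Cr by linarith
      then have "\<bar>f t x - f t 0\<bar> * ?I \<le> \<eta> * ?I"
        using I2_pos by (simp add: abs_mult left_diff_distrib[symmetric])
      then show "\<bar>f t x - f t 0\<bar> \<le> \<eta>" using I2_pos by simp
    qed
  qed
qed

lemma v_minus_gauss:
  assumes \<eta>: "\<eta> > 0"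
  shows "eventually (\<lambda>t. \<forall>x. norm x \<le> R \<longrightarrow> \<bar>v t x - v t 0 * egauss b 1 x\<bar> \<le> \<eta>) at_top"
  using f_locally_constant[OF \<eta>, of R]
proof eventually_elim
  case (elim t)
  show ?case
  proof (intro allI impI)
    fix x :: "real^'n" assume x: "norm x \<le> R"
    have "v t x - v t 0 * egauss b 1 x = (f t x - f t 0) * egauss b 1 x"
      using egauss_inverse[of b 1 x]
      by (simp add: f_def left_diff_distrib mult.assoc mult.commute[of "egauss b (- 1) x"])
    also have "\<bar>\<dots>\<bar> \<le> \<bar>f t x - f t 0\<bar> * 1"
      unfolding abs_mult using egauss_pos[of b 1 x] egauss_le_1[of 1 b x] b_pos
      by (intro mult_left_mono) auto
    finally show "\<bar>v t x - v t 0 * egauss b 1 x\<bar> \<le> \<eta>" using elim x by fastforce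
  qed
qed

end

lemma egauss_antimono:
  assumes "\<theta> \<le> \<theta>'" "\<And>i. b i > 0"
  shows "egauss b \<theta>' x \<le> egauss b \<theta> x"
proof -
  have "0 \<le> (\<Sum>i\<in>UNIV. b i * (x $ i)^2)"
    by (intro sum_nonneg mult_nonneg_nonneg) (simp_all add: assms less_imp_le)
  then have "\<theta> / 2 * (\<Sum>i\<in>UNIV. b i * (x $ i)^2) \<le> \<theta>' / 2 * (\<Sum>i\<in>UNIV. b i * (x $ i)^2)"
    using assms by (intro mult_right_mono) auto
  then show ?thesis by (simp add: egauss_def)
qed

lemma is_weak_grad_egauss:
  assumes b: "\<And>i. b i > 0"
  shows "is_weak_grad (\<lambda>x. c * egauss b 1 x) (\<lambda>x. - (c * egauss b 1 x) *\<^sub>R diag_mult b x)"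
  unfolding is_weak_grad_def
proof (intro conjI allI impI)
  show m: "(\<lambda>x. c * egauss b 1 x) \<in> borel_measurable borel" by measurable
  show "integrable lborel (\<lambda>x. (c * egauss b 1 x)^2)"
    using integrable_egauss[of 2 b] b by (simp add: power_mult_distrib egauss_power2)
  show mi: "(\<lambda>x. (- (c * egauss b 1 x) *\<^sub>R diag_mult b x) $ i) \<in> borel_measurable borel" for i
    by (intro borel_measurable_continuous_onI continuous_intros continuous_on_egauss continuous_on_diag_mult)
  show "integrable lborel (\<lambda>x. ((- (c * egauss b 1 x) *\<^sub>R diag_mult b x) $ i)^2)" for i
  proof (rule integrable_dominated)
    show "integrable lborel (\<lambda>x. c^2 * (sum b UNIV * 2 * egauss b 1 x))"
      using integrable_egauss[of 1 b] b by simp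
    fix x
    have "((- (c * egauss b 1 x) *\<^sub>R diag_mult b x) $ i)^2 = c^2 * ((diag_mult b x $ i)^2 * egauss b 2 x)"
      unfolding vector_scaleR_component real_scaleR_def power_mult_distrib power2_minus egauss_power2
      by simp
    also have "\<dots> \<le> c^2 * ((norm (diag_mult b x))^2 * egauss b 2 x)"
      by (intro mult_left_mono mult_right_mono component_power2_le) (auto simp: egauss_pos less_imp_le)
    also have "\<dots> \<le> c^2 * (sum b UNIV * (4 / 2) * egauss b (2 / 2) x)"
      by (intro mult_left_mono norm_diag_mult_egauss_le b) auto
    finally show "\<bar>((- (c * egauss b 1 x) *\<^sub>R diag_mult b x) $ i)^2\<bar> \<le> c^2 * (sum b UNIV * 2 * egauss b 1 x)"
      unfolding abs_power2 by simp
  qed (use mi in measurable)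
  fix \<psi> \<psi>' i K
  assume t: "test_pair (K :: (real^'a) set) i \<psi> \<psi>'"
  note K = test_pairD(1)[OF t]
  let ?E = "\<lambda>x. c * egauss b 1 x"
  let ?E' = "\<lambda>x. (- ?E x *\<^sub>R diag_mult b x) $ i"
  have c: "continuous_on S ?E" "continuous_on S ?E'" "continuous_on S \<psi>" "continuous_on S \<psi>'" for S
    by (rule test_pairD(2,3)[OF t] |
        intro continuous_intros continuous_on_egauss continuous_on_diag_mult)+
  have i: "integrable lborel (\<lambda>x. ?E x * \<psi>' x)" "integrable lborel (\<lambda>x. ?E' x * \<psi> x)"
    by (rule integrable_compact_support[OF K continuous_on_mult[OF c(1,4)]]
        integrable_compact_support[OF K continuous_on_mult[OF c(2,3)]]; simp add: test_pairD(4,5)[OF t])+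
  have "(LINT x|lborel. ?E' x * \<psi> x + ?E x * \<psi>' x) = 0"
  proof (rule integral_directional_derivative_eq_0[OF K open_UNIV subset_UNIV, where f="\<lambda>x. ?E x * \<psi> x"])
    fix x :: "real^'a"
    show "has_partial (\<lambda>x. ?E x * \<psi> x) i (?E' x * \<psi> x + ?E x * \<psi>' x) x"
      using has_partial_mult[OF DERIV_cmult[OF gderiv_partial[OF gderiv_egauss[of b 1]], of c] test_pairD(6)[OF t]]
      by (simp add: algebra_simps)
    show "continuous_on UNIV (\<lambda>x. ?E x * \<psi> x)" by (rule continuous_on_mult[OF c(1,3)])
    show "continuous_on UNIV (\<lambda>x. ?E' x * \<psi> x + ?E x * \<psi>' x)"
      by (intro continuous_on_add continuous_on_mult c)
  qed (simp_all add: test_pairD(4,5)[OF t])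
  then show "(LINT x|lborel. ?E x * \<psi>' x) = - (LINT x|lborel. ?E' x * \<psi> x)"
    using i by simp
qed

context well_eigenfunction begin

lemma v_bounded: obtains C where "\<And>x. \<bar>v x\<bar> \<le> C"
proof -
  have "compact (v ` closure D)"
    by (intro compact_continuous_image v_cont compact_closure_D)
  then have "bounded (v ` closure D)" by (rule compact_imp_bounded)
  then obtain C where "\<forall>z\<in>v ` closure D. norm z \<le> C" unfolding bounded_iff by blast
  then have C: "\<bar>v x\<bar> \<le> C" if "x \<in> D" for x using that closure_subset[of D] by auto
  have "\<bar>v x\<bar> \<le> \<bar>C\<bar>" for x
    by (cases "x \<in> D") (use C[of x] v_outside in auto)
  then show ?thesis by (rule that)
qed

lemma translated_in_spaces: "(\<lambda>x. v (x + z)) \<in> H1 \<inter> Linf"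
proof -
  obtain C where "\<And>x. \<bar>v x\<bar> \<le> C" using v_bounded by blast
  then have "(\<lambda>x. v (x + z)) \<in> Linf" by (intro Linf_bound(1)[of _ C]) auto
  then show ?thesis using is_weak_grad_imp(2)[OF is_weak_grad_translate[OF weak_grad]] by blast
qed

end

section \<open>Identification of the limit and convergence in all norms\<close>

context well_family begin

text \<open>The constant that gives \<open>Q\<close> unit L2 norm; \<open>c1_eq\<close> evaluates
  it.\<close>

definition c1 :: real where "c1 = 1 / sqrt (LINT x|lborel. egauss b 2 x)"

definition Q :: "real^'n \<Rightarrow> real" where "Q x = c1 * egauss b 1 x"

lemma integral_egauss_pos: "(LINT x|lborel. egauss b 2 x) > 0"
  using integral_egauss[of 2 b] b_pos by (simp add: prod_pos)

lemma c1_pos: "c1 > 0"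
  using integral_egauss_pos by (simp add: c1_def)

lemma v_minus_gauss_tendsto: "((\<lambda>t. v t x - v t 0 * egauss b 1 x) \<longlongrightarrow> 0) at_top"
proof (rule tendstoI)
  fix e :: real assume "e > 0"
  then have "eventually (\<lambda>t. \<forall>z. norm z \<le> norm x \<longrightarrow> \<bar>v t z - v t 0 * egauss b 1 z\<bar> \<le> e / 2) at_top"
    by (intro v_minus_gauss) simp
  then show "eventually (\<lambda>t. dist (v t x - v t 0 * egauss b 1 x) 0 < e) at_top"
    by eventually_elim (use \<open>e > 0\<close> in fastforce)
qed

lemma gauss_le_1: "egauss b 1 x \<le> 1"
  by (rule egauss_le_1) (simp_all add: b_pos)

text \<open>At this stage v(0) is not known to converge, so dominated convergence is applied to v^2
  - (v(0) G)^2, which tends to 0 pointwise and has integral 1 - v(0)^2 times the integral of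
  G^2.\<close>

lemma v0_tendsto: "((\<lambda>t. v t 0) \<longlongrightarrow> c1) at_top"
proof -
  let ?J = "LINT x|lborel. egauss b 2 x"
  let ?s = "\<lambda>t x. (v t x)^2 - (v t 0 * egauss b 1 x)^2"
  obtain K where K: "K > 0" "eventually (\<lambda>t. \<forall>y. v t y \<le> K * egauss b (1/2) y) at_top"
    using decay_eventually by blast
  have iE: "integrable lborel (egauss b 1)" "integrable lborel (egauss b 2)"
    by (rule integrable_egauss; simp add: b_pos)+
  have "((\<lambda>t. LINT x|lborel. ?s t x) \<longlongrightarrow> 0) at_top"
  proof (rule integral_tendsto_0_dominated)
    show "integrable lborel (\<lambda>x. (K^2 + V^2) * egauss b 1 x)" using iE by simp
    show "((\<lambda>t. ?s t x) \<longlongrightarrow> 0) at_top" for x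
      proof (rule Lim_null_comparison)
        show "((\<lambda>t. \<bar>v t x - v t 0 * egauss b 1 x\<bar> * (2 * V)) \<longlongrightarrow> 0) at_top"
          by (intro tendsto_mult_left_zero tendsto_rabs_zero v_minus_gauss_tendsto)
        show "eventually (\<lambda>t. norm (?s t x) \<le> \<bar>v t x - v t 0 * egauss b 1 x\<bar> * (2 * V)) at_top"
          using v_le_V[of "norm x"]
        proof eventually_elim
          case (elim t)
          have "v t 0 * egauss b 1 x \<le> V * 1"
            using elim gauss_le_1 V_pos by (intro mult_mono) (auto simp: v_nonneg egauss_pos less_imp_le)
          moreover have "0 \<le> v t 0 * egauss b 1 x" by (simp add: v_nonneg egauss_pos less_imp_le)
          ultimately have "\<bar>v t x + v t 0 * egauss b 1 x\<bar> \<le> 2 * V"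
            using elim[rule_format, of x] v_nonneg[of t x] by (simp add: abs_of_nonneg)
          then have "\<bar>v t x - v t 0 * egauss b 1 x\<bar> * \<bar>v t x + v t 0 * egauss b 1 x\<bar>
              \<le> \<bar>v t x - v t 0 * egauss b 1 x\<bar> * (2 * V)"
            by (intro mult_left_mono) auto
          then show ?case by (simp add: power2_eq_square abs_mult[symmetric] algebra_simps)
        qed
      qed
    show "eventually (\<lambda>t. \<forall>x. \<bar>?s t x\<bar> \<le> (K^2 + V^2) * egauss b 1 x) at_top"
      using K(2) v_le_V[of 0]
    proof eventually_elim
      case (elim t)
      show ?case
      proof
        fix x
        have "(v t x)^2 \<le> (K * egauss b (1/2) x)^2"
          using elim v_nonneg by (intro power_mono) auto
        then have 1: "(v t x)^2 \<le> K^2 * egauss b 1 x" by (simp add: power_mult_distrib egauss_power2)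
        have "(v t 0 * egauss b 1 x)^2 \<le> V^2 * egauss b 1 x"
          unfolding power_mult_distrib egauss_power2 using elim v_nonneg
          by (intro mult_mono power_mono egauss_antimono) (auto simp: b_pos egauss_pos less_imp_le)
        with 1 have "(v t x)^2 + (v t 0 * egauss b 1 x)^2 \<le> (K^2 + V^2) * egauss b 1 x"
          by (simp add: distrib_right)
        then show "\<bar>?s t x\<bar> \<le> (K^2 + V^2) * egauss b 1 x"
          using zero_le_power2[of "v t x"] zero_le_power2[of "v t 0 * egauss b 1 x"] by linarith
      qed
    qed
  qed measurable
  moreover have "(LINT x|lborel. ?s t x) = 1 - (v t 0)^2 * ?J" for t
    using well_eigenfunction.integrable_v2[OF well] well_eigenfunction.normalized[OF well] iE
    by (simp add: power_mult_distrib egauss_power2)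
  ultimately have "((\<lambda>t. 1 - (v t 0)^2 * ?J) \<longlongrightarrow> 0) at_top" by simp
  then have "((\<lambda>t. sqrt ((1 - (1 - (v t 0)^2 * ?J)) / ?J)) \<longlongrightarrow> sqrt ((1 - 0) / ?J)) at_top"
    by (intro tendsto_intros) (use integral_egauss_pos in auto)
  then show ?thesis
    using integral_egauss_pos v_nonneg by (simp add: c1_def real_sqrt_divide)
qed

text \<open>On a large ball \<open>v_minus_gauss\<close> and \<open>v0_tendsto\<close> combine.
  Outside it both functions are non-negative and bounded by multiples of
  \<open>egauss b (1/2)\<close>, so even their sum is small.\<close>

lemma v_uniform:
  assumes \<eta>: "\<eta> > 0"
  shows "eventually (\<lambda>t. \<forall>x. \<bar>v t x - Q x\<bar> \<le> \<eta>) at_top"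
proof -
  obtain K where K: "K > 0" "eventually (\<lambda>t. \<forall>y. v t y \<le> K * egauss b (1/2) y) at_top"
    using decay_eventually by blast
  have p: "0 < \<eta> / (K + c1)" using \<eta> K c1_pos by simp
  obtain R where R: "R > 0" "\<And>x. norm x \<ge> R \<Longrightarrow> egauss b (1/2) x < \<eta> / (K + c1)"
    using egauss_small_outside[of "1/2" "\<eta> / (K + c1)" b\<^sub>0 b, OF _ p b0] by auto
  have "eventually (\<lambda>t. dist (v t 0) c1 < \<eta> / 2) at_top"
    using tendstoD[OF v0_tendsto, of "\<eta> / 2"] \<eta> by simp
  with K(2) v_minus_gauss[OF half_gt_zero[OF \<eta>], of R] show ?thesis
  proof eventually_elim
    case (elim t)
    show ?case
    proof
      fix x
      show "\<bar>v t x - Q x\<bar> \<le> \<eta>"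
      proof (cases "norm x \<le> R")
        case True
        have "\<bar>(v t 0 - c1) * egauss b 1 x\<bar> \<le> \<eta> / 2 * 1"
          unfolding abs_mult using elim(3) gauss_le_1[of x] egauss_pos[of b 1 x]
            \<eta> by (intro mult_mono) (auto simp: dist_real_def)
        moreover have "\<bar>v t x - v t 0 * egauss b 1 x\<bar> \<le> \<eta> / 2" using elim(2) True by blast
        ultimately show ?thesis unfolding Q_def left_diff_distrib by linarith
      next
        case False
        have "v t x + Q x \<le> K * egauss b (1/2) x + c1 * egauss b (1/2) x"
          unfolding Q_def using elim(1) c1_pos by (intro add_mono mult_left_mono egauss_antimono) (auto simp: b_pos)
        also have "\<dots> = (K + c1) * egauss b (1/2) x" by (simp add: distrib_right)
        also have "\<dots> \<le> (K + c1) * (\<eta> / (K + c1))"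
          using R(2)[of x] False K c1_pos by (intro mult_left_mono) auto
        also have "\<dots> = \<eta>" using K c1_pos by simp
        finally have "v t x + Q x \<le> \<eta>" .
        moreover have "Q x \<ge> 0" using c1_pos egauss_pos[of b 1 x] by (simp add: Q_def)
        ultimately show ?thesis using v_nonneg[of t x] by linarith
      qed
    qed
  qed
qed

text \<open>At distance at least \<open>e\<close> from 0 the profile is at most c1 \<gamma>, below
  its peak c1 by 4 \<sigma>. A uniform error \<sigma> on both sides cannot close this gap, so a
  point that far away cannot beat 0.\<close>

lemma maximum_point_tendsto:
  assumes max: "\<And>t x. v t x \<le> v t (y t)"
  shows "((\<lambda>t. norm (y t)) \<longlongrightarrow> 0) at_top"
proof (rule tendstoI)
  fix e :: real assume e: "e > 0"
  define \<gamma> where "\<gamma> = exp (- (1 / 2) * (b\<^sub>0 * e^2))"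
  have \<gamma>: "\<gamma> < 1" using b0(1) e by (simp add: \<gamma>_def)
  define \<sigma> where "\<sigma> = c1 * (1 - \<gamma>) / 4"
  have p: "c1 * (1 - \<gamma>) > 0" using \<gamma> c1_pos by simp
  then have "\<sigma> > 0" by (simp add: \<sigma>_def)
  from v_uniform[OF this] show "eventually (\<lambda>t. dist (norm (y t)) 0 < e) at_top"
  proof eventually_elim
    case (elim t)
    show ?case
    proof (rule ccontr)
      assume "\<not> dist (norm (y t)) 0 < e"
      then have "egauss b 1 (y t) \<le> \<gamma>"
        unfolding \<gamma>_def using e b0 by (intro egauss_le) (auto simp: less_imp_le)
      then have "Q (y t) \<le> c1 * \<gamma>" unfolding Q_def using c1_pos by (intro mult_left_mono) auto
      moreover have "Q 0 = c1" by (simp add: Q_def)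
      moreover have "\<bar>v t (y t) - Q (y t)\<bar> \<le> \<sigma>" "\<bar>v t 0 - Q 0\<bar> \<le> \<sigma>" using elim by auto
      moreover have "4 * \<sigma> = c1 - c1 * \<gamma>" by (simp add: \<sigma>_def field_simps)
      ultimately show False using max[of t 0] p \<open>\<sigma> > 0\<close> by linarith
    qed
  qed
qed

lemma Q_lipschitz: "\<bar>Q x - Q z\<bar> \<le> c1 * sqrt (2 * \<beta>) * norm (x - z)"
proof -
  have "\<bar>Q x - Q z\<bar> = c1 * \<bar>egauss b 1 x - egauss b 1 z\<bar>"
    using c1_pos by (simp add: Q_def abs_mult right_diff_distrib[symmetric])
  also have "\<dots> \<le> c1 * (sqrt (2 * \<beta>) * norm (x - z))"
    using c1_pos by (intro mult_left_mono egauss_lipschitz) (auto simp: b_pos)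
  finally show ?thesis by (simp add: mult.assoc)
qed

lemma translated_uniform:
  assumes y: "((\<lambda>t. norm (y t)) \<longlongrightarrow> 0) at_top" and \<eta>: "\<eta> > 0"
  shows "eventually (\<lambda>t. \<forall>x. \<bar>v t (x + y t) - Q x\<bar> \<le> \<eta>) at_top"
proof -
  have "((\<lambda>t. c1 * sqrt (2 * \<beta>) * norm (y t)) \<longlongrightarrow> 0) at_top"
    by (rule tendsto_mult_right_zero[OF y])
  then have "eventually (\<lambda>t. c1 * sqrt (2 * \<beta>) * norm (y t) < \<eta> / 2) at_top"
    by (rule order_tendstoD(2)) (use \<eta> in simp)
  with v_uniform[OF half_gt_zero[OF \<eta>]] show ?thesis
  proof eventually_elim
    case (elim t)
    show ?case
    proof
      fix x
      have "\<bar>v t (x + y t) - Q (x + y t)\<bar> \<le> \<eta> / 2" using elim by blast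
      moreover have "\<bar>Q (x + y t) - Q x\<bar> \<le> \<eta> / 2" using Q_lipschitz[of "x + y t" x] elim by simp
      ultimately show "\<bar>v t (x + y t) - Q x\<bar> \<le> \<eta>" by linarith
    qed
  qed
qed

lemma Q_measurable [measurable]: "Q \<in> borel_measurable borel"
  unfolding Q_def[abs_def] by measurable

lemma weak_grad_Q: "is_weak_grad Q (\<lambda>x. - Q x *\<^sub>R diag_mult b x)"
  unfolding Q_def[abs_def] by (rule is_weak_grad_egauss) (rule b_pos)

lemma Q_bounded: "\<bar>Q x\<bar> \<le> c1"
  using c1_pos gauss_le_1[of x] egauss_pos[of b 1 x] by (simp add: Q_def abs_mult)

lemma weak_grad_translated: "is_weak_grad (\<lambda>x. v t (x + z)) (\<lambda>x. g t (x + z))"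
  by (rule is_weak_grad_translate[OF well_eigenfunction.weak_grad[OF well]])

lemma Q_in_spaces: "Q \<in> H1 \<inter> Linf"
  using is_weak_grad_imp(2)[OF weak_grad_Q] Linf_bound(1)[OF Q_measurable Q_bounded] by blast

lemma Linf_tendsto:
  assumes y: "((\<lambda>t. norm (y t)) \<longlongrightarrow> 0) at_top"
  shows "((\<lambda>t. Linf_norm (\<lambda>x. v t (x + y t) - Q x)) \<longlongrightarrow> 0) at_top"
proof (rule tendstoI)
  fix e :: real assume e: "e > 0"
  from translated_uniform[OF y, of "e / 2"] e
  have "eventually (\<lambda>t. \<forall>x. \<bar>v t (x + y t) - Q x\<bar> \<le> e / 2) at_top" by simp
  then show "eventually (\<lambda>t. dist (Linf_norm (\<lambda>x. v t (x + y t) - Q x)) 0 < e) at_top"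
  proof eventually_elim
    case (elim t)
    then show ?case
      using Linf_bound(2,3)[of "\<lambda>x. v t (x + y t) - Q x" "e / 2"] e by simp
  qed
qed

lemma translated_tendsto:
  assumes y: "((\<lambda>t. norm (y t)) \<longlongrightarrow> 0) at_top"
  shows "((\<lambda>t. v t (x + y t)) \<longlongrightarrow> Q x) at_top"
proof (rule tendstoI)
  fix e :: real assume e: "e > 0"
  from translated_uniform[OF y, of "e / 2"] e
  have "eventually (\<lambda>t. \<forall>x. \<bar>v t (x + y t) - Q x\<bar> \<le> e / 2) at_top" by simp
  then show "eventually (\<lambda>t. dist (v t (x + y t)) (Q x) < e) at_top"
  proof eventually_elim
    case (elim t)
    then have "\<bar>v t (x + y t) - Q x\<bar> \<le> e / 2" by blast
    then show ?case using e by (simp add: dist_real_def)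
  qed
qed

lemma egauss_translate_half:
  assumes "norm z \<le> 1" "\<theta> \<ge> 1/2"
  shows "egauss b \<theta> (x + z) \<le> exp (\<beta> / 4) * egauss b (1/4) x"
proof -
  have "egauss b \<theta> (x + z) \<le> egauss b (1/2) (x + z)" by (rule egauss_antimono) (use assms b_pos in auto)
  also have "\<dots> \<le> exp (1/2 / 2 * \<beta>) * egauss b (1/2 / 2) x"
    by (rule egauss_translate_le) (use assms b_pos in auto)
  finally show ?thesis by simp
qed

lemma power2_diff_le: "(a - c)^2 \<le> 2 * a^2 + 2 * c^2" for a c :: real
  using zero_le_power2[of "a + c"] by (simp add: power2_eq_square algebra_simps)

text \<open>The difference of the gradients is \<rho> at the shifted point minus \<open>T\<close>.
  The first is small in L2 by \<open>integral_rho2\<close> and \<nu> -> \<beta>; the second contains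
  no derivative of v, so dominated convergence handles it.\<close>

lemma H1_tendsto:
  assumes y: "((\<lambda>t. norm (y t)) \<longlongrightarrow> 0) at_top"
  shows "((\<lambda>t. H1_norm (\<lambda>x. v t (x + y t) - Q x)) \<longlongrightarrow> 0) at_top"
proof -
  obtain K where K: "K > 0" "eventually (\<lambda>t. \<forall>y. v t y \<le> K * egauss b (1/2) y) at_top"
    using decay_eventually by blast
  have y1: "eventually (\<lambda>t. norm (y t) \<le> 1) at_top"
    using order_tendstoD(2)[OF y zero_less_one] by (rule eventually_mono) simp
  let ?w = "\<lambda>t x. v t (x + y t)"
  let ?F = "\<lambda>t x. g t (x + y t) - (- Q x *\<^sub>R diag_mult b x)"
  let ?\<rho> = "\<lambda>t. well_eigenfunction.\<rho> (v t) (g t) b"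
  define T where "T i t x = b i * (x + y t) $ i * ?w t x - b i * x $ i * Q x" for i t x
  have wg: "is_weak_grad (\<lambda>x. ?w t x - Q x) (?F t)" for t
    by (rule is_weak_grad_diff[OF weak_grad_translated weak_grad_Q])
  have T_eq: "T i t x = ?\<rho> t (x + y t) $ i - ?F t x $ i" for i t x
    by (simp add: T_def well_eigenfunction.rho_nth[OF well] algebra_simps)
  have [measurable]: "(\<lambda>x. ?\<rho> t x $ i) \<in> borel_measurable borel" "(\<lambda>x. ?F t x $ i) \<in> borel_measurable borel" for t i
    using well_eigenfunction.rho_measurable[OF well] is_weak_gradD(3)[OF wg] by auto
  have T_meas [measurable]: "T i t \<in> borel_measurable borel" for i t
    unfolding T_eq[abs_def] by measurable
  have iF: "integrable lborel (\<lambda>x. (?F t x $ i)^2)" for t i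
    by (rule is_weak_gradD(4)[OF wg])
  have i\<rho>0: "integrable lborel (\<lambda>x. (?\<rho> t x $ i)^2)" for t i
    by (rule integrable_dominated[OF well_eigenfunction.integrable_rho2[OF well, of t]])
       (simp_all add: component_power2_le)
  have i\<rho>: "integrable lborel (\<lambda>x. (?\<rho> t (x + y t) $ i)^2)" for t i
    using lborel_translate_integrable_iff[of "\<lambda>x. (?\<rho> t x $ i)^2" "y t"] i\<rho>0 by simp
  have \<rho>_le: "(LINT x|lborel. (?\<rho> t (x + y t) $ i)^2) \<le> \<nu> t - \<beta>" for t i
  proof -
    have "(LINT x|lborel. (?\<rho> t (x + y t) $ i)^2) = (LINT x|lborel. (?\<rho> t x $ i)^2)"
      by (rule lborel_translate_integral) measurable
    also have "\<dots> \<le> (LINT x|lborel. (norm (?\<rho> t x))^2)"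
      by (intro integral_mono i\<rho>0 well_eigenfunction.integrable_rho2[OF well] component_power2_le)
    finally show ?thesis using well_eigenfunction.integral_rho2[OF well, of t] by linarith
  qed
  have iT: "integrable lborel (\<lambda>x. (T i t x)^2)" for i t
  proof -
    have "(\<lambda>x. ?\<rho> t (x + y t) $ i) \<in> borel_measurable lborel" by measurable
    moreover have "(\<lambda>x. ?F t x $ i) \<in> borel_measurable lborel"
      using is_weak_gradD(3)[OF wg[of t], of i] by simp
    ultimately show ?thesis unfolding T_eq by (rule integrable_power2_diff[OF _ _ i\<rho> iF])
  qed
  have F_le: "(LINT x|lborel. (?F t x $ i)^2) \<le> 2 * (\<nu> t - \<beta>) + 2 * (LINT x|lborel. (T i t x)^2)" for t i
  proof -
    have "(LINT x|lborel. (?F t x $ i)^2) \<le> (LINT x|lborel. 2 * (?\<rho> t (x + y t) $ i)^2 + 2 * (T i t x)^2)"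
    proof (rule integral_mono[OF iF])
      show "integrable lborel (\<lambda>x. 2 * (?\<rho> t (x + y t) $ i)^2 + 2 * (T i t x)^2)"
        using i\<rho>[of t i] iT[of i t] by simp
      fix x
      have "?F t x $ i = ?\<rho> t (x + y t) $ i - T i t x" by (simp add: T_eq)
      then show "(?F t x $ i)^2 \<le> 2 * (?\<rho> t (x + y t) $ i)^2 + 2 * (T i t x)^2"
        by (simp only: power2_diff_le)
    qed
    also have "\<dots> = 2 * (LINT x|lborel. (?\<rho> t (x + y t) $ i)^2) + 2 * (LINT x|lborel. (T i t x)^2)"
      using i\<rho>[of t i] iT[of i t] by simp
    also have "\<dots> \<le> 2 * (\<nu> t - \<beta>) + 2 * (LINT x|lborel. (T i t x)^2)"
      by (intro add_right_mono mult_left_mono \<rho>_le) simp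
    finally show ?thesis .
  qed
  have iE: "integrable lborel (egauss b (1/4))" by (rule integrable_egauss) (simp_all add: b_pos)
  have w2: "(?w t x)^2 \<le> K^2 * egauss b 1 (x + y t)" if "\<forall>y. v t y \<le> K * egauss b (1/2) y" for t x
  proof -
    have "(?w t x)^2 \<le> (K * egauss b (1/2) (x + y t))^2"
      using that v_nonneg by (intro power_mono) auto
    then show ?thesis by (simp add: power_mult_distrib egauss_power2)
  qed
  have Q2: "(Q x)^2 = c1^2 * egauss b 2 x" for x
    by (simp add: Q_def power_mult_distrib egauss_power2)
  have L2: "((\<lambda>t. LINT x|lborel. (?w t x - Q x)^2) \<longlongrightarrow> 0) at_top"
  proof (rule integral_tendsto_0_dominated)
    show "integrable lborel (\<lambda>x. (2 * (K^2 * exp (\<beta> / 4)) + 2 * c1^2) * egauss b (1/4) x)" using iE by simp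
    have "((\<lambda>t. (?w t x - Q x)^2) \<longlongrightarrow> (Q x - Q x)^2) at_top" for x
      by (intro tendsto_intros translated_tendsto y)
    then show "((\<lambda>t. (?w t x - Q x)^2) \<longlongrightarrow> 0) at_top" for x by simp
    show "eventually (\<lambda>t. \<forall>x. \<bar>(?w t x - Q x)^2\<bar>
        \<le> (2 * (K^2 * exp (\<beta> / 4)) + 2 * c1^2) * egauss b (1/4) x) at_top"
      using K(2) y1
    proof eventually_elim
      case (elim t)
      show ?case
      proof
        fix x
        have "(?w t x)^2 \<le> K^2 * (exp (\<beta> / 4) * egauss b (1/4) x)"
          using w2[OF elim(1), of x] egauss_translate_half[OF elim(2), of 1 x]
          by (elim order_trans) (intro mult_left_mono, auto)
        moreover have "(Q x)^2 \<le> c1^2 * egauss b (1/4) x"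
          unfolding Q2 by (intro mult_left_mono egauss_antimono) (auto simp: b_pos)
        ultimately have "(?w t x - Q x)^2 \<le> 2 * (K^2 * (exp (\<beta> / 4) * egauss b (1/4) x)) + 2 * (c1^2 * egauss b (1/4) x)"
          using power2_diff_le[of "?w t x" "Q x"] by linarith
        then show "\<bar>(?w t x - Q x)^2\<bar> \<le> (2 * (K^2 * exp (\<beta> / 4)) + 2 * c1^2) * egauss b (1/4) x"
          by (simp add: algebra_simps)
      qed
    qed
  qed measurable
  have y_nth: "((\<lambda>t. y t $ i) \<longlongrightarrow> 0) at_top" for i
    by (rule Lim_null_comparison[OF _ y]) (simp add: component_le_norm_cart)
  have T0: "((\<lambda>t. LINT x|lborel. (T i t x)^2) \<longlongrightarrow> 0) at_top" for i
  proof (rule integral_tendsto_0_dominated)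
    \<comment> \<open>The outer factors 2 come from (a - c)^2 <= 2 a^2 + 2 c^2. The factors \<beta>
      * 4 and \<beta> * 2 absorb |Bx|^2 at rates 1 and 2, and exp (\<beta>/4) pays for the
      shift.\<close>
    let ?C = "2 * (K^2 * (\<beta> * 4 * exp (\<beta> / 4))) + 2 * (c1^2 * (\<beta> * 2))"
    show "integrable lborel (\<lambda>x. ?C * egauss b (1/4) x)" using iE by simp
    have "((\<lambda>t. (T i t x)^2) \<longlongrightarrow> (b i * (x $ i + 0) * Q x - b i * x $ i * Q x)^2) at_top" for x
      unfolding T_def vector_add_component by (intro tendsto_intros translated_tendsto y y_nth)
    then show "((\<lambda>t. (T i t x)^2) \<longlongrightarrow> 0) at_top" for x by simp
    show "eventually (\<lambda>t. \<forall>x. \<bar>(T i t x)^2\<bar> \<le> ?C * egauss b (1/4) x) at_top"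
      using K(2) y1
    proof eventually_elim
      case (elim t)
      show ?case
      proof
        fix x
        let ?z = "x + y t"
        have sq: "(b i * p $ i)^2 \<le> (norm (diag_mult b p))^2" for p :: "real^'n"
          using component_power2_le[of "diag_mult b p" i] by simp
        have "(b i * ?z $ i)^2 * (?w t x)^2 \<le> (norm (diag_mult b ?z))^2 * (K^2 * egauss b 1 ?z)"
          by (intro mult_mono sq w2[OF elim(1)]) auto
        also have "\<dots> = K^2 * ((norm (diag_mult b ?z))^2 * egauss b 1 ?z)" by simp
        also have "\<dots> \<le> K^2 * (\<beta> * (4 / 1) * egauss b (1 / 2) ?z)"
          by (intro mult_left_mono norm_diag_mult_egauss_le) (auto simp: b_pos)
        also have "\<dots> \<le> K^2 * (\<beta> * (4 / 1) * (exp (\<beta> / 4) * egauss b (1/4) x))"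
          using beta_pos by (intro mult_left_mono egauss_translate_half elim(2)) auto
        finally have 1: "(b i * ?z $ i)^2 * (?w t x)^2 \<le> K^2 * (\<beta> * 4 * exp (\<beta> / 4)) * egauss b (1/4) x"
          by (simp add: mult_ac)
        have "(b i * x $ i)^2 * (Q x)^2 \<le> (norm (diag_mult b x))^2 * (c1^2 * egauss b 2 x)"
          unfolding Q2 by (intro mult_right_mono sq) (simp add: egauss_pos less_imp_le)
        also have "\<dots> = c1^2 * ((norm (diag_mult b x))^2 * egauss b 2 x)" by simp
        also have "\<dots> \<le> c1^2 * (\<beta> * (4 / 2) * egauss b (2 / 2) x)"
          by (intro mult_left_mono norm_diag_mult_egauss_le) (auto simp: b_pos)
        also have "\<dots> \<le> c1^2 * (\<beta> * (4 / 2) * egauss b (1/4) x)"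
          using beta_pos by (intro mult_left_mono egauss_antimono) (auto simp: b_pos)
        finally have 2: "(b i * x $ i)^2 * (Q x)^2 \<le> c1^2 * (\<beta> * 2) * egauss b (1/4) x"
          by (simp add: mult_ac)
        have "(T i t x)^2 \<le> 2 * ((b i * ?z $ i)^2 * (?w t x)^2) + 2 * ((b i * x $ i)^2 * (Q x)^2)"
          unfolding T_def power_mult_distrib[symmetric] by (rule power2_diff_le)
        also have "\<dots> \<le> 2 * (K^2 * (\<beta> * 4 * exp (\<beta> / 4)) * egauss b (1/4) x) + 2 * (c1^2 * (\<beta> * 2) * egauss b (1/4) x)"
          by (intro add_mono mult_left_mono 1 2) auto
        also have "\<dots> = ?C * egauss b (1/4) x" by (simp add: algebra_simps)
        finally show "\<bar>(T i t x)^2\<bar> \<le> ?C * egauss b (1/4) x" by simp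
      qed
    qed
  qed measurable
  let ?A = "\<lambda>t. sqrt ((LINT x|lborel. (?w t x - Q x)^2) + (\<Sum>i\<in>UNIV. 2 * (\<nu> t - \<beta>) + 2 * (LINT x|lborel. (T i t x)^2)))"
  have "(?A \<longlongrightarrow> sqrt (0 + (\<Sum>i\<in>(UNIV :: 'n set). 2 * (\<beta> - \<beta>) + 2 * 0))) at_top"
    using L2 T0 by (intro tendsto_intros nu_tendsto) simp_all
  then have A: "(?A \<longlongrightarrow> 0) at_top" by simp
  show ?thesis
  proof (rule Lim_null_comparison[OF always_eventually A], rule allI)
    fix t
    have "H1_norm (\<lambda>x. ?w t x - Q x) \<le> sqrt ((LINT x|lborel. (?w t x - Q x)^2) + (\<Sum>i\<in>UNIV. LINT x|lborel. (?F t x $ i)^2))"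
      by (rule is_weak_grad_imp(3)[OF wg])
    also have "\<dots> \<le> ?A t"
      by (intro real_sqrt_le_mono add_left_mono sum_mono F_le)
    finally show "norm (H1_norm (\<lambda>x. ?w t x - Q x)) \<le> ?A t"
      using is_weak_grad_imp(4)[OF wg, of t] by simp
  qed
qed

end

section \<open>The rescaled principal eigenpair\<close>

lemma gderiv_scale:
  fixes f :: "'a::real_inner \<Rightarrow> real"
  assumes "GDERIV f (s *\<^sub>R y) :> D"
  shows "GDERIV (\<lambda>y. f (s *\<^sub>R y)) y :> s *\<^sub>R D"
proof -
  have "((\<lambda>y. s *\<^sub>R y) has_derivative (\<lambda>h. s *\<^sub>R h)) (at y)"
    by (auto intro!: derivative_eq_intros)
  from has_derivative_compose[OF this assms[unfolded gderiv_def]] show ?thesis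
    by (simp add: gderiv_def)
qed

lemma partial_quadratic:
  fixes m :: "real^'n::finite \<Rightarrow> real"
  assumes "open S" "x \<in> S" and m: "\<And>y. y \<in> S \<Longrightarrow> m y = a\<^sub>0 + (\<Sum>i\<in>UNIV. a i * (y $ i)^2)"
  shows "partial i m x = 2 * a i * x $ i"
proof -
  have nth: "((\<lambda>x::real^'n. x $ i) has_derivative (\<lambda>h. h $ i)) (at x)" for i
    by (rule bounded_linear_imp_has_derivative[OF bounded_linear_vec_nth])
  have "((\<lambda>y. a\<^sub>0 + (\<Sum>i\<in>UNIV. a i * (y $ i)^2)) has_derivative (\<lambda>h. \<Sum>i\<in>UNIV. 2 * a i * x $ i * h $ i)) (at x)"
    by (auto intro!: derivative_eq_intros nth ext simp: mult_ac)
  then have "(m has_derivative (\<lambda>h. \<Sum>i\<in>UNIV. 2 * a i * x $ i * h $ i)) (at x)"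
    by (rule has_derivative_transform_within_open[OF _ assms(1,2)]) (simp add: m)
  then have "frechet_derivative m (at x) = (\<lambda>h. \<Sum>i\<in>UNIV. 2 * a i * x $ i * h $ i)"
    by (rule frechet_derivative_at[symmetric])
  then show ?thesis
    by (simp add: partial_def axis_def if_distrib[of "\<lambda>t. _ * t"] cong: if_cong)
qed

lemma Ck_on_2D:
  assumes "Ck_on 2 S \<phi>"
  shows "\<And>x. x \<in> S \<Longrightarrow> \<phi> differentiable (at x)"
    and "\<And>x i. x \<in> S \<Longrightarrow> partial i \<phi> differentiable (at x)"
    and "\<And>i. continuous_on S (partial i (partial i \<phi>))"
  using assms by (auto simp: numeral_2_eq_2)

locale eigenpair_rescaling =
  fixes \<Omega> :: "(real^'n::finite) set" and m V :: "real^'n \<Rightarrow> real" and a\<^sub>0 :: real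
    and a :: "'n \<Rightarrow> real" and \<epsilon> \<alpha> lam B :: real and u \<phi> :: "real^'n \<Rightarrow> real" and c :: real
  assumes \<Omega>: "open \<Omega>" "bounded \<Omega>"
    and m: "\<And>x. x \<in> closure \<Omega> \<Longrightarrow> m x = a\<^sub>0 + (\<Sum>i\<in>UNIV. a i * (x $ i)^2)"
    and a: "\<And>i. a i \<noteq> 0" and sum_a: "(\<Sum>i\<in>UNIV. a i) = 0"
    and V: "\<And>x. x \<in> closure \<Omega> \<Longrightarrow> 0 \<le> V x" "\<And>x. x \<in> closure \<Omega> \<Longrightarrow> V x \<le> B"
    and \<epsilon>: "\<epsilon> > 0" and \<alpha>: "\<alpha> > 0"
    and \<phi>: "principal_eigenfunction \<epsilon> \<alpha> m V \<Omega> lam \<phi>" and c: "c > 0"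
    and u: "\<And>x. x \<in> closure \<Omega> \<Longrightarrow> u x = c * (exp (\<alpha> / \<epsilon> * m x) * \<phi> x)"
    and u_norm: "L2_norm (lebesgue_on \<Omega>) u = 1"
begin

definition s :: real where "s = \<alpha> powr (- 1/2)"

definition D :: "(real^'n) set" where "D = {y. s *\<^sub>R y \<in> \<Omega>}"

definition v :: "real^'n \<Rightarrow> real" where
  "v y = \<alpha> powr (- real CARD('n) / 4) * zero_extension \<Omega> u (s *\<^sub>R y)"

text \<open>Signed version of \<open>b\<close>: its entries sum to 0 because those of
  \<open>a\<close> do, and the squares agree, so both give the same quadratic potential.\<close>

definition b' :: "'n \<Rightarrow> real" where "b' i = - 2 * a i / \<epsilon>"

definition b :: "'n \<Rightarrow> real" where "b i = 2 * \<bar>a i\<bar> / \<epsilon>"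

definition C :: real where "C = \<alpha> powr (- real CARD('n) / 4) * (c * exp (\<alpha> / \<epsilon> * a\<^sub>0))"

text \<open>The factor e^(\<alpha> m/\<epsilon>) in the rescaled variable, without its constant. It
  grows in the directions with a_i > 0.\<close>

definition E :: "real^'n \<Rightarrow> real" where "E = egauss b' 1"

definition E' :: "real^'n \<Rightarrow> real^'n" where "E' y = (- 1 * egauss b' 1 y) *\<^sub>R diag_mult b' y"

definition \<psi> :: "real^'n \<Rightarrow> real" where "\<psi> y = \<phi> (s *\<^sub>R y)"

definition \<psi>' :: "real^'n \<Rightarrow> real^'n" where "\<psi>' y = s *\<^sub>R grad \<phi> (s *\<^sub>R y)"

definition g :: "real^'n \<Rightarrow> real^'n" where
  "g y = (if y \<in> D then C *\<^sub>R (E y *\<^sub>R \<psi>' y + \<psi> y *\<^sub>R E' y) else 0)"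

text \<open>The product rule for the second partials of C E \<psi>.\<close>

definition l :: "'n \<Rightarrow> real^'n \<Rightarrow> real" where
  "l i y = (if y \<in> D then C * (E y * (s^2 * partial i (partial i \<phi>) (s *\<^sub>R y)) + 2 * (E' y $ i * \<psi>' y $ i)
      + \<psi> y * (((b' i * y $ i)^2 - b' i) * E y)) else 0)"

lemma s: "s > 0" "s^2 * \<alpha> = 1"
proof -
  show "s > 0" using \<alpha> by (simp add: s_def)
  have "s^2 = \<alpha> powr (- 1)" using \<alpha> by (simp add: s_def power2_eq_square powr_add[symmetric])
  then show "s^2 * \<alpha> = 1" using \<alpha> by (simp add: powr_minus)
qed

lemma C2: "Ck_on 2 \<Omega> \<phi>" and cont_\<phi>: "continuous_on (closure \<Omega>) \<phi>"
  and pde: "x \<in> \<Omega> \<Longrightarrow> - \<epsilon> * laplacian \<phi> x - 2 * \<alpha> * (grad m x \<bullet> grad \<phi> x) + V x * \<phi> x = lam * \<phi> x"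
  and \<phi>_0: "x \<in> frontier \<Omega> \<Longrightarrow> \<phi> x = 0" and \<phi>_pos: "x \<in> \<Omega> \<Longrightarrow> \<phi> x > 0"
  using \<phi> by (auto simp: principal_eigenfunction_def)

lemma in_closure: "x \<in> \<Omega> \<Longrightarrow> x \<in> closure \<Omega>"
  using closure_subset by blast

lemma open_D: "open D"
proof -
  have "open ((\<lambda>y. s *\<^sub>R y) -` \<Omega>)" by (intro open_vimage \<Omega> continuous_intros)
  then show ?thesis by (simp add: D_def vimage_def)
qed

lemma bounded_D: "bounded D"
proof -
  obtain r where r: "\<And>x. x \<in> \<Omega> \<Longrightarrow> norm x \<le> r" using \<Omega>(2) by (auto simp: bounded_iff)
  show ?thesis
    unfolding bounded_iff
  proof (intro exI[of _ "r / s"] ballI)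
    fix y assume "y \<in> D"
    then have "norm (s *\<^sub>R y) \<le> r" by (intro r) (simp add: D_def)
    then show "norm y \<le> r / s" using s by (simp add: le_divide_eq mult.commute)
  qed
qed

lemma exp_eq: "c * exp (\<alpha> / \<epsilon> * m x) = c * exp (\<alpha> / \<epsilon> * a\<^sub>0) * egauss (\<lambda>i. \<alpha> * b' i) 1 x" if "x \<in> closure \<Omega>"
proof -
  have "\<alpha> / \<epsilon> * m x = \<alpha> / \<epsilon> * a\<^sub>0 + - (1 / 2) * (\<Sum>i\<in>UNIV. \<alpha> * b' i * (x $ i)^2)"
    unfolding m[OF that] distrib_left
    by (simp add: sum_distrib_left sum_negf[symmetric] b'_def sum_divide_distrib mult_ac)
  then show ?thesis by (simp only: egauss_def exp_add mult.assoc)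
qed

lemma zero_extension_eq: "zero_extension \<Omega> u x = c * exp (\<alpha> / \<epsilon> * a\<^sub>0) * egauss (\<lambda>i. \<alpha> * b' i) 1 x * \<phi> x"
  if "x \<in> closure \<Omega>"
proof (cases "x \<in> \<Omega>")
  case True
  then have "zero_extension \<Omega> u x = c * exp (\<alpha> / \<epsilon> * m x) * \<phi> x"
    using u[OF that] by (simp add: zero_extension_def)
  then show ?thesis by (simp only: exp_eq[OF that])
next
  case False
  then have "x \<in> frontier \<Omega>" using that \<Omega>(1) by (simp add: frontier_def interior_open)
  then show ?thesis using False by (simp add: zero_extension_def \<phi>_0)
qed

text \<open>The closed sets \<open>closure \<Omega>\<close> and \<open>- \<Omega>\<close> meet in
  the frontier, where the Dirichlet condition makes the two formulas agree.\<close>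

lemma cont_zero_extension: "continuous_on UNIV (zero_extension \<Omega> u)"
proof -
  have "continuous_on (closure \<Omega> \<union> - \<Omega>) (zero_extension \<Omega> u)"
  proof (rule continuous_on_closed_Un)
    have "continuous_on (closure \<Omega>) (\<lambda>x. c * exp (\<alpha> / \<epsilon> * a\<^sub>0) * egauss (\<lambda>i. \<alpha> * b' i) 1 x * \<phi> x)"
      by (intro continuous_intros continuous_on_egauss cont_\<phi>)
    then show "continuous_on (closure \<Omega>) (zero_extension \<Omega> u)"
      by (rule continuous_on_cong[THEN iffD1, OF refl, rotated]) (simp add: zero_extension_eq)
    show "continuous_on (- \<Omega>) (zero_extension \<Omega> u)"
      by (rule continuous_on_cong[THEN iffD1, OF refl _ continuous_on_const[of _ 0]]) (simp add: zero_extension_def)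
  qed (use \<Omega>(1) in auto)
  moreover have "closure \<Omega> \<union> - \<Omega> = UNIV" using closure_subset by blast
  ultimately show ?thesis by simp
qed

lemma v_eq: "y \<in> D \<Longrightarrow> v y = C * (E y * \<psi> y)"
proof -
  assume y: "y \<in> D"
  have "(\<Sum>i\<in>UNIV. \<alpha> * b' i * (s * y $ i)^2) = (\<Sum>i\<in>UNIV. b' i * (y $ i)^2 * (s^2 * \<alpha>))"
    by (rule sum.cong) (simp_all add: power_mult_distrib mult_ac)
  then have "egauss (\<lambda>i. \<alpha> * b' i) 1 (s *\<^sub>R y) = E y"
    unfolding s by (simp add: egauss_def E_def)
  then show ?thesis
    using y in_closure by (simp add: v_def zero_extension_eq D_def C_def \<psi>_def)
qed

lemma C_pos: "C > 0"
  using \<alpha> c by (simp add: C_def)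

lemma gderiv_\<psi>: "y \<in> D \<Longrightarrow> GDERIV \<psi> y :> \<psi>' y"
  unfolding \<psi>_def[abs_def] \<psi>'_def
  by (intro gderiv_scale gderiv_grad Ck_on_2D(1)[OF C2]) (simp add: D_def)

lemma gderiv_E: "GDERIV E y :> E' y"
  unfolding E_def E'_def by (rule gderiv_egauss)

lemma gderiv_v: assumes y: "y \<in> D" shows "GDERIV v y :> g y"
proof -
  have "GDERIV (\<lambda>y. C * (E y * \<psi> y)) y :> C *\<^sub>R (E y *\<^sub>R \<psi>' y + \<psi> y *\<^sub>R E' y) + (E y * \<psi> y) *\<^sub>R 0"
    by (intro GDERIV_mult GDERIV_const gderiv_\<psi>[OF y] gderiv_E)
  then have "((\<lambda>y. C * (E y * \<psi> y)) has_derivative (\<lambda>h. h \<bullet> g y)) (at y)"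
    using y by (simp add: gderiv_def g_def)
  then have "(v has_derivative (\<lambda>h. h \<bullet> g y)) (at y)"
    by (rule has_derivative_transform_within_open[OF _ open_D y]) (simp add: v_eq)
  then show ?thesis by (simp add: gderiv_def)
qed

lemma partial_continuous: "continuous_on \<Omega> (partial i \<phi>)"
  by (intro continuous_at_imp_continuous_on ballI differentiable_imp_continuous_within Ck_on_2D(2)[OF C2])

lemma cont_\<psi>'_nth: "continuous_on D (\<lambda>y. \<psi>' y $ i)"
  unfolding \<psi>'_def grad_def
  by simp (intro continuous_intros continuous_on_compose2[OF partial_continuous], auto simp: D_def)

lemma cont_\<psi>: "continuous_on D \<psi>"
  by (rule gderiv_imp_continuous_on) (rule gderiv_\<psi>)

lemma cont_E: "continuous_on S E" "continuous_on S E'"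
  unfolding E_def E'_def by (intro continuous_intros continuous_on_egauss continuous_on_diag_mult)+

lemma cont_g: "continuous_on D g"
proof -
  have "continuous_on D \<psi>'"
    using cont_\<psi>'_nth continuous_on_vec_lambda[of D "\<lambda>i y. \<psi>' y $ i"] by simp
  then have "continuous_on D (\<lambda>y. C *\<^sub>R (E y *\<^sub>R \<psi>' y + \<psi> y *\<^sub>R E' y))"
    by (intro continuous_intros cont_E cont_\<psi>)
  then show ?thesis
    by (rule continuous_on_cong[THEN iffD1, OF refl, rotated]) (simp add: g_def)
qed

lemma cont_l: "continuous_on D (l i)"
proof -
  have "continuous_on D (\<lambda>y. partial i (partial i \<phi>) (s *\<^sub>R y))"
    by (rule continuous_on_compose2[OF Ck_on_2D(3)[OF C2]]) (auto simp: D_def intro!: continuous_intros)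
  then have "continuous_on D (\<lambda>y. C * (E y * (s^2 * partial i (partial i \<phi>) (s *\<^sub>R y)) + 2 * (E' y $ i * \<psi>' y $ i)
      + \<psi> y * (((b' i * y $ i)^2 - b' i) * E y)))"
    by (intro continuous_intros cont_E cont_\<psi> cont_\<psi>'_nth)
  then show ?thesis
    by (rule continuous_on_cong[THEN iffD1, OF refl, rotated]) (simp add: l_def)
qed

lemma deriv_g:
  assumes y: "y \<in> D"
  shows "has_partial (\<lambda>x. g x $ i) i (l i y) y"
proof -
  have dE': "has_partial (\<lambda>y. E' y $ i) i (((b' i * y $ i)^2 - b' i) * E y) y"
    using egauss_second_derivative[of 1 b' y i] by (simp add: E_def E'_def)
  have "GDERIV (\<lambda>y. partial i \<phi> (s *\<^sub>R y)) y :> s *\<^sub>R grad (partial i \<phi>) (s *\<^sub>R y)"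
    by (intro gderiv_scale gderiv_grad Ck_on_2D(2)[OF C2]) (use y in \<open>simp add: D_def\<close>)
  from DERIV_cmult[OF gderiv_partial[OF this, of i], of s]
  have d\<psi>': "has_partial (\<lambda>y. \<psi>' y $ i) i (s^2 * partial i (partial i \<phi>) (s *\<^sub>R y)) y"
    by (simp add: \<psi>'_def grad_def power2_eq_square mult.assoc)
  have "has_partial (\<lambda>y. C * (E y * \<psi>' y $ i + \<psi> y * E' y $ i)) i (l i y) y"
    using DERIV_cmult[OF DERIV_add[OF has_partial_mult[OF gderiv_partial[OF gderiv_E] d\<psi>']
        has_partial_mult[OF gderiv_partial[OF gderiv_\<psi>[OF y]] dE']], of C] y
    by (simp add: l_def algebra_simps)
  moreover have "open ((\<lambda>t. y + t *\<^sub>R axis i 1) -` D)" by (intro open_vimage open_D continuous_intros)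
  ultimately show ?thesis
    by (rule has_field_derivative_transform_within_open) (use y in \<open>simp_all add: g_def\<close>)
qed

lemma grad_m: "x \<in> \<Omega> \<Longrightarrow> grad m x \<bullet> grad \<phi> x = (\<Sum>i\<in>UNIV. 2 * a i * x $ i * partial i \<phi> x)"
  using partial_quadratic[OF \<Omega>(1) _ m[OF in_closure]] by (simp add: grad_def inner_vec_def)

text \<open>The conjugation by \<open>e\<^bsup>\<alpha>m/\<epsilon>\<^esup>\<close> removes the drift; \<open>\<Delta>m = 0\<close> leaves only the quadratic potential.\<close>

lemma laplacian_eq:
  assumes y: "y \<in> D"
  shows "(\<Sum>i\<in>UNIV. l i y) = ((norm (diag_mult b y))^2 + V (s *\<^sub>R y) / (\<alpha> * \<epsilon>) - lam / (\<alpha> * \<epsilon>)) * v y"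
proof -
  let ?x = "s *\<^sub>R y"
  let ?S = "\<Sum>i\<in>UNIV. a i * y $ i * partial i \<phi> ?x"
  have x: "?x \<in> \<Omega>" using y by (simp add: D_def)
  have b'0: "(\<Sum>i\<in>UNIV. b' i) = 0"
    using sum_a by (simp add: b'_def sum_divide_distrib[symmetric] sum_distrib_left[symmetric] sum_negf)
  have "(\<Sum>i\<in>UNIV. (b' i * y $ i)^2) = (norm (diag_mult b y))^2"
    by (simp add: norm_power2_eq_sum b'_def b_def power_mult_distrib power_divide)
  then have sum_b': "(\<Sum>i\<in>UNIV. ((b' i * y $ i)^2 - b' i) * E y) = (norm (diag_mult b y))^2 * E y"
    by (simp only: sum_distrib_right[symmetric] sum_subtractf b'0 diff_zero)
  have cross: "(\<Sum>i\<in>UNIV. E' y $ i * \<psi>' y $ i) = 2 * s / \<epsilon> * E y * ?S"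
    by (simp add: E'_def \<psi>'_def grad_def b'_def E_def sum_distrib_left mult_ac sum_negf)
  have "grad m ?x \<bullet> grad \<phi> ?x = 2 * s * ?S"
    unfolding grad_m[OF x] by (simp add: sum_distrib_left mult_ac)
  with pde[OF x] have "\<epsilon> * laplacian \<phi> ?x = - 4 * \<alpha> * s * ?S + (V ?x - lam) * \<phi> ?x"
    by (simp add: algebra_simps)
  then have lap_eq: "laplacian \<phi> ?x = (- 4 * \<alpha> * s * ?S + (V ?x - lam) * \<phi> ?x) / \<epsilon>"
    using \<epsilon> by (simp add: field_simps)
  have s2: "s^2 = 1 / \<alpha>" using s \<alpha> by (simp add: field_simps)
  have lap: "s^2 * laplacian \<phi> ?x = - 4 * s / \<epsilon> * ?S + (V ?x - lam) / (\<alpha> * \<epsilon>) * \<psi> y"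
    unfolding lap_eq s2 \<psi>_def using \<alpha> \<epsilon> by (simp add: field_simps)
  have "(\<Sum>i\<in>UNIV. l i y) = C * (E y * (s^2 * laplacian \<phi> ?x) + 2 * (\<Sum>i\<in>UNIV. E' y $ i * \<psi>' y $ i)
      + \<psi> y * (\<Sum>i\<in>UNIV. ((b' i * y $ i)^2 - b' i) * E y))"
    using y by (simp add: l_def laplacian_def sum.distrib sum_distrib_left[symmetric])
  \<comment> \<open>The drift term -4 s/\<epsilon> times \<open>?S\<close> in \<open>lap\<close>
    cancels against twice \<open>cross\<close>.\<close>
  also have "\<dots> = C * (E y * \<psi> y) * ((V ?x - lam) / (\<alpha> * \<epsilon>) + (norm (diag_mult b y))^2)"
    unfolding lap cross sum_b' by (simp add: algebra_simps)
  finally show ?thesis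
    unfolding v_eq[OF y] by (simp add: diff_divide_distrib algebra_simps)
qed

lemma normalized: "(LINT y|lborel. (v y)^2) = 1"
proof -
  let ?u = "zero_extension \<Omega> u"
  have [measurable]: "?u \<in> borel_measurable borel"
    by (rule borel_measurable_continuous_onI[OF cont_zero_extension])
  have "(LINT x|lebesgue_on \<Omega>. (u x)^2) = 1"
    using u_norm by (simp add: L2_norm_def real_sqrt_eq_1_iff)
  moreover have "(LINT x|lebesgue_on \<Omega>. (u x)^2) = (LINT x|lebesgue. indicator \<Omega> x *\<^sub>R (u x)^2)"
    by (rule integral_restrict_space) (use \<Omega>(1) in auto)
  moreover have "(\<lambda>x. indicator \<Omega> x *\<^sub>R (u x)^2) = (\<lambda>x. (?u x)^2)"
    by (auto simp: zero_extension_def indicator_def)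
  ultimately have "(LINT x|lborel. (?u x)^2) = 1"
    by (simp add: lebesgue_integral_eq_lborel)
  moreover have "(LINT x|lborel. (?u x)^2) = s ^ CARD('n) * (LINT y|lborel. (?u (s *\<^sub>R y))^2)"
    using lborel_affine_integral[of "\<lambda>x. (?u x)^2" s 0] s by simp
  \<comment> \<open>The squared amplitude of the rescaling is exactly the Jacobian of the
    dilation.\<close>
  moreover have "(\<alpha> powr (- real CARD('n) / 4))^2 = s ^ CARD('n)"
    using \<alpha> by (simp add: s_def powr_power)
  ultimately show ?thesis by (simp add: v_def power_mult_distrib)
qed

lemma well: "well_eigenfunction D v g l b (\<lambda>y. V (s *\<^sub>R y) / (\<alpha> * \<epsilon>)) (lam / (\<alpha> * \<epsilon>)) (B / (\<alpha> * \<epsilon>))"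
proof
  show "continuous_on UNIV v" unfolding v_def[abs_def]
    by (intro continuous_intros continuous_on_compose2[OF cont_zero_extension]) auto
  show "v y > 0" if "y \<in> D" for y
    using that C_pos \<phi>_pos by (simp add: v_eq E_def egauss_pos \<psi>_def D_def)
  show "v y = 0" if "y \<notin> D" for y using that by (simp add: v_def zero_extension_def D_def)
  show "0 \<le> V (s *\<^sub>R y) / (\<alpha> * \<epsilon>)" "V (s *\<^sub>R y) / (\<alpha> * \<epsilon>) \<le> B / (\<alpha> * \<epsilon>)" if "y \<in> D" for y
    using that V in_closure \<alpha> \<epsilon> by (simp_all add: D_def divide_right_mono)
  show "b i > 0" for i using a \<epsilon> by (simp add: b_def)
  show "g y = 0" "l i y = 0" if "y \<notin> D" for y i using that by (simp_all add: g_def l_def)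
qed (fact open_D bounded_D gderiv_v cont_g cont_l deriv_g laplacian_eq normalized)+

end

text \<open>Supplies the upper bound for the potential that makes V/(\<alpha> \<epsilon>) tend to 0
  uniformly.\<close>

lemma holder_on_bounded:
  assumes "holder_on \<gamma> S f" "\<gamma> \<ge> 0" "bounded S"
  obtains B where "\<And>x. x \<in> S \<Longrightarrow> f x \<le> B"
proof (cases "S = {}")
  case False
  then obtain p where p: "p \<in> S" by auto
  obtain K where K: "\<And>x y. x \<in> S \<Longrightarrow> y \<in> S \<Longrightarrow> \<bar>f x - f y\<bar> \<le> K * dist x y powr \<gamma>"
    using assms(1) by (auto simp: holder_on_def)
  obtain r where r: "\<And>x. x \<in> S \<Longrightarrow> dist x p \<le> r"
    using assms(3) by (metis bounded_any_center dist_commute)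
  show ?thesis
  proof (rule that)
    fix x assume x: "x \<in> S"
    have "K * dist x p powr \<gamma> \<le> \<bar>K\<bar> * r powr \<gamma>"
      by (intro mult_mono powr_mono2 r x assms) auto
    then show "f x \<le> f p + \<bar>K\<bar> * r powr \<gamma>" using K[OF x p] by linarith
  qed
qed (use that in auto)

lemma prod_sqrt: "(\<Prod>i\<in>S. sqrt (f i)) = sqrt (\<Prod>i\<in>S. f i)"
  by (induction S rule: infinite_finite_induct) (simp_all add: real_sqrt_mult)

context well_family begin

text \<open>The integral of G^2 is a product of the square roots of \<pi>/b_i; normalizing takes one
  more square root, whence the power 1/4.\<close>

lemma c1_eq: "c1 = (\<Prod>i\<in>UNIV. b i / pi) powr (1/4)"
proof -
  let ?P = "\<Prod>i\<in>UNIV. b i / pi"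
  have P: "?P > 0" by (rule prod_pos) (simp add: b_pos)
  have "(LINT x|lborel. egauss b 2 x) = (\<Prod>i\<in>UNIV. sqrt (2 * pi / (2 * b i)))"
    by (rule integral_egauss) (simp_all add: b_pos)
  also have "\<dots> = (\<Prod>i\<in>UNIV. 1 / sqrt (b i / pi))"
    by (rule prod.cong) (simp_all add: real_sqrt_divide)
  also have "\<dots> = 1 / (\<Prod>i\<in>UNIV. sqrt (b i / pi))"
    by (simp add: prod_dividef)
  also have "(\<Prod>i\<in>UNIV. sqrt (b i / pi)) = sqrt ?P"
    by (rule prod_sqrt)
  finally have "c1 = sqrt (sqrt ?P)" by (simp add: c1_def real_sqrt_divide)
  also have "\<dots> = ?P powr (1/4)" using P by (simp add: powr_half_sqrt[symmetric] powr_powr)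
  finally show ?thesis .
qed

end

theorem theorem1p1:
  fixes \<Omega> :: "(real^'n::finite) set"
    and m V :: "real^'n \<Rightarrow> real"
    and a\<^sub>0 :: real and a :: "'n \<Rightarrow> real"
    and \<epsilon> \<gamma> :: real
    and lam :: "real \<Rightarrow> real"
    and u :: "real \<Rightarrow> real^'n \<Rightarrow> real"
    and d :: "real \<Rightarrow> real^'n"
  assumes "smooth_bounded_domain \<Omega>" and "0 \<in> \<Omega>"
    and "\<And>x. x \<in> closure \<Omega> \<Longrightarrow> m x = a\<^sub>0 + (\<Sum>i\<in>UNIV. a i * (x $ i)\<^sup>2)"
    and "\<And>i. a i \<noteq> 0" and "(\<Sum>i\<in>UNIV. a i) = 0"
    and "0 < \<gamma>" and "\<gamma> < 1"
    and "holder_on \<gamma> (closure \<Omega>) V" and "\<And>x. x \<in> closure \<Omega> \<Longrightarrow> 0 \<le> V x"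
    and "\<epsilon> > 0"
    and "\<And>\<alpha>. \<alpha> > 0 \<Longrightarrow> principal_eigenpair \<epsilon> \<alpha> m V \<Omega> (lam \<alpha>) (u \<alpha>)"
    and "\<And>\<alpha>. \<alpha> > 0 \<Longrightarrow>
           d \<alpha> \<in> \<Omega> \<and> (\<forall>x. zero_extension \<Omega> (u \<alpha>) x \<le> zero_extension \<Omega> (u \<alpha>) (d \<alpha>))"
  shows "let w = (\<lambda>\<alpha>. rescaled \<alpha> (zero_extension \<Omega> (u \<alpha>)) (d \<alpha>));
             Q = gaussian_profile \<epsilon> a
         in ((\<lambda>\<alpha>. lam \<alpha> / \<alpha>) \<longlongrightarrow> 2 * (\<Sum>j\<in>UNIV. \<bar>a j\<bar>)) at_top \<and>
            2 * (\<Sum>j\<in>UNIV. \<bar>a j\<bar>) > 0 \<and>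
            (\<forall>\<alpha>>0. w \<alpha> \<in> H1 \<inter> Linf) \<and> Q \<in> H1 \<inter> Linf \<and>
            ((\<lambda>\<alpha>. H1_norm (\<lambda>x. w \<alpha> x - Q x)) \<longlongrightarrow> 0) at_top \<and>
            ((\<lambda>\<alpha>. Linf_norm (\<lambda>x. w \<alpha> x - Q x)) \<longlongrightarrow> 0) at_top \<and>
            ((\<lambda>\<alpha>. \<alpha> powr (1/2) * norm (d \<alpha>)) \<longlongrightarrow> 0) at_top"
proof -
  have \<Omega>: "open \<Omega>" "bounded \<Omega>" using assms(1) by (auto simp: smooth_bounded_domain_def)
  obtain B where B: "\<And>x. x \<in> closure \<Omega> \<Longrightarrow> V x \<le> B"
    using holder_on_bounded[OF assms(8)] assms(6) \<Omega>(2) by (metis bounded_closure less_imp_le)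
  define b where "b i = 2 * \<bar>a i\<bar> / \<epsilon>" for i
  define s where "s t = t powr (- 1/2)" for t :: real
  define D where "D t = {y. s t *\<^sub>R y \<in> \<Omega>}" for t
  define v where "v t y = t powr (- real CARD('n) / 4) * zero_extension \<Omega> (u t) (s t *\<^sub>R y)" for t y
  define q where "q t y = V (s t *\<^sub>R y) / (t * \<epsilon>)" for t y
  \<comment> \<open>\<open>g\<close> and \<open>l\<close> are built from the eigenfunction hidden in
    \<open>principal_eigenpair\<close>, so they are only asserted to exist; the other data are
    explicit.\<close>
  have well: "\<exists>g l. well_eigenfunction (D t) (v t) g l b (q t) (lam t / (t * \<epsilon>)) (B / (t * \<epsilon>))"
    if t: "t > 0" for t
  proof -
    obtain \<phi> c where \<phi>: "principal_eigenfunction \<epsilon> t m V \<Omega> (lam t) \<phi>" "c > 0"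
      "\<And>x. x \<in> closure \<Omega> \<Longrightarrow> u t x = c * (exp (t / \<epsilon> * m x) * \<phi> x)"
      and norm: "L2_norm (lebesgue_on \<Omega>) (u t) = 1"
      using assms(11)[OF t] by (auto simp: principal_eigenpair_def)
    interpret R: eigenpair_rescaling \<Omega> m V a\<^sub>0 a \<epsilon> t "lam t" B "u t" \<phi> c
      by unfold_locales (fact \<Omega> assms(3,4,5,9,10) B t \<phi> norm)+
    have "R.s = s t" by (simp add: R.s_def s_def)
    then have "R.D = D t" "R.v = v t" "R.b = b" "(\<lambda>y. V (R.s *\<^sub>R y) / (t * \<epsilon>)) = q t"
      by (auto simp: R.D_def D_def R.v_def v_def R.b_def b_def q_def)
    then show ?thesis using R.well by metis
  qed
  have s_mult: "s t * t powr (1/2) = 1" if "t > 0" for t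
    using that by (simp add: s_def powr_add[symmetric])
  have w_eq: "rescaled t (zero_extension \<Omega> (u t)) (d t) = (\<lambda>x. v t (x + t powr (1/2) *\<^sub>R d t))"
    if "t > 0" for t
    using s_mult[OF that] by (intro ext) (simp add: rescaled_def v_def scaleR_right_distrib s_def)
  have w_spaces: "\<forall>t>0. rescaled t (zero_extension \<Omega> (u t)) (d t) \<in> H1 \<inter> Linf"
    using well well_eigenfunction.translated_in_spaces w_eq by metis
  \<comment> \<open>The family is only defined for \<open>t > 0\<close>; it is reparametrized to be total.\<close>
  define A where "A t = max t 1" for t :: real
  have A: "A t > 0" for t by (simp add: A_def)
  have ev_A: "eventually (\<lambda>t. A t = t) at_top"
    using eventually_ge_at_top[of 1] by eventually_elim (simp add: A_def)
  have transfer: "(f \<longlongrightarrow> z) at_top" if "((\<lambda>t. f (A t)) \<longlongrightarrow> z) at_top" for f :: "real \<Rightarrow> real" and z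
    by (rule Lim_transform_eventually[OF that]) (use ev_A in \<open>auto elim: eventually_mono\<close>)
  have A_lim: "filterlim A at_top at_top"
    unfolding A_def[abs_def] by real_asymp
  have "\<exists>g. \<forall>t. \<exists>l. well_eigenfunction (D (A t)) (v (A t)) (g t) l b (q (A t)) (lam (A t) / (A t * \<epsilon>)) (B / (A t * \<epsilon>))"
    by (rule choice) (use well[OF A] in blast)
  then obtain g where "\<forall>t. \<exists>l. well_eigenfunction (D (A t)) (v (A t)) (g t) l b (q (A t)) (lam (A t) / (A t * \<epsilon>)) (B / (A t * \<epsilon>))"
    by blast
  from choice[OF this] obtain l where
    gl: "\<And>t. well_eigenfunction (D (A t)) (v (A t)) (g t) (l t) b (q (A t)) (lam (A t) / (A t * \<epsilon>)) (B / (A t * \<epsilon>))"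
    by blast
  interpret F: well_family "\<lambda>t. D (A t)" "\<lambda>t. v (A t)" g l b "\<lambda>t. q (A t)"
    "\<lambda>t. lam (A t) / (A t * \<epsilon>)" "\<lambda>t. B / (A t * \<epsilon>)"
  proof (rule well_family.intro[OF gl])
    show "((\<lambda>t. B / (A t * \<epsilon>)) \<longlongrightarrow> 0) at_top"
    proof (rule filterlim_compose[OF _ A_lim])
      show "((\<lambda>t. B / (t * \<epsilon>)) \<longlongrightarrow> 0) at_top" using assms(10) by real_asymp
    qed
    fix R :: real
    \<comment> \<open>As the origin is interior to \<Omega>, the domains blown up by t^(1/2) contain
      any given ball for large t.\<close>
    obtain r where r: "r > 0" "ball 0 r \<subseteq> \<Omega>" using \<Omega>(1) assms(2) by (auto simp: open_contains_ball)
    have "((\<lambda>t. s (A t) * R) \<longlongrightarrow> 0) at_top"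
    proof (rule filterlim_compose[OF _ A_lim])
      show "((\<lambda>t. s t * R) \<longlongrightarrow> 0) at_top" unfolding s_def by real_asymp
    qed
    then have "eventually (\<lambda>t. s (A t) * R < r) at_top" by (rule order_tendstoD(2)[OF _ r(1)])
    then show "eventually (\<lambda>t. cball 0 R \<subseteq> D (A t)) at_top"
    proof eventually_elim
      case (elim t)
      show ?case
      proof
        fix y :: "real^'n" assume "y \<in> cball 0 R"
        then have "s (A t) * norm y \<le> s (A t) * R" using A[of t] by (intro mult_left_mono) (auto simp: s_def)
        then have "norm (s (A t) *\<^sub>R y) < r" using elim by (simp add: s_def)
        then show "y \<in> D (A t)" using r by (auto simp: D_def)
      qed
    qed
  qed
  have Q_eq: "gaussian_profile \<epsilon> a = F.Q"
  proof (rule ext)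
    fix x
    have "(\<Prod>i\<in>UNIV. b i / pi) = (\<Prod>i\<in>UNIV. 2 * \<bar>a i\<bar> / (\<epsilon> * pi))" by (simp add: b_def)
    moreover have "- (1 / 2) * (\<Sum>i\<in>UNIV. b i * (x $ i)^2) = - (1 / \<epsilon>) * (\<Sum>j\<in>UNIV. \<bar>a j\<bar> * (x $ j)^2)"
      by (simp add: b_def sum_distrib_left)
    ultimately show "gaussian_profile \<epsilon> a x = F.Q x"
      by (simp only: gaussian_profile_def F.Q_def F.c1_eq egauss_def)
  qed
  \<comment> \<open>The maximum point in the rescaled variable: its norm is the quantity in the last
    claim, and \<open>w_eq\<close> exhibits the rescaled function as the translate of
    \<open>v\<close> by it.\<close>
  let ?y = "\<lambda>t. A t powr (1/2) *\<^sub>R d (A t)"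
  have "v (A t) x \<le> v (A t) (?y t)" for t x
    using assms(12)[OF A[of t]] s_mult[OF A[of t]] unfolding v_def by (simp add: mult_left_mono)
  then have y0: "((\<lambda>t. norm (?y t)) \<longlongrightarrow> 0) at_top" by (rule F.maximum_point_tendsto)
  have "((\<lambda>t. A t powr (1/2) * norm (d (A t))) \<longlongrightarrow> 0) at_top" using y0 by simp
  from transfer[OF this] have d_lim: "((\<lambda>t. t powr (1/2) * norm (d t)) \<longlongrightarrow> 0) at_top" .
  \<comment> \<open>Multiplication by \<epsilon> turns the scaled eigenvalue back into lam/\<alpha>
    and the trace of B into twice the sum of the |a_j|.\<close>
  have "((\<lambda>t. \<epsilon> * (lam (A t) / (A t * \<epsilon>))) \<longlongrightarrow> \<epsilon> * (\<Sum>i\<in>UNIV. b i)) at_top"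
    by (intro tendsto_mult_left F.nu_tendsto)
  moreover have "\<epsilon> * (\<Sum>i\<in>UNIV. b i) = 2 * (\<Sum>j\<in>UNIV. \<bar>a j\<bar>)"
    using assms(10) by (simp add: b_def sum_distrib_left)
  ultimately have "((\<lambda>t. lam (A t) / A t) \<longlongrightarrow> 2 * (\<Sum>j\<in>UNIV. \<bar>a j\<bar>)) at_top"
    using assms(10) by simp
  from transfer[OF this] have lam_lim: "((\<lambda>t. lam t / t) \<longlongrightarrow> 2 * (\<Sum>j\<in>UNIV. \<bar>a j\<bar>)) at_top" .
  have pos: "2 * (\<Sum>j\<in>UNIV. \<bar>a j\<bar>) > 0"
    using assms(4) by (simp add: sum_pos)
  let ?w = "\<lambda>t. rescaled t (zero_extension \<Omega> (u t)) (d t)"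
  have "((\<lambda>t. H1_norm (\<lambda>x. ?w (A t) x - F.Q x)) \<longlongrightarrow> 0) at_top"
    using F.H1_tendsto[OF y0] by (simp add: w_eq[OF A])
  from transfer[OF this] have H1_lim: "((\<lambda>t. H1_norm (\<lambda>x. ?w t x - F.Q x)) \<longlongrightarrow> 0) at_top" .
  have "((\<lambda>t. Linf_norm (\<lambda>x. ?w (A t) x - F.Q x)) \<longlongrightarrow> 0) at_top"
    using F.Linf_tendsto[OF y0] by (simp add: w_eq[OF A])
  from transfer[OF this] have Linf_lim: "((\<lambda>t. Linf_norm (\<lambda>x. ?w t x - F.Q x)) \<longlongrightarrow> 0) at_top" .
  show ?thesis
    unfolding Let_def Q_eq
    by (intro conjI lam_lim pos w_spaces F.Q_in_spaces H1_lim Linf_lim d_lim)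
qed

end
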